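(* Let $-2<m<-1$. There exists $\gamma_*<0$ (depending on $m$) such that the boundary value problem $$f'''+(m+2)ff''-(2m+1)f'^2=0 \text{ on } [0,\infty),\qquad f(0)=-\gamma,\quad f''(0)=-1,\quad f'(\infty)=0$$ has no solution for $\gamma>\gamma_*$; one and only one solution, which is bounded, for $\gamma=\gamma_*$; and two bounded solutions and infinitely many unbounded solutions for $\gamma<\gamma_*$.
   Context: Here $m,\gamma$ are real numbers and $f'(\infty):=\lim_{t\to\infty}f'(t)$. A solution is a three times differentiable function $f:[0,\infty)\to\mathbb{R}$ satisfying the differential equation on $[0,\infty)$ together with all three boundary conditions; $f'(0)$ is not prescribed. Bounded/unbounded refers to boundedness of $f$ on $[0,\infty)$. *)

theory Defs
  imports "HOL-Analysis.Analysis"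
begin

definition is_bvp_solution :: "real \<Rightarrow> real \<Rightarrow> (real \<Rightarrow> real) \<Rightarrow> bool" where
  "is_bvp_solution m \<gamma> f \<longleftrightarrow>
     (\<exists>f1 f2 f3.
        (\<forall>t\<ge>0. (f has_real_derivative f1 t) (at t within {0..})) \<and>
        (\<forall>t\<ge>0. (f1 has_real_derivative f2 t) (at t within {0..})) \<and>
        (\<forall>t\<ge>0. (f2 has_real_derivative f3 t) (at t within {0..})) \<and>
        (\<forall>t\<ge>0. f3 t + (m + 2) * f t * f2 t - (2 * m + 1) * (f1 t)\<^sup>2 = 0) \<and>
        f 0 = - \<gamma> \<and>
        f2 0 = - 1 \<and>
        (f1 \<longlongrightarrow> 0) at_top)"

(* Functions with domain [0, oo) are represented by extensional functions, i.e. functions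
   equal to undefined on the negative reals. Without this normalisation a single solution
   on [0, oo) would be counted once for each of its extensions to the whole line. *)
definition bvp_solutions :: "real \<Rightarrow> real \<Rightarrow> (real \<Rightarrow> real) set" where
  "bvp_solutions m \<gamma> = {f \<in> extensional {0..}. is_bvp_solution m \<gamma> f}"

definition bounded_on_half_line :: "(real \<Rightarrow> real) \<Rightarrow> bool" where
  "bounded_on_half_line f \<longleftrightarrow> bounded (f ` {0..})"

end

(* With a = m + 2 and b = -(2m + 1) the equation reads f''' + a f f'' + b f'^2 = 0 with 0 < a < b.
   A solution is concave and increasing, and f(0) > 0: otherwise its orbit in the plane below would
   come in from u = infinity.  As the equation is invariant under translations and under
   f(t) -> k f(k t), the variables u = f'/f^2 and q = f''/(f f') satisfy a planar autonomous system.
   The bounded solutions form the stable manifold of its equilibrium (0, -a).  This manifold is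
   obtained near the equilibrium from a power series in exp(-a t) and continued backwards until
   f'' = 0, which happens while f > 0 because f'' + a f f' is decreasing with limit 0.  It is the
   graph of a function of u, and the difference between q and this function satisfies a linear
   equation along every orbit: orbits below the graph carry no solution, the graph carries the
   bounded solutions, and orbits above it carry unbounded ones.  The invariant u q = f''/f^3 equals
   -1/f(0)^3 at t = 0; along the graph it falls from 0 to a single minimum and rises back to 0, and
   this minimum determines gamma_*. *)
theory Submission
  imports Defs
begin

section \<open>Global solutions of Lipschitz equations\<close>

text \<open>The equilibrium (0, -a) is a saddle, with eigenvalue -a along the separatrix and a in
  the direction of q. Solutions near the separatrix drift away from it, so it is built explicitly
  instead of as a limit of solutions, and the expansion at rate a is what singles out the bounded
  ones. Fixing f(0) = d and f''(0) = -1 leaves f'(0) free and confines the starting point to the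
  hyperbola u q = -1/d^3. A point of it is named by the time t at which the reference orbit has the
  same u. Its position relative to the separatrix is then the comparison of one function of t,
  \<open>level\<close>, with -1/d^3. Equality gives a bounded solution, \<open>level t\<close> <
  -1/d^3 an unbounded one. The value d = -gamma_* is the one for which -1/d^3 is the minimum of
  \<open>level\<close>; for larger d there are two points of equality, and every point between them
  is unbounded. The obstacle is that the derivative of \<open>level\<close> has no evident sign.
  Divided by a suitable positive factor, it satisfies a linear differential inequality, which allows
  one change of sign. The same device, y' <= p y transporting the sign of y, gives concavity, the
  invariance of both sides of the separatrix and the positivity of f'.\<close>

lemma integral_from_zero_has_vector_derivative:
  fixes g :: "real \<Rightarrow> 'a::banach"
  assumes "continuous_on UNIV g" and "0 \<le> t"
  shows "((\<lambda>u. integral {0..u} g) has_vector_derivative g t) (at t within {0..})"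
proof -
  have "((\<lambda>u. integral {0..u} g) has_vector_derivative g t) (at t within {0..t + 1})"
    using assms by (intro integral_has_vector_derivative continuous_on_subset[OF assms(1)]) auto
  moreover have "at t within {0..t + 1} = at t within {0..}"
    by (rule at_within_nhd[of _ "{..<t + 1}"]) auto
  ultimately show ?thesis by simp
qed

text \<open>A weighted norm makes one contraction serve the whole half-line: the unknown is z(t) =
  exp(-k t) y(t) in the space of bounded continuous functions. With k = L + 1 the Picard map
  contracts by L / k < 1, so no continuation of local solutions is needed.\<close>

lemma picard_global:
  fixes G :: "'a::banach \<Rightarrow> 'a"
  assumes lip: "L-lipschitz_on UNIV G"
  shows "\<exists>y. y 0 = y0 \<and> (\<forall>t\<ge>0. (y has_vector_derivative G (y t)) (at t within {0..}))"
proof -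
  have L: "0 \<le> L" using lip by (rule lipschitz_on_nonneg)
  define k where "k = L + 1"
  have k: "0 < k" using L by (simp add: k_def)
  have contG: "continuous_on UNIV G" by (rule lipschitz_on_continuous_on[OF lip])
  define W where "W z s = G (exp (k * s) *\<^sub>R apply_bcontfun z s)" for z s
  have contW: "continuous_on UNIV (W z)" for z
    unfolding W_def by (intro continuous_on_compose2[OF contG] continuous_intros) auto
  have intW: "W z integrable_on {0..t}" for z t
    by (intro integrable_continuous_real continuous_on_subset[OF contW]) auto
  have exp_int: "((\<lambda>s. C * exp (k * s)) has_integral (C / k * exp (k * t) - C / k * exp (k * 0))) {0..t}"
    if "0 \<le> t" for C t
    by (rule fundamental_theorem_of_calculus)
       (use that k in \<open>auto intro!: derivative_eq_intros simp flip: has_real_derivative_iff_has_vector_derivative\<close>)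
  have exp_bound: "norm (integral {0..t} f) \<le> C / k * exp (k * t)"
    if "0 \<le> t" "f integrable_on {0..t}" "0 \<le> C" "\<And>s. s \<in> {0..t} \<Longrightarrow> norm (f s) \<le> C * exp (k * s)"
    for f :: "real \<Rightarrow> 'a" and C t
  proof -
    have "norm (integral {0..t} f) \<le> integral {0..t} (\<lambda>s. C * exp (k * s))"
      using that exp_int[OF that(1), of C] by (intro integral_norm_bound_integral) auto
    also have "\<dots> = C / k * exp (k * t) - C / k * exp (k * 0)"
      using exp_int[OF that(1)] by (rule integral_unique)
    also have "\<dots> \<le> C / k * exp (k * t)" using that k by simp
    finally show ?thesis .
  qed
  \<comment> \<open>\<open>max 0 t\<close> extends the Picard map constantly to negative times,
    because \<open>bcontfun\<close> lives on the whole line; only t >= 0 is read off at the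
    end.\<close>
  define P where "P z t = exp (- k * max 0 t) *\<^sub>R (y0 + integral {0..max 0 t} (W z))" for z t
  have P_in: "P z \<in> bcontfun" for z
  proof (rule bcontfun_normI)
    have "continuous_on {0..} (\<lambda>u. integral {0..u} (W z))"
      unfolding continuous_on_eq_continuous_within
      by (auto intro!: has_vector_derivative_continuous integral_from_zero_has_vector_derivative contW)
    then have "continuous_on UNIV (\<lambda>t. integral {0..max 0 t} (W z))"
      by (rule continuous_on_compose2) (auto intro!: continuous_intros)
    then show "continuous_on UNIV (P z)" unfolding P_def
      by (intro continuous_on_scaleR continuous_on_add continuous_on_const) (intro continuous_intros)
    show "norm (P z t) \<le> norm y0 + (norm (G 0) + L * norm z) / k" for t
    proof -
      define u where "u = max 0 t"
      have u: "0 \<le> u" by (simp add: u_def)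
      have "norm (W z s) \<le> (norm (G 0) + L * norm z) * exp (k * s)" if "s \<in> {0..u}" for s
      proof -
        have e: "1 \<le> exp (k * s)" using that k by simp
        have "norm (W z s) \<le> norm (G 0) + norm (W z s - G 0)"
          by (metis norm_triangle_sub)
        also have "norm (W z s - G 0) \<le> L * norm (exp (k * s) *\<^sub>R apply_bcontfun z s)"
          using lipschitz_onD[OF lip, of "exp (k * s) *\<^sub>R apply_bcontfun z s" 0] by (simp add: W_def dist_norm)
        also have "\<dots> \<le> L * (exp (k * s) * norm z)"
          using L norm_bounded[of z s] by (intro mult_left_mono) auto
        also have "norm (G 0) \<le> norm (G 0) * exp (k * s)"
          using e by (simp add: mult_le_cancel_left1)
        finally show ?thesis by (simp add: algebra_simps)
      qed
      then have I: "norm (integral {0..u} (W z)) \<le> (norm (G 0) + L * norm z) / k * exp (k * u)"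
        using L by (intro exp_bound u intW) auto
      have "norm (P z t) \<le> exp (- k * u) * (norm y0 + (norm (G 0) + L * norm z) / k * exp (k * u))"
        unfolding P_def u_def[symmetric] using I
        by (simp add: norm_triangle_le)
      also have "\<dots> = exp (- k * u) * norm y0 + (norm (G 0) + L * norm z) / k * (exp (- k * u) * exp (k * u))"
        by (simp add: algebra_simps)
      also have "exp (- k * u) * exp (k * u) = 1" by (simp flip: exp_add)
      also have "exp (- k * u) * norm y0 \<le> norm y0" using k u by (simp add: mult_left_le_one_le)
      finally show ?thesis by simp
    qed
  qed
  define F where "F z = Bcontfun (P z)" for z
  have F: "apply_bcontfun (F z) = P z" for z
    unfolding F_def using P_in by (simp add: Bcontfun_inverse)
  have contr: "dist (F z) (F w) \<le> L / k * dist z w" for z w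
  proof (rule dist_bound)
    fix t :: real
    define u where "u = max 0 t"
    have u: "0 \<le> u" by (simp add: u_def)
    have "norm (W z s - W w s) \<le> (L * dist z w) * exp (k * s)" for s
    proof -
      have "norm (W z s - W w s) \<le> L * norm (exp (k * s) *\<^sub>R apply_bcontfun z s - exp (k * s) *\<^sub>R apply_bcontfun w s)"
        using lipschitz_onD[OF lip] by (simp add: W_def dist_norm)
      also have "\<dots> = L * (exp (k * s) * dist (apply_bcontfun z s) (apply_bcontfun w s))"
        by (simp add: dist_norm flip: scaleR_diff_right)
      also have "\<dots> \<le> L * (exp (k * s) * dist z w)"
        using L dist_bounded[of z s w] by (intro mult_left_mono) auto
      finally show ?thesis by (simp add: algebra_simps)
    qed
    then have "norm (integral {0..u} (\<lambda>s. W z s - W w s)) \<le> (L * dist z w) / k * exp (k * u)"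
      using L by (intro exp_bound u integrable_diff intW) auto
    then have I: "norm (integral {0..u} (W z) - integral {0..u} (W w)) \<le> (L * dist z w) / k * exp (k * u)"
      by (simp add: integral_diff intW)
    have "dist (P z t) (P w t) = exp (- k * u) * norm (integral {0..u} (W z) - integral {0..u} (W w))"
      unfolding P_def u_def[symmetric] by (simp add: dist_norm flip: scaleR_diff_right)
    also have "\<dots> \<le> exp (- k * u) * ((L * dist z w) / k * exp (k * u))"
      using I by (intro mult_left_mono) auto
    also have "\<dots> = L / k * dist z w * (exp (- k * u) * exp (k * u))" by simp
    also have "exp (- k * u) * exp (k * u) = 1" by (simp flip: exp_add)
    finally show "dist (apply_bcontfun (F z) t) (apply_bcontfun (F w) t) \<le> L / k * dist z w"
      by (simp add: F)
  qed
  have "\<exists>!z\<in>UNIV. F z = z"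
    by (rule Banach_fix[where c = "L / k"]) (use L k contr in \<open>auto simp: k_def complete_UNIV\<close>)
  then obtain z where z: "F z = z" by auto
  define y where "y t = y0 + integral {0..t} (W z)" for t
  have y_eq: "exp (k * t) *\<^sub>R apply_bcontfun z t = y t" if "0 \<le> t" for t
  proof -
    have "apply_bcontfun z t = exp (- k * t) *\<^sub>R y t"
      using F[of z] that by (simp add: z P_def y_def)
    then show ?thesis by (simp flip: exp_add)
  qed
  have "(y has_vector_derivative G (y t)) (at t within {0..})" if "0 \<le> t" for t
    unfolding y_eq[OF that, symmetric] unfolding y_def W_def[symmetric]
    by (auto intro!: derivative_eq_intros integral_from_zero_has_vector_derivative contW that)
  moreover have "y 0 = y0" by (simp add: y_def)
  ultimately show ?thesis by blast
qed

section \<open>Linear differential inequalities and first hitting times\<close>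

lemma antiderivative_real:
  fixes p :: "real \<Rightarrow> real"
  assumes "continuous_on {s..t} p"
  obtains P where "continuous_on {s..t} P" "\<And>x. s < x \<Longrightarrow> x < t \<Longrightarrow> (P has_real_derivative p x) (at x)"
proof -
  obtain P where P: "\<And>x. x \<in> {s..t} \<Longrightarrow> (P has_vector_derivative p x) (at x within {s..t})"
    using antiderivative_continuous[OF assms] by blast
  show thesis
  proof
    show "continuous_on {s..t} P"
      unfolding continuous_on_eq_continuous_within
      using P has_vector_derivative_continuous by blast
    show "(P has_real_derivative p x) (at x)" if "s < x" "x < t" for x
      using P[of x] that by (simp add: has_real_derivative_iff_has_vector_derivative at_within_Icc_at)
  qed
qed

text \<open>Integrating factor exp(-P) with P' = p. Only the positivity of k matters later: the
  inequality carries the sign of y from s to t, and it is used for \<open>y\<close> and for its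
  negative.\<close>

lemma lin_diff_ineq:
  fixes y p :: "real \<Rightarrow> real"
  assumes "s \<le> t" and y: "continuous_on {s..t} y" and p: "continuous_on {s..t} p"
    and der: "\<And>x. s < x \<Longrightarrow> x < t \<Longrightarrow> \<exists>D. (y has_real_derivative D) (at x) \<and> D \<le> p x * y x"
  shows "\<exists>k>0. y t \<le> k * y s"
proof -
  obtain P where contP: "continuous_on {s..t} P"
    and P: "\<And>x. s < x \<Longrightarrow> x < t \<Longrightarrow> (P has_real_derivative p x) (at x)"
    using antiderivative_real[OF p] by blast
  have "y t * exp (- P t) \<le> y s * exp (- P s)"
  proof (rule DERIV_nonpos_imp_decreasing_open[OF \<open>s \<le> t\<close>])
    fix x assume x: "s < x" "x < t"
    then obtain D where D: "(y has_real_derivative D) (at x)" "D \<le> p x * y x" using der by blast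
    have "((\<lambda>x. y x * exp (- P x)) has_real_derivative (D - p x * y x) * exp (- P x)) (at x)"
      using D(1) P[OF x] by (auto intro!: derivative_eq_intros simp: algebra_simps)
    then show "\<exists>z. ((\<lambda>x. y x * exp (- P x)) has_real_derivative z) (at x) \<and> z \<le> 0"
      using D(2) by (intro exI conjI) (auto simp: mult_le_0_iff)
  qed (intro continuous_intros y contP)
  then have "y t \<le> exp (P t - P s) * y s"
    by (simp add: exp_diff exp_minus field_simps)
  then show ?thesis by (intro exI[of _ "exp (P t - P s)"]) simp
qed

lemma lin_diff_ineq_strict:
  fixes y p :: "real \<Rightarrow> real"
  assumes "s < t" and y: "continuous_on {s..t} y" and p: "continuous_on {s..t} p"
    and der: "\<And>x. s < x \<Longrightarrow> x < t \<Longrightarrow> \<exists>D. (y has_real_derivative D) (at x) \<and> D < p x * y x"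
  shows "\<exists>k>0. y t < k * y s"
proof -
  obtain P where contP: "continuous_on {s..t} P"
    and P: "\<And>x. s < x \<Longrightarrow> x < t \<Longrightarrow> (P has_real_derivative p x) (at x)"
    using antiderivative_real[OF p] by blast
  have "y t * exp (- P t) < y s * exp (- P s)"
  proof (rule DERIV_neg_imp_decreasing_open[OF \<open>s < t\<close>])
    fix x assume x: "s < x" "x < t"
    then obtain D where D: "(y has_real_derivative D) (at x)" "D < p x * y x" using der by blast
    have "((\<lambda>x. y x * exp (- P x)) has_real_derivative (D - p x * y x) * exp (- P x)) (at x)"
      using D(1) P[OF x] by (auto intro!: derivative_eq_intros simp: algebra_simps)
    then show "\<exists>z. ((\<lambda>x. y x * exp (- P x)) has_real_derivative z) (at x) \<and> z < 0"
      using D(2) by (intro exI conjI) (auto simp: mult_less_0_iff)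
  qed (intro continuous_intros y contP)
  then have "y t < exp (P t - P s) * y s"
    by (simp add: exp_diff exp_minus field_simps)
  then show ?thesis by (intro exI[of _ "exp (P t - P s)"]) simp
qed

lemma first_hit:
  fixes N :: "real \<Rightarrow> real"
  assumes cont: "continuous_on {s..t} N" and "N s < R" and ex: "r \<in> {s..t}" "R \<le> N r"
  shows "\<exists>\<tau>\<in>{s..t}. s < \<tau> \<and> N \<tau> = R \<and> (\<forall>x\<in>{s..<\<tau>}. N x < R)"
proof -
  define A where "A = {x \<in> {s..t}. R \<le> N x}"
  have "compact A"
  proof -
    have "closed ({s..t} \<inter> N -` {R..})"
      by (intro continuous_closed_preimage cont) auto
    moreover have "A = {s..t} \<inter> N -` {R..}" by (auto simp: A_def)
    ultimately have "closed A" by simp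
    moreover have "bounded A" by (rule bounded_subset[of "{s..t}"]) (auto simp: A_def)
    ultimately show ?thesis by (simp add: compact_eq_bounded_closed)
  qed
  moreover have "A \<noteq> {}" using ex by (auto simp: A_def)
  ultimately obtain \<tau> where \<tau>: "\<tau> \<in> A" "\<And>x. x \<in> A \<Longrightarrow> \<tau> \<le> x"
    using compact_attains_inf by metis
  have lt: "N x < R" if "x \<in> {s..<\<tau>}" for x
    using \<tau>(1) \<tau>(2)[of x] that by (force simp: A_def)
  have "s < \<tau>" using \<tau>(1) assms(2) by (cases "s = \<tau>") (auto simp: A_def)
  obtain x where x: "s \<le> x" "x \<le> \<tau>" "N x = R"
    using IVT'[of N s R \<tau>] \<tau>(1) assms(2) continuous_on_subset[OF cont, of "{s..\<tau>}"] by (auto simp: A_def)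
  then have "x = \<tau>" using lt[of x] by force
  then show ?thesis using x \<tau>(1) lt \<open>s < \<tau>\<close> by (auto simp: A_def)
qed

section \<open>The similarity equation as a first-order system\<close>

text \<open>Derivatives are taken within \<open>I\<close>, so that one predicate covers compact
  intervals with their one-sided endpoints as well as the half-line. The triple stands for f, f',
  f''; the equation itself is the prescribed derivative of \<open>h\<close>.\<close>

definition flow :: "real \<Rightarrow> real \<Rightarrow> real set \<Rightarrow> (real \<Rightarrow> real) \<Rightarrow> (real \<Rightarrow> real) \<Rightarrow> (real \<Rightarrow> real) \<Rightarrow> bool" where
  "flow a b I f g h \<longleftrightarrow> (\<forall>t\<in>I.
     (f has_real_derivative g t) (at t within I) \<and>
     (g has_real_derivative h t) (at t within I) \<and>
     (h has_real_derivative - (a * f t * h t + b * (g t)\<^sup>2)) (at t within I))"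

lemma flow_subset:
  assumes "flow a b I f g h" and "J \<subseteq> I"
  shows "flow a b J f g h"
  unfolding flow_def
proof (intro ballI conjI)
  fix t assume "t \<in> J"
  then have "t \<in> I" using assms(2) by blast
  note d = assms(1)[unfolded flow_def, rule_format, OF this]
  show "(f has_real_derivative g t) (at t within J)"
    using d by (elim conjE) (rule DERIV_subset[OF _ assms(2)])
  show "(g has_real_derivative h t) (at t within J)"
    using d by (elim conjE) (rule DERIV_subset[OF _ assms(2)])
  show "(h has_real_derivative - (a * f t * h t + b * (g t)\<^sup>2)) (at t within J)"
    using d by (elim conjE) (rule DERIV_subset[OF _ assms(2)])
qed

lemma flow_continuous:
  assumes "flow a b I f g h"
  shows "continuous_on I f" "continuous_on I g" "continuous_on I h"
proof -
  note d = assms[unfolded flow_def, rule_format]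
  show "continuous_on I f" by (rule DERIV_continuous_on[OF conjunct1[OF d]])
  show "continuous_on I g" by (rule DERIV_continuous_on[OF conjunct1[OF conjunct2[OF d]]])
  show "continuous_on I h" by (rule DERIV_continuous_on[OF conjunct2[OF conjunct2[OF d]]])
qed

lemma flow_DERIV:
  assumes "flow a b I f g h" "{s<..<t} \<subseteq> I" "s < x" "x < t"
  shows "(f has_real_derivative g x) (at x)" "(g has_real_derivative h x) (at x)"
    "(h has_real_derivative - (a * f x * h x + b * (g x)\<^sup>2)) (at x)"
proof -
  have "x \<in> interior I" using assms(2-4) by (meson greaterThanLessThan_iff interior_maximal open_greaterThanLessThan subsetD)
  then have I: "at x within I = at x" "x \<in> I"
    by (rule at_within_interior) (use \<open>x \<in> interior I\<close> interior_subset in blast)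
  note d = assms(1)[unfolded flow_def, rule_format, OF I(2), unfolded I(1)]
  show "(f has_real_derivative g x) (at x)" by (rule conjunct1[OF d])
  show "(g has_real_derivative h x) (at x)" by (rule conjunct1[OF conjunct2[OF d]])
  show "(h has_real_derivative - (a * f x * h x + b * (g x)\<^sup>2)) (at x)" by (rule conjunct2[OF conjunct2[OF d]])
qed

text \<open>Gronwall for the squared distance \<open>D\<close> of the two solutions. The difference
  of the right-hand sides is linear in the three differences, with coefficients that are continuous
  and hence bounded on the compact interval; this gives D' <= K D with D(0) = 0.\<close>

lemma flow_unique:
  assumes F: "flow a b {0..T} f g h" and F': "flow a b {0..T} f' g' h'"
    and init: "f 0 = f' 0" "g 0 = g' 0" "h 0 = h' 0" and t: "t \<in> {0..T}"
  shows "f t = f' t" "g t = g' t" "h t = h' t"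
proof -
  have bdd: "\<exists>B\<ge>0. \<forall>x\<in>{0..T}. \<bar>u x\<bar> \<le> B" if "continuous_on {0..T} u" for u :: "real \<Rightarrow> real"
  proof -
    have "bounded (u ` {0..T})" using that by (intro compact_imp_bounded compact_continuous_image) auto
    then obtain B where "B > 0" "\<forall>x\<in>u ` {0..T}. norm x \<le> B" unfolding bounded_pos by blast
    then show ?thesis by (intro exI[of _ B]) auto
  qed
  obtain A where A: "A \<ge> 0" "\<And>x. x \<in> {0..T} \<Longrightarrow> \<bar>a * h x\<bar> \<le> A"
    using bdd[OF continuous_on_mult[OF continuous_on_const flow_continuous(3)[OF F]], of a] by blast
  obtain B where B: "B \<ge> 0" "\<And>x. x \<in> {0..T} \<Longrightarrow> \<bar>b * (g x + g' x)\<bar> \<le> B"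
    using bdd[OF continuous_on_mult[OF continuous_on_const continuous_on_add[OF flow_continuous(2)[OF F] flow_continuous(2)[OF F']]], of b] by blast
  obtain C where C: "C \<ge> 0" "\<And>x. x \<in> {0..T} \<Longrightarrow> \<bar>a * f' x\<bar> \<le> C"
    using bdd[OF continuous_on_mult[OF continuous_on_const flow_continuous(1)[OF F']], of a] by blast
  define D where "D x = (f x - f' x)\<^sup>2 + (g x - g' x)\<^sup>2 + (h x - h' x)\<^sup>2" for x
  have "\<exists>k>0. D t \<le> k * D 0"
  proof (rule lin_diff_ineq[where y = D and s = 0 and t = t and p = "\<lambda>_. 2 + A + B + 2 * C"])
    show "continuous_on {0..t} D" unfolding D_def
      by (intro continuous_intros continuous_on_subset[OF flow_continuous(1)[OF F]]
          continuous_on_subset[OF flow_continuous(1)[OF F']]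
          continuous_on_subset[OF flow_continuous(2)[OF F]]
          continuous_on_subset[OF flow_continuous(2)[OF F']]
          continuous_on_subset[OF flow_continuous(3)[OF F]]
          continuous_on_subset[OF flow_continuous(3)[OF F']]) (use t in auto)
    fix x assume x: "0 < x" "x < t"
    then have xT: "x \<in> {0..T}" and sub: "{0<..<t} \<subseteq> {0..T}" using t by auto
    define p q r where "p = f x - f' x" and "q = g x - g' x" and "r = h x - h' x"
    note d = flow_DERIV[OF F sub x] flow_DERIV[OF F' sub x]
    have "(D has_real_derivative (2 * p * q + 2 * q * r +
      2 * r * (- (a * f x * h x + b * (g x)\<^sup>2) + (a * f' x * h' x + b * (g' x)\<^sup>2)))) (at x)"
      unfolding D_def p_def q_def r_def using d by (auto intro!: derivative_eq_intros simp: algebra_simps)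
    also have "- (a * f x * h x + b * (g x)\<^sup>2) + (a * f' x * h' x + b * (g' x)\<^sup>2)
      = - ((a * h x) * p + (a * f' x) * r + (b * (g x + g' x)) * q)"
      unfolding p_def q_def r_def by (simp add: algebra_simps power2_eq_square)
    finally have der: "(D has_real_derivative (2 * p * q + 2 * q * r +
      2 * r * - ((a * h x) * p + (a * f' x) * r + (b * (g x + g' x)) * q))) (at x)" .
    \<comment> \<open>Each mixed term of D' is absorbed into squares by 2uv <= u^2 + v^2.\<close>
    have cs: "2 * (c * (u * v)) \<le> K * (u\<^sup>2 + v\<^sup>2)" if "\<bar>c\<bar> \<le> K" for c K u v :: real
    proof -
      have "2 * (c * (u * v)) \<le> \<bar>c\<bar> * (2 * \<bar>u * v\<bar>)"
        by (metis abs_ge_self abs_mult mult.left_commute mult.assoc abs_numeral)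
      also have "\<dots> \<le> \<bar>c\<bar> * (u\<^sup>2 + v\<^sup>2)"
        by (intro mult_left_mono) (use sum_squares_bound[of "\<bar>u\<bar>" "\<bar>v\<bar>"] in \<open>auto simp: abs_mult\<close>)
      also have "\<dots> \<le> K * (u\<^sup>2 + v\<^sup>2)" using that by (intro mult_right_mono) auto
      finally show ?thesis .
    qed
    have "2 * p * q + 2 * q * r + 2 * r * - ((a * h x) * p + (a * f' x) * r + (b * (g x + g' x)) * q)
      = 2 * (1 * (p * q)) + 2 * (1 * (q * r)) + 2 * (- (a * h x) * (r * p)) + 2 * (- (a * f' x) * (r * r))
        + 2 * (- (b * (g x + g' x)) * (r * q))" by (simp add: algebra_simps)
    also have "\<dots> \<le> 1 * (p\<^sup>2 + q\<^sup>2) + 1 * (q\<^sup>2 + r\<^sup>2) + A * (r\<^sup>2 + p\<^sup>2) + C * (r\<^sup>2 + r\<^sup>2) + B * (r\<^sup>2 + q\<^sup>2)"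
      by (intro add_mono cs) (use A(2)[OF xT] B(2)[OF xT] C(2)[OF xT] in auto)
    also have "\<dots> \<le> (2 + A + B + 2 * C) * (p\<^sup>2 + q\<^sup>2 + r\<^sup>2)"
    proof -
      have "(2 + A + B + 2 * C) * (p\<^sup>2 + q\<^sup>2 + r\<^sup>2) - (1 * (p\<^sup>2 + q\<^sup>2) + 1 * (q\<^sup>2 + r\<^sup>2) + A * (r\<^sup>2 + p\<^sup>2) + C * (r\<^sup>2 + r\<^sup>2) + B * (r\<^sup>2 + q\<^sup>2))
         = p\<^sup>2 + r\<^sup>2 + A * q\<^sup>2 + B * p\<^sup>2 + 2 * C * p\<^sup>2 + 2 * C * q\<^sup>2" by (simp add: algebra_simps)
      moreover have "\<dots> \<ge> 0" using A(1) B(1) C(1) by simp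
      ultimately show ?thesis by linarith
    qed
    finally show "\<exists>E. (D has_real_derivative E) (at x) \<and> E \<le> (2 + A + B + 2 * C) * D x"
      using der unfolding D_def p_def q_def r_def by blast
  qed (use t in auto)
  moreover have "D 0 = 0" by (simp add: D_def init)
  ultimately have "D t \<le> 0" by auto
  then show "f t = f' t" "g t = g' t" "h t = h' t"
    unfolding D_def by (smt (verit) zero_le_power2 power2_eq_iff_nonneg zero_eq_power2)+
qed

text \<open>The vector field is only locally Lipschitz. Clamping every coordinate to [-R, R] by
  \<open>c\<close> makes it globally Lipschitz, and the clamped solution solves the true system
  until a coordinate reaches size R. The final alternative is the form in which this is used: an a
  priori bound below R excludes the exit and forces \<tau> = T.\<close>

lemma flow_local:
  assumes init: "\<bar>x\<bar> < R" "\<bar>y\<bar> < R" "\<bar>z\<bar> < R" and T: "0 < T"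
  shows "\<exists>f g h \<tau>. 0 < \<tau> \<and> \<tau> \<le> T \<and> flow a b {0..\<tau>} f g h \<and> f 0 = x \<and> g 0 = y \<and> h 0 = z \<and>
    (\<forall>t\<in>{0..\<tau>}. \<bar>f t\<bar> \<le> R \<and> \<bar>g t\<bar> \<le> R \<and> \<bar>h t\<bar> \<le> R) \<and>
    (\<tau> = T \<or> \<bar>f \<tau>\<bar> = R \<or> \<bar>g \<tau>\<bar> = R \<or> \<bar>h \<tau>\<bar> = R)"
proof -
  have R: "0 < R" using init by linarith
  define c where "c s = max (- R) (min R s)" for s
  have c1: "\<bar>c s - c t\<bar> \<le> \<bar>s - t\<bar>" and c2: "\<bar>c s\<bar> \<le> R" for s t
    using R by (auto simp: c_def)
  have c3: "c s = s" if "\<bar>s\<bar> \<le> R" for s using that by (auto simp: c_def)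
  define G where "G = (\<lambda>v :: real \<times> real \<times> real. (c (fst (snd v)), c (snd (snd v)),
     - (a * c (fst v) * c (snd (snd v)) + b * (c (fst (snd v)))\<^sup>2)))"
  have "(1 + 1 + (2 * \<bar>a\<bar> * R + 2 * \<bar>b\<bar> * R))-lipschitz_on UNIV G"
  proof (rule lipschitz_onI)
    fix v w :: "real \<times> real \<times> real"
    define d where "d = dist v w"
    have d: "\<bar>fst v - fst w\<bar> \<le> d" "\<bar>fst (snd v) - fst (snd w)\<bar> \<le> d" "\<bar>snd (snd v) - snd (snd w)\<bar> \<le> d"
      using dist_fst_le[of v w] dist_snd_le[of v w] dist_fst_le[of "snd v" "snd w"] dist_snd_le[of "snd v" "snd w"]
      by (auto simp: d_def dist_real_def)
    have e: "\<bar>c (fst v) - c (fst w)\<bar> \<le> d" "\<bar>c (fst (snd v)) - c (fst (snd w))\<bar> \<le> d"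
      "\<bar>c (snd (snd v)) - c (snd (snd w))\<bar> \<le> d"
      using d c1 order_trans by blast+
    have prod: "\<bar>c s * c t - c s' * c t'\<bar> \<le> 2 * R * d" if "\<bar>c s - c s'\<bar> \<le> d" "\<bar>c t - c t'\<bar> \<le> d" for s t s' t'
    proof -
      have "c s * c t - c s' * c t' = c s * (c t - c t') + (c s - c s') * c t'" by (simp add: algebra_simps)
      also have "\<bar>\<dots>\<bar> \<le> \<bar>c s\<bar> * \<bar>c t - c t'\<bar> + \<bar>c s - c s'\<bar> * \<bar>c t'\<bar>"
        by (metis abs_mult abs_triangle_ineq)
      also have "\<dots> \<le> R * d + d * R" using that c2 R by (intro add_mono mult_mono) auto
      finally show ?thesis by simp
    qed
    define X where "X = c (fst v) * c (snd (snd v)) - c (fst w) * c (snd (snd w))"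
    define Y where "Y = c (fst (snd v)) * c (fst (snd v)) - c (fst (snd w)) * c (fst (snd w))"
    define Z where "Z = - (a * c (fst v) * c (snd (snd v)) + b * (c (fst (snd v)))\<^sup>2)
      + (a * c (fst w) * c (snd (snd w)) + b * (c (fst (snd w)))\<^sup>2)"
    have "Z = - (a * X + b * Y)"
      unfolding X_def Y_def Z_def by (simp add: algebra_simps power2_eq_square)
    then have "\<bar>Z\<bar> = \<bar>a * X + b * Y\<bar>" by (simp only: abs_minus_cancel)
    also have "\<dots> \<le> \<bar>a\<bar> * \<bar>X\<bar> + \<bar>b\<bar> * \<bar>Y\<bar>"
      using abs_triangle_ineq[of "a * X" "b * Y"] by (simp add: abs_mult)
    also have "\<dots> \<le> \<bar>a\<bar> * (2 * R * d) + \<bar>b\<bar> * (2 * R * d)"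
      unfolding X_def Y_def by (intro add_mono mult_left_mono prod e) auto
    finally have third: "\<bar>Z\<bar> \<le> (2 * \<bar>a\<bar> * R + 2 * \<bar>b\<bar> * R) * d" by (simp add: algebra_simps)
    have n3: "norm (p, q, r) \<le> \<bar>p\<bar> + \<bar>q\<bar> + \<bar>r\<bar>" for p q r :: real
      using norm_Pair_le[of p "(q, r)"] norm_Pair_le[of q r] by simp
    have "dist (G v) (G w) = norm (G v - G w)" by (rule dist_norm)
    also have "\<dots> \<le> \<bar>c (fst (snd v)) - c (fst (snd w))\<bar> + \<bar>c (snd (snd v)) - c (snd (snd w))\<bar> +
      \<bar>Z\<bar>"
    proof -
      have "G v - G w = (c (fst (snd v)) - c (fst (snd w)), c (snd (snd v)) - c (snd (snd w)), Z)"
        by (simp add: G_def Z_def)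
      then show ?thesis using n3 by simp
    qed
    also have "\<dots> \<le> d + d + (2 * \<bar>a\<bar> * R + 2 * \<bar>b\<bar> * R) * d" using e third by linarith
    also have "\<dots> = (1 + 1 + (2 * \<bar>a\<bar> * R + 2 * \<bar>b\<bar> * R)) * dist v w" by (simp add: d_def algebra_simps)
    finally show "dist (G v) (G w) \<le> (1 + 1 + (2 * \<bar>a\<bar> * R + 2 * \<bar>b\<bar> * R)) * dist v w" .
  qed (use R in auto)
  then obtain Y where Y0: "Y 0 = (x, y, z)" and Y: "\<And>t. 0 \<le> t \<Longrightarrow> (Y has_vector_derivative G (Y t)) (at t within {0..})"
    using picard_global by blast
  define f g h where "f t = fst (Y t)" and "g t = fst (snd (Y t))" and "h t = snd (snd (Y t))" for t
  have der: "(f has_real_derivative c (g t)) (at t within {0..})" "(g has_real_derivative c (h t)) (at t within {0..})"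
    "(h has_real_derivative - (a * c (f t) * c (h t) + b * (c (g t))\<^sup>2)) (at t within {0..})" if "0 \<le> t" for t
  proof -
    have Y': "(Y has_derivative (\<lambda>s. s *\<^sub>R G (Y t))) (at t within {0..})"
      using Y[OF that] by (simp add: has_vector_derivative_def)
    show "(f has_real_derivative c (g t)) (at t within {0..})"
      using has_derivative_fst[OF Y'] unfolding has_real_derivative_iff_has_vector_derivative has_vector_derivative_def
      by (simp add: f_def[abs_def] g_def G_def)
    show "(g has_real_derivative c (h t)) (at t within {0..})"
      using has_derivative_fst[OF has_derivative_snd[OF Y']] unfolding has_real_derivative_iff_has_vector_derivative has_vector_derivative_def
      by (simp add: h_def g_def[abs_def] G_def)
    show "(h has_real_derivative - (a * c (f t) * c (h t) + b * (c (g t))\<^sup>2)) (at t within {0..})"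
      using has_derivative_snd[OF has_derivative_snd[OF Y']] unfolding has_real_derivative_iff_has_vector_derivative has_vector_derivative_def
      by (simp add: h_def[abs_def] g_def f_def G_def)
  qed
  have cont: "continuous_on {0..} f" "continuous_on {0..} g" "continuous_on {0..} h"
    by (rule DERIV_continuous_on, use der in force)+
  define N where "N t = max \<bar>f t\<bar> (max \<bar>g t\<bar> \<bar>h t\<bar>)" for t
  have contN: "continuous_on {0..T} N" unfolding N_def
    by (intro continuous_intros) (auto intro: cont[THEN continuous_on_subset])
  have N0: "N 0 < R" using init by (simp add: N_def f_def g_def h_def Y0)
  have flow: "flow a b {0..\<tau>} f g h" if "\<forall>t\<in>{0..\<tau>}. N t \<le> R" for \<tau>
    unfolding flow_def
  proof
    fix t assume t: "t \<in> {0..\<tau>}"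
    then have "N t \<le> R" using that by blast
    then have "c (f t) = f t" "c (g t) = g t" "c (h t) = h t" by (auto simp: N_def intro!: c3)
    then show "(f has_real_derivative g t) (at t within {0..\<tau>}) \<and> (g has_real_derivative h t) (at t within {0..\<tau>}) \<and>
       (h has_real_derivative - (a * f t * h t + b * (g t)\<^sup>2)) (at t within {0..\<tau>})"
      using der[of t] t DERIV_subset[of _ _ t "{0..}" "{0..\<tau>}"] by auto
  qed
  have init': "f 0 = x" "g 0 = y" "h 0 = z" by (simp_all add: f_def g_def h_def Y0)
  have main: "\<exists>\<tau>. 0 < \<tau> \<and> \<tau> \<le> T \<and> (\<forall>t\<in>{0..\<tau>}. N t \<le> R) \<and> (\<tau> = T \<or> N \<tau> = R)"
  proof (cases "\<exists>r\<in>{0..T}. R \<le> N r")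
    case True
    then obtain \<tau> where "\<tau> \<in> {0..T}" "0 < \<tau>" "N \<tau> = R" "\<forall>x\<in>{0..<\<tau>}. N x < R"
      using first_hit[OF contN N0] by blast
    then show ?thesis by (intro exI[of _ \<tau>]) (auto simp: order_le_less)
  next
    case False
    then show ?thesis using T by (intro exI[of _ T]) force
  qed
  then obtain \<tau> where \<tau>: "0 < \<tau>" "\<tau> \<le> T" "\<forall>t\<in>{0..\<tau>}. N t \<le> R" "\<tau> = T \<or> N \<tau> = R" by blast
  have "\<tau> = T \<or> \<bar>f \<tau>\<bar> = R \<or> \<bar>g \<tau>\<bar> = R \<or> \<bar>h \<tau>\<bar> = R" using \<tau>(4) by (auto simp: N_def max_def split: if_splits)
  moreover have "\<forall>t\<in>{0..\<tau>}. \<bar>f t\<bar> \<le> R \<and> \<bar>g t\<bar> \<le> R \<and> \<bar>h t\<bar> \<le> R" using \<tau>(3) by (auto simp: N_def)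
  ultimately show ?thesis using \<tau>(1,2) flow[OF \<tau>(3)] init' by blast
qed

section \<open>Concave solutions\<close>

lemma flow_affine:
  assumes F: "flow a b {0..} f g h" and k: "0 < k" and s: "0 \<le> s"
  shows "flow a b {0..} (\<lambda>t. k * f (k * t + s)) (\<lambda>t. k ^ 2 * g (k * t + s)) (\<lambda>t. k ^ 3 * h (k * t + s))"
proof -
  have ch: "((\<lambda>t. u (k * t + s)) has_real_derivative D * k) (at t within {0..})"
    if "(u has_real_derivative D) (at (k * t + s) within {0..})" "0 \<le> t" for u D t
  proof -
    have "((\<lambda>t. k * t + s) has_real_derivative k) (at t within {0..})"
      by (auto intro!: derivative_eq_intros)
    moreover have "(u has_real_derivative D) (at (k * t + s) within (\<lambda>t. k * t + s) ` {0..})"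
      using that(1) by (rule DERIV_subset) (use k s in auto)
    ultimately show ?thesis using DERIV_image_chain[of u D "\<lambda>t. k * t + s" t "{0..}" k]
      by (simp add: o_def)
  qed
  show ?thesis unfolding flow_def
  proof (intro ballI conjI)
    fix t :: real assume t: "t \<in> {0..}"
    then have "k * t + s \<in> {0..}" using k s by auto
    note d = F[unfolded flow_def, rule_format, OF this]
    show "((\<lambda>t. k * f (k * t + s)) has_real_derivative k ^ 2 * g (k * t + s)) (at t within {0..})"
      using DERIV_cmult[OF ch, of f "g (k * t + s)" t k] d t by (simp add: power2_eq_square mult_ac)
    show "((\<lambda>t. k ^ 2 * g (k * t + s)) has_real_derivative k ^ 3 * h (k * t + s)) (at t within {0..})"
      using DERIV_cmult[OF ch, of g "h (k * t + s)" t "k ^ 2"] d t by (simp add: power2_eq_square power3_eq_cube mult_ac)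
    show "((\<lambda>t. k ^ 3 * h (k * t + s)) has_real_derivative
        - (a * (k * f (k * t + s)) * (k ^ 3 * h (k * t + s)) + b * (k ^ 2 * g (k * t + s))\<^sup>2)) (at t within {0..})"
      using DERIV_cmult[OF ch, of h "- (a * f (k * t + s) * h (k * t + s) + b * (g (k * t + s))\<^sup>2)" t "k ^ 3"] d t
      by (simp add: power2_eq_square power3_eq_cube algebra_simps)
  qed
qed

lemma flow_shift:
  assumes "flow a b {0..} f g h" and "0 \<le> s"
  shows "flow a b {0..} (\<lambda>t. f (t + s)) (\<lambda>t. g (t + s)) (\<lambda>t. h (t + s))"
  using flow_affine[OF assms(1) _ assms(2), of 1] by simp

lemma flow_reverse:
  assumes F: "flow a b {0..\<tau>} f g h"
  shows "flow a b {0..\<tau>} (\<lambda>t. - f (\<tau> - t)) (\<lambda>t. g (\<tau> - t)) (\<lambda>t. - h (\<tau> - t))"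
proof -
  have ch: "((\<lambda>t. u (\<tau> - t)) has_real_derivative - D) (at t within {0..\<tau>})"
    if "(u has_real_derivative D) (at (\<tau> - t) within {0..\<tau>})" "t \<in> {0..\<tau>}" for u D t
  proof -
    have "((\<lambda>t. \<tau> - t) has_real_derivative - 1) (at t within {0..\<tau>})"
      by (auto intro!: derivative_eq_intros)
    moreover have "(u has_real_derivative D) (at (\<tau> - t) within (\<lambda>t. \<tau> - t) ` {0..\<tau>})"
      using that(1) by (rule DERIV_subset) auto
    ultimately show ?thesis using DERIV_image_chain[of u D "\<lambda>t. \<tau> - t" t "{0..\<tau>}" "- 1"]
      by (simp add: o_def)
  qed
  show ?thesis unfolding flow_def
  proof (intro ballI conjI)
    fix t :: real assume t: "t \<in> {0..\<tau>}"
    then have "\<tau> - t \<in> {0..\<tau>}" by auto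
    note d = F[unfolded flow_def, rule_format, OF this]
    show "((\<lambda>t. - f (\<tau> - t)) has_real_derivative g (\<tau> - t)) (at t within {0..\<tau>})"
      using DERIV_minus[OF ch, of f "g (\<tau> - t)" t] d t by simp
    show "((\<lambda>t. g (\<tau> - t)) has_real_derivative - h (\<tau> - t)) (at t within {0..\<tau>})"
      using ch[of g "h (\<tau> - t)" t] d t by simp
    show "((\<lambda>t. - h (\<tau> - t)) has_real_derivative
        - (a * - f (\<tau> - t) * - h (\<tau> - t) + b * (g (\<tau> - t))\<^sup>2)) (at t within {0..\<tau>})"
      using DERIV_minus[OF ch, of h "- (a * f (\<tau> - t) * h (\<tau> - t) + b * (g (\<tau> - t))\<^sup>2)" t] d t
      by (simp add: algebra_simps)
  qed
qed

section \<open>Signs, monotonicity and energy of concave solutions\<close>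

lemma flow_DERIV_pos:
  assumes F: "flow a b {0..} f g h" and x: "0 < x"
  shows "(f has_real_derivative g x) (at x)" "(g has_real_derivative h x) (at x)"
    "(h has_real_derivative - (a * f x * h x + b * (g x)\<^sup>2)) (at x)"
proof -
  have s: "{0<..<x + 1} \<subseteq> {0..}" and l: "x < x + 1" by auto
  show "(f has_real_derivative g x) (at x)" by (rule flow_DERIV(1)[OF F s x l])
  show "(g has_real_derivative h x) (at x)" by (rule flow_DERIV(2)[OF F s x l])
  show "(h has_real_derivative - (a * f x * h x + b * (g x)\<^sup>2)) (at x)" by (rule flow_DERIV(3)[OF F s x l])
qed

text \<open>Dropping the term -b g^2 leaves h' <= -a f h, a linear inequality that preserves
  negativity whatever the sign of f.\<close>

lemma flow_concave:
  assumes F: "flow a b {s..T} f g h" and b: "0 \<le> b" and h0: "h s < 0" and t: "t \<in> {s..T}"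
  shows "h t < 0"
proof -
  have "\<exists>k>0. h t \<le> k * h s"
  proof (rule lin_diff_ineq[where y = h and s = s and t = t and p = "\<lambda>x. - a * f x"])
    show "continuous_on {s..t} h" "continuous_on {s..t} (\<lambda>x. - a * f x)"
      using t by (auto intro!: continuous_intros flow_continuous[OF F, THEN continuous_on_subset])
    fix x assume "s < x" "x < t"
    then show "\<exists>D. (h has_real_derivative D) (at x) \<and> D \<le> - a * f x * h x"
      using flow_DERIV(3)[OF F, of s t x] t b by force
  qed (use t in auto)
  then show ?thesis using h0 by (metis mult_pos_neg order_le_less_trans)
qed

text \<open>The energy \<open>f'' + a f f'\<close> has derivative \<open>(a - b) f'\<^sup>2\<close>.\<close>

lemma flow_energy_less:
  assumes F: "flow a b I f g h" and ab: "a < b" and st: "s < t" "{s..t} \<subseteq> I"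
    and g: "\<And>x. s < x \<Longrightarrow> x < t \<Longrightarrow> g x \<noteq> 0"
  shows "h t + a * f t * g t < h s + a * f s * g s"
proof (rule DERIV_neg_imp_decreasing_open[OF st(1)])
  show "continuous_on {s..t} (\<lambda>t. h t + a * f t * g t)"
    using st(2) by (intro continuous_intros flow_continuous[OF F, THEN continuous_on_subset]) auto
  fix x assume x: "s < x" "x < t"
  have sub: "{s<..<t} \<subseteq> I" using st(2) greaterThanLessThan_subseteq_atLeastAtMost_iff by fastforce
  note d = flow_DERIV[OF F sub x]
  have "((\<lambda>t. h t + a * f t * g t) has_real_derivative (a - b) * (g x)\<^sup>2) (at x)"
    using d by (auto intro!: derivative_eq_intros simp: algebra_simps power2_eq_square)
  moreover have "(a - b) * (g x)\<^sup>2 < 0" using ab g[OF x] by (simp add: mult_neg_pos)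
  ultimately show "\<exists>y. ((\<lambda>t. h t + a * f t * g t) has_real_derivative y) (at x) \<and> y < 0" by blast
qed

text \<open>\<open>h\<close> is required to be negative only for t > 0, so that the reference
  solution, which starts at its inflection point, qualifies. That f' tends to 0 is a consequence,
  \<open>concave_flow_g_to_0\<close>.\<close>

definition concave_flow :: "real \<Rightarrow> real \<Rightarrow> (real \<Rightarrow> real) \<Rightarrow> (real \<Rightarrow> real) \<Rightarrow> (real \<Rightarrow> real) \<Rightarrow> bool" where
  "concave_flow a b f g h \<longleftrightarrow> flow a b {0..} f g h \<and>
     (\<forall>t\<ge>0. 0 < f t \<and> 0 < g t) \<and> (\<forall>t>0. h t < 0)"

lemma concave_flow_shift:
  assumes "concave_flow a b f g h" "0 \<le> s"
  shows "concave_flow a b (\<lambda>t. f (t + s)) (\<lambda>t. g (t + s)) (\<lambda>t. h (t + s))"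
  using assms flow_shift unfolding concave_flow_def by auto

locale similarity_flow =
  fixes a b :: real
  assumes a: "0 < a" and ab: "a < b"
begin

lemma concave_flow_mono:
  assumes C: "concave_flow a b f g h" and st: "0 \<le> s" "s < t"
  shows "f s < f t" "g t < g s" "h t + a * f t * g t < h s + a * f s * g s"
proof -
  have F: "flow a b {0..} f g h" using C by (simp add: concave_flow_def)
  have P: "0 < g x" "h x < 0" if "0 < x" for x using C that by (auto simp: concave_flow_def)
  have sub: "{s..t} \<subseteq> {0..}" using st by auto
  note c = flow_continuous[OF F, THEN continuous_on_subset, OF sub]
  show "f s < f t"
  proof (rule DERIV_pos_imp_increasing_open[OF st(2) _ c(1)])
    fix x assume "s < x" "x < t"
    then have "0 < x" using st by simp
    then show "\<exists>y. (f has_real_derivative y) (at x) \<and> 0 < y"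
      using flow_DERIV_pos(1)[OF F] P(1) by blast
  qed
  show "g t < g s"
  proof (rule DERIV_neg_imp_decreasing_open[OF st(2) _ c(2)])
    fix x assume "s < x" "x < t"
    then have "0 < x" using st by simp
    then show "\<exists>y. (g has_real_derivative y) (at x) \<and> y < 0"
      using flow_DERIV_pos(2)[OF F] P(2) by blast
  qed
  show "h t + a * f t * g t < h s + a * f s * g s"
  proof (rule flow_energy_less[OF F ab st(2) sub])
    fix x assume "s < x" "x < t"
    then show "g x \<noteq> 0" using P(1)[of x] st by simp
  qed
qed

text \<open>If the energy became negative, \<open>f''\<close> would stay below a negative constant.\<close>

lemma energy_pos:
  assumes C: "concave_flow a b f g h" and "0 \<le> s"
  shows "0 < h s + a * f s * g s"
proof (rule ccontr)
  assume neg: "\<not> ?thesis"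
  have F: "flow a b {0..} f g h" using C by (simp add: concave_flow_def)
  have P: "0 < f t" "0 < g t" if "0 \<le> t" for t using C that by (auto simp: concave_flow_def)
  \<comment> \<open>The energy at \<open>s\<close> might be exactly zero; one unit later its strict
    decrease has made it negative.\<close>
  define e where "e = - (h (s + 1) + a * f (s + 1) * g (s + 1))"
  have e: "0 < e" using concave_flow_mono(3)[OF C \<open>0 \<le> s\<close>, of "s + 1"] neg by (simp add: e_def)
  \<comment> \<open>Chosen so that g(s + 1) - e (T - (s + 1)) = -e, which contradicts g > 0.\<close>
  define T where "T = s + 1 + (g (s + 1) / e + 1)"
  have T: "s + 1 < T" using P[of "s + 1"] \<open>0 \<le> s\<close> e by (simp add: T_def add_pos_pos)
  have "g T + e * T \<le> g (s + 1) + e * (s + 1)"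
  proof (rule DERIV_nonpos_imp_decreasing_open[where f = "\<lambda>t. g t + e * t" and a = "s + 1" and b = T])
    show "continuous_on {s + 1..T} (\<lambda>t. g t + e * t)"
      using \<open>0 \<le> s\<close> by (intro continuous_intros flow_continuous[OF F, THEN continuous_on_subset]) auto
    fix x assume x: "s + 1 < x" "x < T"
    then have x0: "0 \<le> x" using \<open>0 \<le> s\<close> by simp
    have "(g has_real_derivative h x) (at x)"
      using flow_DERIV_pos(2)[OF F, of x] x \<open>0 \<le> s\<close> by linarith
    then have "((\<lambda>t. g t + e * t) has_real_derivative h x + e) (at x)"
      by (auto intro!: derivative_eq_intros)
    moreover have "h x + a * f x * g x < - e"
      using concave_flow_mono(3)[OF C, of "s + 1" x] x \<open>0 \<le> s\<close> by (simp add: e_def)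
    then have "h x + e \<le> 0" using P[OF x0] a by (smt (verit) mult_pos_pos)
    ultimately show "\<exists>y. ((\<lambda>t. g t + e * t) has_real_derivative y) (at x) \<and> y \<le> 0" by blast
  qed (use T in simp)
  then have "g T \<le> g (s + 1) - e * (T - (s + 1))" by (simp add: algebra_simps)
  also have "e * (T - (s + 1)) = g (s + 1) + e" using e by (simp add: T_def field_simps)
  finally have "g T < 0" using e by simp
  then show False using P[of T] T \<open>0 \<le> s\<close> by simp
qed

text \<open>As g is positive and decreasing, the alternative is g >= e > 0 throughout. Then f grows
  linearly, so a f g eventually exceeds the initial energy by 1. Since the energy h + a f g
  decreases, this forces h <= -1 from then on, and g would become negative.\<close>

lemma concave_flow_g_to_0:
  assumes C: "concave_flow a b f g h"
  shows "(g \<longlongrightarrow> 0) at_top"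
proof (rule ccontr)
  have F: "flow a b {0..} f g h" using C by (simp add: concave_flow_def)
  have P: "0 < f t" "0 < g t" if "0 \<le> t" for t using C that by (auto simp: concave_flow_def)
  assume nt: "\<not> ?thesis"
  have "\<exists>e>0. \<forall>t\<ge>0. e \<le> g t"
  proof (rule ccontr)
    assume no: "\<not> (\<exists>e>0. \<forall>t\<ge>0. e \<le> g t)"
    have "(g \<longlongrightarrow> 0) at_top"
    proof (rule order_tendstoI)
      fix y :: real assume "y < 0"
      have "y < g x" if "0 \<le> x" for x using P[OF that] \<open>y < 0\<close> by simp
      then show "\<forall>\<^sub>F x in at_top. y < g x" by (rule eventually_at_top_linorderI)
    next
      fix y :: real assume "0 < y"
      then obtain t where t: "0 \<le> t" "g t < y" using no by force
      have "g x < y" if "t \<le> x" for x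
        using concave_flow_mono(2)[OF C t(1), of x] t(2) that by (cases "x = t") auto
      then show "\<forall>\<^sub>F x in at_top. g x < y" by (rule eventually_at_top_linorderI)
    qed
    then show False using nt by blast
  qed
  then obtain e where e: "0 < e" "\<And>t. 0 \<le> t \<Longrightarrow> e \<le> g t" by blast
  define E where "E = h 0 + a * f 0 * g 0"
  have E: "0 < E" unfolding E_def using energy_pos[OF C, of 0] by simp
  \<comment> \<open>At this time the lower bound a (e T) e for a f g equals E + 1.\<close>
  define T where "T = (E + 1) / (a * e * e)"
  have T: "0 < T" using E a e by (simp add: T_def)
  have f: "f 0 + e * (t - 0) \<le> f t" if "0 < t" for t
  proof -
    have "f 0 - e * 0 \<le> f t - e * t"
    proof (rule DERIV_nonneg_imp_increasing_open[where f = "\<lambda>t. f t - e * t" and a = 0 and b = t])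
      show "continuous_on {0..t} (\<lambda>t. f t - e * t)"
        by (intro continuous_intros flow_continuous[OF F, THEN continuous_on_subset]) auto
      fix x assume x: "0 < x" "x < t"
      have "(f has_real_derivative g x) (at x)"
        using flow_DERIV_pos(1)[OF F x(1)] .
      then have "((\<lambda>t. f t - e * t) has_real_derivative g x - e) (at x)"
        by (auto intro!: derivative_eq_intros)
      then show "\<exists>y. ((\<lambda>t. f t - e * t) has_real_derivative y) (at x) \<and> 0 \<le> y"
        using e(2)[of x] x by force
    qed (use that in simp)
    then show ?thesis by simp
  qed
  have h: "h t \<le> - 1" if "T \<le> t" for t
  proof -
    have "h t + a * f t * g t < E" unfolding E_def
      using concave_flow_mono(3)[OF C, of 0 t] that T by simp
    moreover have "E + 1 \<le> a * f t * g t"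
    proof -
      have "E + 1 = a * (e * T) * e" using a e by (simp add: T_def field_simps)
      also have "\<dots> \<le> a * f t * g t"
      proof (intro mult_mono)
        have "e * T \<le> e * t" using e that by simp
        also have "\<dots> \<le> f t" using f[of t] P[of 0] that T by simp
        finally show "e * T \<le> f t" .
      qed (use e a P[of t] T that in \<open>auto intro: less_imp_le\<close>)
      finally show ?thesis .
    qed
    ultimately show ?thesis by simp
  qed
  define S where "S = T + g T"
  have S: "T < S" using P[of T] T by (simp add: S_def)
  have "g S + S \<le> g T + T"
  proof (rule DERIV_nonpos_imp_decreasing_open[where f = "\<lambda>t. g t + t" and a = T and b = S])
    show "continuous_on {T..S} (\<lambda>t. g t + t)"
      using T by (intro continuous_intros flow_continuous[OF F, THEN continuous_on_subset]) auto
    fix x assume x: "T < x" "x < S"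
    have "(g has_real_derivative h x) (at x)"
      using flow_DERIV_pos(2)[OF F, of x] x T by linarith
    then have "((\<lambda>t. g t + t) has_real_derivative h x + 1) (at x)"
      by (auto intro!: derivative_eq_intros)
    then show "\<exists>y. ((\<lambda>t. g t + t) has_real_derivative y) (at x) \<and> y \<le> 0"
      using h[of x] x by force
  qed (use S in simp)
  then have "g S \<le> 0" by (simp add: S_def)
  then show False using P[of S] S T by simp
qed

end

text \<open>Negativity of h is \<open>flow_concave\<close>. It makes g strictly decreasing, and a
  strictly decreasing function with limit 0 is positive. If f stayed nonpositive, both terms of h'
  would be nonpositive, so h <= h(0) < 0 and g would reach zero in finite time.\<close>

lemma flow_bounded_below_pos:
  assumes F: "flow a b {0..} f g h" and a: "0 < a" and b: "0 \<le> b" and h0: "h 0 < 0" and lim: "(g \<longlongrightarrow> 0) at_top"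
  shows "\<And>t. 0 \<le> t \<Longrightarrow> h t < 0" "\<And>t. 0 \<le> t \<Longrightarrow> 0 < g t" "\<exists>t\<ge>0. 0 < f t"
proof -
  show h: "h t < 0" if "0 \<le> t" for t
    using flow_concave[OF flow_subset[OF F] b h0, of t t] that by auto
  have dec: "g t < g s" if "0 \<le> s" "s < t" for s t
  proof (rule DERIV_neg_imp_decreasing_open[OF that(2)])
    show "continuous_on {s..t} g"
      using that by (intro flow_continuous[OF F, THEN continuous_on_subset]) auto
    fix x assume "s < x" "x < t"
    then have "0 < x" using that by simp
    then show "\<exists>y. (g has_real_derivative y) (at x) \<and> y < 0"
      using flow_DERIV_pos(2)[OF F] h[of x] by (intro exI[of _ "h x"]) simp
  qed
  show g: "0 < g t" if "0 \<le> t" for t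
  proof (rule ccontr)
    assume "\<not> 0 < g t"
    then have neg: "g (t + 1) < 0" using dec[of t "t + 1"] that by simp
    have "\<forall>\<^sub>F x in at_top. g (t + 1) < g x" using lim neg by (rule order_tendstoD(1))
    then have "\<forall>\<^sub>F x in at_top. g (t + 1) < g x \<and> t + 1 < x"
      using eventually_gt_at_top by (rule eventually_conj)
    then obtain x where "g (t + 1) < g x" "t + 1 < x"
      using eventually_happens'[OF trivial_limit_at_top_linorder] by blast
    then show False using dec[of "t + 1" x] that by simp
  qed
  show "\<exists>t\<ge>0. 0 < f t"
  proof (rule ccontr)
    assume "\<not> ?thesis"
    then have f: "f t \<le> 0" if "0 \<le> t" for t using that by force
    have hle: "h t \<le> h 0" if "0 \<le> t" for t
    proof (rule DERIV_nonpos_imp_decreasing_open[OF that])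
      show "continuous_on {0..t} h"
        by (intro flow_continuous[OF F, THEN continuous_on_subset]) auto
      fix x assume x: "0 < x" "x < t"
      have "(h has_real_derivative - (a * f x * h x + b * (g x)\<^sup>2)) (at x)"
        using flow_DERIV_pos(3)[OF F x(1)] .
      moreover have "0 \<le> a * f x * h x" using a f[of x] h[of x] x
        by (simp add: mult_nonpos_nonpos mult_nonneg_nonpos)
      ultimately show "\<exists>y. (h has_real_derivative y) (at x) \<and> y \<le> 0"
        using mult_nonneg_nonneg[OF b zero_le_power2[of "g x"]] by (intro exI conjI) (assumption, linarith)
    qed
    define S where "S = g 0 / - h 0"
    have S: "0 < S" using g[of 0] h0 by (simp add: S_def divide_pos_neg)
    have "g S - h 0 * S \<le> g 0 - h 0 * 0"
    proof (rule DERIV_nonpos_imp_decreasing_open[where f = "\<lambda>t. g t - h 0 * t" and a = 0 and b = S])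
      show "continuous_on {0..S} (\<lambda>t. g t - h 0 * t)"
        by (intro continuous_intros flow_continuous[OF F, THEN continuous_on_subset]) auto
      fix x assume x: "0 < x" "x < S"
      have "(g has_real_derivative h x) (at x)"
        using flow_DERIV_pos(2)[OF F x(1)] .
      then have "((\<lambda>t. g t - h 0 * t) has_real_derivative h x - h 0) (at x)"
        by (auto intro!: derivative_eq_intros)
      then show "\<exists>y. ((\<lambda>t. g t - h 0 * t) has_real_derivative y) (at x) \<and> y \<le> 0"
        using hle[of x] x by force
    qed (use S in simp)
    then have "g S \<le> 0" using h0 by (simp add: S_def)
    then show False using g[of S] S by simp
  qed
qed

section \<open>The phase plane\<close>

definition phase_u :: "(real \<Rightarrow> real) \<Rightarrow> (real \<Rightarrow> real) \<Rightarrow> real \<Rightarrow> real" where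
  "phase_u f g t = g t / (f t)\<^sup>2"

definition phase_q :: "(real \<Rightarrow> real) \<Rightarrow> (real \<Rightarrow> real) \<Rightarrow> (real \<Rightarrow> real) \<Rightarrow> real \<Rightarrow> real" where
  "phase_q f g h t = h t / (f t * g t)"

text \<open>The factor \<open>f x\<close>, which \<open>phase_q_DERIV\<close> shares, is only a
  change of time; what remains depends on u and q alone.\<close>

lemma phase_u_DERIV:
  assumes "(f has_real_derivative g x) (at x)" "(g has_real_derivative h x) (at x)"
    and "f x \<noteq> 0" "g x \<noteq> 0"
  shows "(phase_u f g has_real_derivative
    f x * (phase_u f g x * (phase_q f g h x - 2 * phase_u f g x))) (at x)"
proof -
  have "((\<lambda>t. g t / (f t)\<^sup>2) has_real_derivative
      (h x * (f x)\<^sup>2 - g x * (2 * f x * g x)) / ((f x)\<^sup>2 * (f x)\<^sup>2)) (at x)"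
    using assms by (auto intro!: derivative_eq_intros)
  also have "(h x * (f x)\<^sup>2 - g x * (2 * f x * g x)) / ((f x)\<^sup>2 * (f x)\<^sup>2)
    = f x * (phase_u f g x * (phase_q f g h x - 2 * phase_u f g x))"
    using assms(3,4) by (simp add: phase_u_def phase_q_def field_simps power2_eq_square)
  finally show ?thesis by (simp add: phase_u_def[abs_def])
qed

context similarity_flow
begin

text \<open>The q-component of the planar field after removal of the factor f; the u-component is u
  (q - 2 u). It vanishes at (0, -a), and its derivative in q there is a, the unstable
  eigenvalue.\<close>

definition slope :: "real \<Rightarrow> real \<Rightarrow> real" where
  "slope u q = - a * q - b * u - q * u - q\<^sup>2"

lemma phase_q_DERIV:
  assumes "(f has_real_derivative g x) (at x)" "(g has_real_derivative h x) (at x)"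
    and "(h has_real_derivative - (a * f x * h x + b * (g x)\<^sup>2)) (at x)"
    and "f x \<noteq> 0" "g x \<noteq> 0"
  shows "(phase_q f g h has_real_derivative f x * slope (phase_u f g x) (phase_q f g h x)) (at x)"
proof -
  have "((\<lambda>t. h t / (f t * g t)) has_real_derivative
      (- (a * f x * h x + b * (g x)\<^sup>2) * (f x * g x) - h x * (g x * g x + f x * h x)) / ((f x * g x) * (f x * g x))) (at x)"
    using assms by (auto intro!: derivative_eq_intros simp: algebra_simps)
  also have "(- (a * f x * h x + b * (g x)\<^sup>2) * (f x * g x) - h x * (g x * g x + f x * h x)) / ((f x * g x) * (f x * g x))
    = f x * slope (phase_u f g x) (phase_q f g h x)"
    using assms(4,5) by (simp add: phase_u_def phase_q_def slope_def divide_simps) (simp add: algebra_simps power2_eq_square)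
  finally show ?thesis by (simp add: phase_q_def[abs_def])
qed

lemma phase_continuous:
  assumes F: "flow a b I f g h" and "\<And>t. t \<in> I \<Longrightarrow> 0 < f t" "\<And>t. t \<in> I \<Longrightarrow> 0 < g t"
  shows "continuous_on I (phase_u f g)" "continuous_on I (phase_q f g h)"
  unfolding phase_u_def[abs_def] phase_q_def[abs_def]
  by (intro continuous_intros flow_continuous[OF F] ballI; use assms in fastforce)+

text \<open>Concavity means q < 0, so u' = f u (q - 2 u) is negative. This is what allows u to
  replace time as the independent variable.\<close>

lemma phase_u_decreasing:
  assumes F: "flow a b I f g h" and st: "{s..t} \<subseteq> I" "s < t"
    and pos: "\<And>x. x \<in> {s..t} \<Longrightarrow> 0 < f x" "\<And>x. x \<in> {s..t} \<Longrightarrow> 0 < g x"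
    and h: "\<And>x. s < x \<Longrightarrow> x < t \<Longrightarrow> h x < 0"
  shows "phase_u f g t < phase_u f g s"
proof (rule DERIV_neg_imp_decreasing_open[OF st(2)])
  have F': "flow a b {s..t} f g h" by (rule flow_subset[OF F st(1)])
  show "continuous_on {s..t} (phase_u f g)" by (rule phase_continuous(1)[OF F' pos])
  fix x assume x: "s < x" "x < t"
  then have m: "x \<in> {s..t}" by simp
  have sub: "{s<..<t} \<subseteq> {s..t}" by auto
  note d = flow_DERIV[OF F' sub x]
  have "(phase_u f g has_real_derivative f x * (phase_u f g x * (phase_q f g h x - 2 * phase_u f g x))) (at x)"
    by (rule phase_u_DERIV[of f g x h, OF d(1,2)]) (use pos[OF m] in auto)
  moreover have "f x * (phase_u f g x * (phase_q f g h x - 2 * phase_u f g x)) < 0"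
  proof -
    have "0 < phase_u f g x" "phase_q f g h x < 0" using pos[OF m] h[OF x]
      by (auto simp: phase_u_def phase_q_def divide_neg_pos)
    then show ?thesis using pos(1)[OF m] by (intro mult_pos_neg) auto
  qed
  ultimately show "\<exists>y. (phase_u f g has_real_derivative y) (at x) \<and> y < 0" by blast
qed

text \<open>The bound q > -a is positivity of the energy divided by f g. That u tends to 0 follows
  from f' tending to 0 and f >= f(0) > 0.\<close>

lemma concave_phase:
  assumes C: "concave_flow a b f g h"
  shows "continuous_on {0..} (phase_u f g)" "continuous_on {0..} (phase_q f g h)"
    "\<And>s t. 0 \<le> s \<Longrightarrow> s < t \<Longrightarrow> phase_u f g t < phase_u f g s"
    "\<And>t. 0 \<le> t \<Longrightarrow> 0 < phase_u f g t"
    "\<And>t. 0 \<le> t \<Longrightarrow> - a < phase_q f g h t"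
    "\<And>t. 0 < t \<Longrightarrow> phase_q f g h t < 0"
    "(phase_u f g \<longlongrightarrow> 0) at_top"
proof -
  have F: "flow a b {0..} f g h" using C by (simp add: concave_flow_def)
  have P: "0 < f t" "0 < g t" if "0 \<le> t" for t using C that by (auto simp: concave_flow_def)
  have H: "h t < 0" if "0 < t" for t using C that by (auto simp: concave_flow_def)
  show "continuous_on {0..} (phase_u f g)" "continuous_on {0..} (phase_q f g h)"
    by (rule phase_continuous[OF F]; use P in force)+
  show "phase_u f g t < phase_u f g s" if "0 \<le> s" "s < t" for s t
    by (rule phase_u_decreasing[OF F]) (use that P H in auto)
  show U: "0 < phase_u f g t" if "0 \<le> t" for t using P[OF that] by (simp add: phase_u_def)
  show "- a < phase_q f g h t" if "0 \<le> t" for t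
    using energy_pos[OF C that] P[OF that] by (simp add: phase_q_def field_simps)
  show "phase_q f g h t < 0" if "0 < t" for t
    using P[of t] H[OF that] that by (simp add: phase_q_def divide_neg_pos)
  have le: "phase_u f g t \<le> g t / (f 0)\<^sup>2" if "0 \<le> t" for t
  proof -
    have "f 0 \<le> f t" using concave_flow_mono(1)[OF C, of 0 t] that by (cases "t = 0") auto
    then show ?thesis unfolding phase_u_def using P[of 0] P[OF that]
      by (intro divide_left_mono power_mono mult_pos_pos) auto
  qed
  show "(phase_u f g \<longlongrightarrow> 0) at_top"
  proof (rule tendsto_sandwich)
    show "\<forall>\<^sub>F t in at_top. 0 \<le> phase_u f g t"
      by (rule eventually_at_top_linorderI[of 0]) (use U in \<open>auto intro: less_imp_le\<close>)
    show "\<forall>\<^sub>F t in at_top. phase_u f g t \<le> g t / (f 0)\<^sup>2"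
      by (rule eventually_at_top_linorderI[of 0]) (rule le)
    show "((\<lambda>t. g t / (f 0)\<^sup>2) \<longlongrightarrow> 0) at_top"
      using tendsto_divide[OF concave_flow_g_to_0[OF C] tendsto_const[of "(f 0)\<^sup>2"]] P[of 0] by simp
  qed simp
qed

text \<open>Integrating the energy identity from \<open>t\<close> to infinity gives
  \<open>f'' + a f f' \<le> (b - a) f'(t) (L - f(t))\<close>, where \<open>L\<close> is the limit of \<open>f\<close>.\<close>

lemma bounded_phase_q:
  assumes C: "concave_flow a b f g h" and M: "\<And>t. 0 \<le> t \<Longrightarrow> f t \<le> M"
  shows "(phase_q f g h \<longlongrightarrow> - a) at_top"
proof -
  have F: "flow a b {0..} f g h" using C by (simp add: concave_flow_def)
  have P: "0 < f t" "0 < g t" if "0 \<le> t" for t using C that by (auto simp: concave_flow_def)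
  have H: "h t < 0" if "0 < t" for t using C that by (auto simp: concave_flow_def)
  have mono: "f s \<le> f t" if "0 \<le> s" "s \<le> t" for s t
    using concave_flow_mono(1)[OF C, of s t] that by (cases "s = t") auto
  have gmono: "g t \<le> g s" if "0 \<le> s" "s \<le> t" for s t
    using concave_flow_mono(2)[OF C, of s t] that by (cases "s = t") auto
  define L where "L = Sup (f ` {0..})"
  have bdd: "bdd_above (f ` {0..})" using M by (auto intro!: bdd_aboveI)
  have fL: "f t \<le> L" if "0 \<le> t" for t unfolding L_def using bdd that by (intro cSup_upper) auto
  have lim: "(f \<longlongrightarrow> L) at_top"
  proof (rule order_tendstoI)
    fix y assume "y < L"
    then obtain s where s: "0 \<le> s" "y < f s"
      unfolding L_def using less_cSupD[of "f ` {0..}" y] by auto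
    have "y < f t" if "s \<le> t" for t using mono[OF s(1) that] s(2) by simp
    then show "\<forall>\<^sub>F t in at_top. y < f t" by (rule eventually_at_top_linorderI)
  next
    fix y assume "L < y"
    then have "f t < y" if "0 \<le> t" for t using fL[OF that] by simp
    then show "\<forall>\<^sub>F t in at_top. f t < y" by (rule eventually_at_top_linorderI)
  qed
  have key: "h t + a * f t * g t \<le> (b - a) * g t * (L - f t)" if t: "0 \<le> t" for t
  proof (rule tendsto_lowerbound)
    show "((\<lambda>T. a * M * g T + (b - a) * g t * (L - f t)) \<longlongrightarrow> (b - a) * g t * (L - f t)) at_top"
      using tendsto_add[OF tendsto_mult[OF tendsto_const[of "a * M"] concave_flow_g_to_0[OF C]]
          tendsto_const[of "(b - a) * g t * (L - f t)"]] by simp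
    have "h t + a * f t * g t \<le> a * M * g T + (b - a) * g t * (L - f t)" if T: "t + 1 \<le> T" for T
    proof -
      \<comment> \<open>With the weight \<open>g t\<close> frozen, the derivative of this
        combination is (b - a) g(x) (g(t) - g(x)), nonnegative because g decreases.\<close>
      have "h t + a * f t * g t + (b - a) * g t * f t \<le> h T + a * f T * g T + (b - a) * g t * f T"
      proof (rule DERIV_nonneg_imp_increasing_open[where f = "\<lambda>x. h x + a * f x * g x + (b - a) * g t * f x" and a = t and b = T])
        show "continuous_on {t..T} (\<lambda>x. h x + a * f x * g x + (b - a) * g t * f x)"
          using t by (intro continuous_intros flow_continuous[OF F, THEN continuous_on_subset]) auto
        fix x assume x: "t < x" "x < T"
        then have x0: "0 < x" using t by simp
        note d = flow_DERIV_pos[OF F x0]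
        have "((\<lambda>x. h x + a * f x * g x + (b - a) * g t * f x) has_real_derivative (b - a) * g x * (g t - g x)) (at x)"
          using d by (auto intro!: derivative_eq_intros simp: algebra_simps power2_eq_square)
        moreover have "0 \<le> (b - a) * g x * (g t - g x)"
          using ab P(2)[of x] x0 gmono[OF t, of x] x by simp
        ultimately show "\<exists>y. ((\<lambda>x. h x + a * f x * g x + (b - a) * g t * f x) has_real_derivative y) (at x) \<and> 0 \<le> y"
          by blast
      qed (use T in simp)
      moreover have "h T < 0" using H[of T] t T by simp
      moreover have "a * f T * g T \<le> a * M * g T"
        using a M[of T] P(2)[of T] t T by (intro mult_right_mono mult_left_mono) auto
      moreover have "(b - a) * g t * f T \<le> (b - a) * g t * L"
        using ab P(2)[OF t] fL[of T] t T by (intro mult_left_mono) auto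
      ultimately show ?thesis by (simp add: algebra_simps)
    qed
    then show "\<forall>\<^sub>F T in at_top. h t + a * f t * g t \<le> a * M * g T + (b - a) * g t * (L - f t)"
      by (rule eventually_at_top_linorderI)
  qed simp
  have q: "phase_q f g h t \<le> - a + (b - a) / f 0 * (L - f t)" if t: "0 \<le> t" for t
  proof -
    have "phase_q f g h t + a = (h t + a * f t * g t) / (f t * g t)"
      using P[OF t] by (simp add: phase_q_def field_simps)
    also have "\<dots> \<le> ((b - a) * g t * (L - f t)) / (f t * g t)"
      using key[OF t] P[OF t] by (intro divide_right_mono) auto
    also have "\<dots> = ((b - a) * (L - f t)) / f t" using P[OF t] by simp
    also have "\<dots> \<le> ((b - a) * (L - f t)) / f 0"
      using P[of 0] P[OF t] mono[of 0 t] t fL[OF t] ab by (intro divide_left_mono mult_pos_pos mult_nonneg_nonneg) auto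
    finally show ?thesis by simp
  qed
  show ?thesis
  proof (rule tendsto_sandwich)
    show "\<forall>\<^sub>F t in at_top. - a \<le> phase_q f g h t"
      by (rule eventually_at_top_linorderI[of 0]) (use concave_phase(5)[OF C] in \<open>auto intro: less_imp_le\<close>)
    show "\<forall>\<^sub>F t in at_top. phase_q f g h t \<le> - a + (b - a) / f 0 * (L - f t)"
      by (rule eventually_at_top_linorderI[of 0]) (rule q)
    show "((\<lambda>t. - a + (b - a) / f 0 * (L - f t)) \<longlongrightarrow> - a) at_top"
      using tendsto_add[OF tendsto_const[of "- a"] tendsto_mult[OF tendsto_const[of "(b - a) / f 0"]
        tendsto_diff[OF tendsto_const[of L] lim]]] by simp
  qed simp
qed

text \<open>Eventually q < -a/2, that is h < -(a/2) f g <= -c g with c = (a/2) f(0). Then g + c f is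
  nonincreasing from that time on, which bounds f.\<close>

lemma phase_q_imp_bounded:
  assumes C: "concave_flow a b f g h" and lim: "(phase_q f g h \<longlongrightarrow> - a) at_top"
  shows "\<exists>M. \<forall>t\<ge>0. f t \<le> M"
proof -
  have F: "flow a b {0..} f g h" using C by (simp add: concave_flow_def)
  have P: "0 < f t" "0 < g t" if "0 \<le> t" for t using C that by (auto simp: concave_flow_def)
  have mono: "f s \<le> f t" if "0 \<le> s" "s \<le> t" for s t
    using concave_flow_mono(1)[OF C, of s t] that by (cases "s = t") auto
  have "\<forall>\<^sub>F t in at_top. phase_q f g h t < - a / 2"
    using lim by (rule order_tendstoD(2)) (use a in simp)
  then obtain T0 where T0: "\<And>t. T0 \<le> t \<Longrightarrow> phase_q f g h t < - a / 2"
    unfolding eventually_at_top_linorder by blast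
  define T where "T = max 0 T0"
  define c where "c = a / 2 * f 0"
  have c: "0 < c" using a P[of 0] by (simp add: c_def)
  have bnd: "c * f t \<le> g T + c * f T" if "T < t" for t
  proof -
    have "g t + c * f t \<le> g T + c * f T"
    proof (rule DERIV_nonpos_imp_decreasing_open[where f = "\<lambda>x. g x + c * f x" and a = T and b = t])
      show "continuous_on {T..t} (\<lambda>x. g x + c * f x)"
        by (intro continuous_intros flow_continuous[OF F, THEN continuous_on_subset]) (auto simp: T_def)
      fix x assume x: "T < x" "x < t"
      then have x0: "0 < x" by (simp add: T_def)
      note d = flow_DERIV_pos[OF F x0]
      have "((\<lambda>x. g x + c * f x) has_real_derivative h x + c * g x) (at x)"
        using d by (auto intro!: derivative_eq_intros)
      moreover have "h x + c * g x \<le> 0"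
      proof -
        have "h x / (f x * g x) < - a / 2" using T0[of x] x by (simp add: T_def phase_q_def)
        then have "h x < - a / 2 * (f x * g x)" using P[of x] x0 by (simp add: pos_divide_less_eq)
        moreover have "c * g x \<le> a / 2 * (f x * g x)"
          unfolding c_def using a P[of x] x0 mono[of 0 x] by simp
        ultimately show ?thesis by simp
      qed
      ultimately show "\<exists>y. ((\<lambda>x. g x + c * f x) has_real_derivative y) (at x) \<and> y \<le> 0" by blast
    qed (use that in simp)
    then show ?thesis using P(2)[of t] that by (simp add: T_def)
  qed
  have "f t \<le> (g T + c * f T) / c" if "0 \<le> t" for t
  proof (cases "T < t")
    case True
    then show ?thesis using bnd[OF True] c by (simp add: field_simps)
  next
    case False
    then have "f t \<le> f T" using mono[OF that, of T] by simp
    also have "\<dots> \<le> (g T + c * f T) / c" using P(2)[of T] c by (simp add: T_def field_simps)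
    finally show ?thesis .
  qed
  then show ?thesis by blast
qed

end

section \<open>The separatrix\<close>

text \<open>A bounded solution, continued backwards to the point where \<open>f''\<close> vanishes.  In the phase
  plane its orbit is the stable manifold of \<open>(0, - a)\<close>, the graph of \<open>sep\<close> over \<open>(0, umax]\<close>.\<close>

locale reference_flow = similarity_flow +
  fixes p p1 p2 :: "real \<Rightarrow> real" and M :: real
  assumes ref: "concave_flow a b p p1 p2" and ref0: "p2 0 = 0"
    and ref_bounded: "\<And>t. 0 \<le> t \<Longrightarrow> p t \<le> M"
begin

abbreviation "up \<equiv> phase_u p p1"
abbreviation "qp \<equiv> phase_q p p1 p2"

definition umax :: real where "umax = up 0"

definition sep :: "real \<Rightarrow> real" where "sep x = qp (the_inv_into {0..} up x)"

lemmas ref_phase = concave_phase[OF ref]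

lemma umax_pos: "0 < umax"
  using ref_phase(4)[of 0] by (simp add: umax_def)

lemma up_inj: "inj_on up {0..}"
proof (rule inj_onI)
  fix s t :: real assume "s \<in> {0..}" "t \<in> {0..}" "up s = up t"
  then show "s = t" using ref_phase(3)[of s t] ref_phase(3)[of t s] by (cases s t rule: linorder_cases) auto
qed

lemma inv_up: "0 \<le> t \<Longrightarrow> the_inv_into {0..} up (up t) = t"
  using the_inv_into_f_f[OF up_inj] by simp

lemma sep_up: "0 \<le> t \<Longrightarrow> sep (up t) = qp t"
  by (simp add: sep_def inv_up)

lemma up_le: "0 \<le> t \<Longrightarrow> up t \<le> umax"
  unfolding umax_def using ref_phase(3)[of 0 t] by (cases "t = 0") auto

lemma up_onto:
  assumes "0 \<le> T" "up T \<le> x" "x \<le> umax"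
  shows "\<exists>t\<ge>0. t \<le> T \<and> up t = x"
  using IVT2'[of up T x 0] assms continuous_on_subset[OF ref_phase(1), of "{0..T}"]
  by (auto simp: umax_def)

lemma up_small:
  assumes "0 < x"
  shows "\<exists>T\<ge>0. up T < x"
proof -
  have "\<forall>\<^sub>F t in at_top. up t < x" using ref_phase(7) assms by (rule order_tendstoD(2))
  then have "\<forall>\<^sub>F t in at_top. up t < x \<and> 0 \<le> t" using eventually_ge_at_top by (rule eventually_conj)
  then show ?thesis using eventually_happens'[OF trivial_limit_at_top_linorder] by blast
qed

lemma up_surj:
  assumes "0 < x" "x \<le> umax"
  shows "\<exists>t\<ge>0. up t = x"
  using up_small[OF assms(1)] up_onto assms(2) by (meson less_imp_le)

lemma sep_umax: "sep umax = 0"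
  unfolding umax_def by (simp add: sep_up phase_q_def ref0)

lemma sep_gt: "0 < x \<Longrightarrow> x \<le> umax \<Longrightarrow> - a < sep x"
  using up_surj[of x] sep_up ref_phase(5) by metis

lemma sep_neg: "0 < x \<Longrightarrow> x < umax \<Longrightarrow> sep x < 0"
  using up_surj[of x] sep_up ref_phase(6) by (metis less_eq_real_def less_irrefl umax_def)

text \<open>The inverse of a continuous injection is continuous on the image of a compact set. As
  (0, umax] is not such an image, the argument is localised: with up(T) < x the set [up(T), umax] is
  a neighbourhood of x within (0, umax].\<close>

lemma inv_up_continuous: "continuous_on {0<..umax} (the_inv_into {0..} up)"
  unfolding continuous_on_eq_continuous_within
proof
  fix x assume x: "x \<in> {0<..umax}"
  then obtain T where T: "0 \<le> T" "up T < x" using up_small[of x] by auto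
  have "continuous_on (up ` {0..T}) (the_inv_into {0..} up)"
    by (rule continuous_on_inv) (auto simp: inv_up intro: continuous_on_subset[OF ref_phase(1)])
  moreover have "up ` {0..T} = {up T..umax}"
  proof -
    have "up T \<le> up t" if "0 \<le> t" "t \<le> T" for t using ref_phase(3)[of t T] that by (cases "t = T") auto
    then show ?thesis using up_le up_onto[OF T(1)] by (auto simp: image_iff) (metis atLeastAtMost_iff)
  qed
  ultimately have "continuous (at x within {up T..umax}) (the_inv_into {0..} up)"
    using x T(2) by (auto simp: continuous_on_eq_continuous_within)
  moreover have "at x within {up T..umax} = at x within {0<..umax}"
    using T ref_phase(4)[of T] by (intro at_within_nhd[of _ "{up T<..}"]) auto
  ultimately show "continuous (at x within {0<..umax}) (the_inv_into {0..} up)" by simp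
qed

lemma sep_continuous: "continuous_on {0<..umax} sep"
  unfolding sep_def
proof (rule continuous_on_compose2[OF ref_phase(2) inv_up_continuous])
  show "the_inv_into {0..} up ` {0<..umax} \<subseteq> {0..}"
  proof
    fix y assume "y \<in> the_inv_into {0..} up ` {0<..umax}"
    then obtain x where "x \<in> {0<..umax}" "y = the_inv_into {0..} up x" by blast
    then show "y \<in> {0..}" using up_surj[of x] inv_up by auto
  qed
qed

text \<open>The upper half of the statement that the separatrix ends at (0, -a);
  \<open>sep_gt\<close> supplies the lower half. It holds because the reference solution is
  bounded.\<close>

lemma sep_tendsto: "\<forall>e>0. \<exists>d>0. \<forall>x. 0 < x \<longrightarrow> x < d \<longrightarrow> sep x < - a + e"
proof (intro allI impI)
  fix e :: real assume "0 < e"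
  then have "\<forall>\<^sub>F t in at_top. qp t < - a + e"
    using bounded_phase_q[OF ref ref_bounded] by (intro order_tendstoD(2)) auto
  then obtain T0 where T0: "\<And>t. T0 \<le> t \<Longrightarrow> qp t < - a + e"
    unfolding eventually_at_top_linorder by blast
  define T where "T = max 0 T0"
  have "sep x < - a + e" if x: "0 < x" "x < up T" for x
  proof -
    have "x \<le> umax" using x up_le[of T] by (simp add: T_def)
    then obtain t where t: "0 \<le> t" "up t = x" using up_surj x by blast
    have "T \<le> t" using ref_phase(3)[of t T] t x by (metis less_le_not_le linorder_not_le order_less_trans)
    then show ?thesis using sep_up[OF t(1)] t(2) T0[of t] by (simp add: T_def)
  qed
  then show "\<exists>d>0. \<forall>x. 0 < x \<longrightarrow> x < d \<longrightarrow> sep x < - a + e"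
    using ref_phase(4)[of T] by (intro exI[of _ "up T"]) (auto simp: T_def)
qed

text \<open>The quotient q'/u' along the reference orbit, where the time factor p(t) cancels. The
  denominator does not vanish because q < 0 < u at positive times.\<close>

lemma sep_DERIV:
  assumes x: "0 < x" "x < umax"
  shows "(sep has_real_derivative slope x (sep x) / (x * (sep x - 2 * x))) (at x)"
proof -
  obtain t where t: "0 \<le> t" "up t = x" using up_surj[of x] x by auto
  have t0: "0 < t" using t x by (cases "t = 0") (auto simp: umax_def)
  have F: "flow a b {0..} p p1 p2" and P: "0 < p t" "0 < p1 t" using ref t by (auto simp: concave_flow_def)
  note d = flow_DERIV_pos[OF F t0]
  define D where "D = p t * (up t * (qp t - 2 * up t))"
  have du: "(up has_real_derivative D) (at t)"
    unfolding D_def by (rule phase_u_DERIV[of p p1 t p2, OF d(1,2)]) (use P in auto)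
  have dq: "(qp has_real_derivative p t * slope (up t) (qp t)) (at t)"
    by (rule phase_q_DERIV[OF d]) (use P in auto)
  have neg: "qp t - 2 * up t < 0" using ref_phase(4)[OF t(1)] ref_phase(6)[OF t0] by simp
  then have D0: "D \<noteq> 0" unfolding D_def using P(1) ref_phase(4)[OF t(1)] by simp
  have inv: "((the_inv_into {0..} up) has_real_derivative inverse D) (at x)"
  proof (rule DERIV_inverse_function[where f = up and a = 0 and b = umax])
    show "(up has_real_derivative D) (at (the_inv_into {0..} up x))"
      using du t inv_up by metis
    show "up (the_inv_into {0..} up y) = y" if "0 < y" "y < umax" for y
      using up_surj[of y] inv_up that by (metis less_imp_le)
    have "continuous_on {0<..<umax} (the_inv_into {0..} up)"
      by (rule continuous_on_subset[OF inv_up_continuous]) auto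
    then show "isCont (the_inv_into {0..} up) x"
      using x by (simp add: continuous_on_eq_continuous_at)
  qed (use D0 x in auto)
  have ix: "the_inv_into {0..} up x = t" using t inv_up by metis
  have "((\<lambda>x. qp (the_inv_into {0..} up x)) has_real_derivative (p t * slope (up t) (qp t)) * inverse D) (at x)"
    by (rule DERIV_chain2[OF _ inv]) (simp add: ix dq)
  moreover have "(p t * slope (up t) (qp t)) * inverse D = slope x (sep x) / (x * (sep x - 2 * x))"
    using P(1) t sep_up[OF t(1)] unfolding D_def by (simp add: divide_inverse)
  ultimately show ?thesis by (simp add: sep_def[abs_def])
qed

section \<open>Signed distance of an orbit from the separatrix\<close>

definition gap :: "(real \<Rightarrow> real) \<Rightarrow> (real \<Rightarrow> real) \<Rightarrow> (real \<Rightarrow> real) \<Rightarrow> real \<Rightarrow> real" where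
  "gap f g h t = phase_q f g h t - sep (phase_u f g t)"

text \<open>The equation for the gap is linear because the right-hand side \<open>slope\<close> is quadratic in \<open>q\<close>.\<close>

definition rate :: "(real \<Rightarrow> real) \<Rightarrow> (real \<Rightarrow> real) \<Rightarrow> (real \<Rightarrow> real) \<Rightarrow> real \<Rightarrow> real" where
  "rate f g h t = - (a + phase_u f g t + phase_q f g h t + sep (phase_u f g t))
     - slope (phase_u f g t) (sep (phase_u f g t)) / (sep (phase_u f g t) - 2 * phase_u f g t)"

lemma gap_DERIV:
  assumes F: "flow a b {s..t} f g h" and x: "s < x" "x < t"
    and pos: "0 < f x" "0 < g x" and u: "phase_u f g x < umax"
  shows "(gap f g h has_real_derivative f x * rate f g h x * gap f g h x) (at x)"
proof -
  have sub: "{s<..<t} \<subseteq> {s..t}" by auto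
  note d = flow_DERIV[OF F sub x]
  define u q where "u = phase_u f g x" and "q = phase_q f g h x"
  define w where "w = sep u"
  have u0: "0 < u" using pos by (simp add: u_def phase_u_def)
  have w: "w < 0" unfolding w_def using sep_neg[OF u0] assms(6) by (simp add: u_def)
  have du: "(phase_u f g has_real_derivative f x * (u * (q - 2 * u))) (at x)"
    unfolding u_def q_def by (rule phase_u_DERIV[of f g x h, OF d(1,2)]) (use pos in auto)
  have dq: "(phase_q f g h has_real_derivative f x * slope u q) (at x)"
    unfolding u_def q_def by (rule phase_q_DERIV[OF d]) (use pos in auto)
  have ds: "(sep has_real_derivative slope u w / (u * (w - 2 * u))) (at (phase_u f g x))"
    using sep_DERIV[OF u0] assms(6) unfolding w_def u_def by blast
  have "((\<lambda>y. phase_q f g h y - sep (phase_u f g y)) has_real_derivative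
      f x * slope u q - slope u w / (u * (w - 2 * u)) * (f x * (u * (q - 2 * u)))) (at x)"
    by (rule DERIV_diff[OF dq DERIV_chain2[OF ds du]])
  moreover have "f x * slope u q - slope u w / (u * (w - 2 * u)) * (f x * (u * (q - 2 * u)))
    = f x * (- (a + u + q + w) - slope u w / (w - 2 * u)) * (q - w)"
  proof -
    have n: "w - 2 * u \<noteq> 0" using w u0 by simp
    \<comment> \<open>Writing (q - 2u)/(w - 2u) as 1 + (q - w)/(w - 2u) isolates
      \<open>slope u w\<close>, which cancels against the same term in \<open>e2\<close>; everything
      left is a multiple of q - w.\<close>
    have e1: "slope u w / (u * (w - 2 * u)) * (f x * (u * (q - 2 * u))) = f x * (slope u w * (1 + (q - w) / (w - 2 * u)))"
      using n u0 by (simp add: field_simps)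
    have e2: "slope u q = slope u w - (a + u + q + w) * (q - w)"
      by (simp add: slope_def algebra_simps power2_eq_square)
    show ?thesis unfolding e1 e2 by (simp add: algebra_simps diff_divide_distrib)
  qed
  ultimately show ?thesis
    by (simp add: gap_def[abs_def] rate_def u_def[symmetric] q_def[symmetric] w_def[symmetric])
qed

lemma gap_continuous:
  assumes F: "flow a b I f g h"
    and pos: "\<And>x. x \<in> I \<Longrightarrow> 0 < f x" "\<And>x. x \<in> I \<Longrightarrow> 0 < g x"
    and u: "\<And>x. x \<in> I \<Longrightarrow> phase_u f g x \<le> umax"
  shows "continuous_on I (gap f g h)" "continuous_on I (\<lambda>x. f x * rate f g h x)"
proof -
  note c = phase_continuous[OF F pos]
  have u0: "0 < phase_u f g x" if "x \<in> I" for x using pos[OF that] by (simp add: phase_u_def)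
  have cs: "continuous_on I (\<lambda>x. sep (phase_u f g x))"
    by (rule continuous_on_compose2[OF sep_continuous c(1)]) (use u0 u in auto)
  show "continuous_on I (gap f g h)"
    unfolding gap_def[abs_def] by (intro continuous_intros c cs)
  have "sep (phase_u f g x) - 2 * phase_u f g x \<noteq> 0" if "x \<in> I" for x
    using sep_neg[OF u0[OF that]] sep_umax u[OF that] u0[OF that]
    by (cases "phase_u f g x = umax") auto
  then show "continuous_on I (\<lambda>x. f x * rate f g h x)"
    unfolding rate_def[abs_def] slope_def
    by (intro continuous_intros c cs flow_continuous[OF F] ballI) auto
qed

text \<open>The two inequalities together say that an orbit stays below, on or above the separatrix
  according to where it starts. The bound u <= umax is required only initially, since u
  decreases.\<close>

lemma gap_propagates:
  assumes F: "flow a b {s..t} f g h" and "s \<le> t"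
    and pos: "\<And>x. x \<in> {s..t} \<Longrightarrow> 0 < f x" "\<And>x. x \<in> {s..t} \<Longrightarrow> 0 < g x"
    and h: "\<And>x. x \<in> {s..t} \<Longrightarrow> h x < 0" and u: "phase_u f g s \<le> umax"
  shows "\<exists>k>0. gap f g h t \<le> k * gap f g h s" "\<exists>k>0. - gap f g h t \<le> k * - gap f g h s"
proof -
  have dec: "phase_u f g x < phase_u f g s" if "s < x" "x \<le> t" for x
    by (rule phase_u_decreasing[OF F]) (use that pos h in auto)
  have ule: "phase_u f g x \<le> umax" if "x \<in> {s..t}" for x
    using dec[of x] u that by (cases "x = s") auto
  note c = gap_continuous[OF F pos ule]
  have d: "(gap f g h has_real_derivative f x * rate f g h x * gap f g h x) (at x)" if "s < x" "x < t" for x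
    by (rule gap_DERIV[OF F that]) (use that pos dec[of x] u in auto)
  show "\<exists>k>0. gap f g h t \<le> k * gap f g h s"
  proof (rule lin_diff_ineq[where y = "gap f g h" and s = s and t = t, OF \<open>s \<le> t\<close> c])
    fix x assume "s < x" "x < t"
    from d[OF this]
    show "\<exists>D. (gap f g h has_real_derivative D) (at x) \<and> D \<le> f x * rate f g h x * gap f g h x"
      by auto
  qed
  show "\<exists>k>0. - gap f g h t \<le> k * - gap f g h s"
  proof (rule lin_diff_ineq[where y = "\<lambda>x. - gap f g h x" and s = s and t = t, OF \<open>s \<le> t\<close> _ c(2)])
    show "continuous_on {s..t} (\<lambda>x. - gap f g h x)" by (intro continuous_intros c(1))
    fix x assume "s < x" "x < t"
    from DERIV_minus[OF d[OF this]]
    show "\<exists>D. ((\<lambda>x. - gap f g h x) has_real_derivative D) (at x) \<and> D \<le> f x * rate f g h x * - gap f g h x"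
      by auto
  qed
qed

end

context reference_flow
begin

lemma sep_phase_u_tendsto:
  assumes C: "concave_flow a b f g h"
  shows "((\<lambda>t. sep (phase_u f g t)) \<longlongrightarrow> - a) at_top"
proof (rule order_tendstoI)
  have small: "\<forall>\<^sub>F t in at_top. 0 < phase_u f g t \<and> phase_u f g t < d" if "0 < d" for d
    using order_tendstoD(2)[OF concave_phase(7)[OF C] that] eventually_ge_at_top[of 0]
    by eventually_elim (use concave_phase(4)[OF C] in auto)
  {
    fix y assume y: "y < - a"
    show "\<forall>\<^sub>F t in at_top. y < sep (phase_u f g t)"
      using small[OF umax_pos] by eventually_elim (use sep_gt y in force)
  next
    fix y assume y: "- a < y"
    then have "0 < y + a" by simp
    then obtain d where d: "0 < d" "\<And>x. 0 < x \<Longrightarrow> x < d \<Longrightarrow> sep x < - a + (y + a)"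
      using sep_tendsto by meson
    show "\<forall>\<^sub>F t in at_top. sep (phase_u f g t) < y"
      using small[OF d(1)] by eventually_elim (use d(2) in force)
  }
qed

text \<open>The limit is the unstable eigenvalue of the saddle (0, -a); its positivity drives
  \<open>gap_zero\<close>.\<close>

lemma rate_tendsto:
  assumes C: "concave_flow a b f g h" and q: "(phase_q f g h \<longlongrightarrow> - a) at_top"
  shows "(rate f g h \<longlongrightarrow> a) at_top"
proof -
  note u = concave_phase(7)[OF C]
  note s = sep_phase_u_tendsto[OF C]
  have "((\<lambda>t. - (a + phase_u f g t + phase_q f g h t + sep (phase_u f g t))
     - slope (phase_u f g t) (sep (phase_u f g t)) / (sep (phase_u f g t) - 2 * phase_u f g t))
     \<longlongrightarrow> - (a + 0 + - a + - a) - slope 0 (- a) / (- a - 2 * 0)) at_top"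
    unfolding slope_def by (intro tendsto_intros u s q) (use a in simp)
  moreover have "- (a + 0 + - a + - a) - slope 0 (- a) / (- a - 2 * 0) = a"
    by (simp add: slope_def power2_eq_square)
  ultimately show ?thesis unfolding rate_def[abs_def] by (simp only:)
qed

lemma gap_propagates_concave:
  assumes C: "concave_flow a b f g h" and h0: "h 0 < 0" and u0: "phase_u f g 0 \<le> umax" and t: "0 \<le> t"
  shows "\<exists>k>0. gap f g h t \<le> k * gap f g h 0" "\<exists>k>0. - gap f g h t \<le> k * - gap f g h 0"
proof -
  have F: "flow a b {0..t} f g h" using C flow_subset[of a b "{0..}" f g h "{0..t}"] by (auto simp: concave_flow_def)
  have P: "0 < f x" "0 < g x" "h x < 0" if "x \<in> {0..t}" for x
    using C h0 that by (auto simp: concave_flow_def order_le_less)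
  note r = gap_propagates[OF F t P u0]
  show "\<exists>k>0. gap f g h t \<le> k * gap f g h 0" by (rule r(1))
  show "\<exists>k>0. - gap f g h t \<le> k * - gap f g h 0" by (rule r(2))
qed

text \<open>Near \<open>(0, - a)\<close> the gap is expanded by the flow, at rate \<open>a > 0\<close>, so an orbit that
  approaches the separatrix lies on it.\<close>

lemma gap_zero:
  assumes C: "concave_flow a b f g h" and h0: "h 0 < 0" and u0: "phase_u f g 0 \<le> umax"
    and q: "(phase_q f g h \<longlongrightarrow> - a) at_top"
  shows "gap f g h 0 = 0"
proof (rule ccontr)
  assume n0: "gap f g h 0 \<noteq> 0"
  have F: "flow a b {0..} f g h" using C by (simp add: concave_flow_def)
  have P: "0 < f t" "0 < g t" if "0 \<le> t" for t using C that by (auto simp: concave_flow_def)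
  have n: "gap f g h t \<noteq> 0" if "0 \<le> t" for t
  proof -
    obtain k k' where "0 < k" "gap f g h t \<le> k * gap f g h 0" "0 < k'" "- gap f g h t \<le> k' * - gap f g h 0"
      using gap_propagates_concave[OF C h0 u0 \<open>0 \<le> t\<close>] by blast
    then show ?thesis using n0 by (smt (verit) mult_pos_pos mult_pos_neg)
  qed
  have "\<forall>\<^sub>F t in at_top. 0 < rate f g h t \<and> phase_u f g t < umax \<and> 0 \<le> t"
    using order_tendstoD(1)[OF rate_tendsto[OF C q] a] order_tendstoD(2)[OF concave_phase(7)[OF C] umax_pos]
      eventually_ge_at_top[of 0] by eventually_elim simp
  then obtain T0 where T0: "\<And>t. T0 \<le> t \<Longrightarrow> 0 < rate f g h t \<and> phase_u f g t < umax \<and> 0 \<le> t"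
    unfolding eventually_at_top_linorder by blast
  define T where "T = max 0 T0"
  have T: "0 \<le> T" "\<And>t. T \<le> t \<Longrightarrow> 0 < rate f g h t" "\<And>t. T \<le> t \<Longrightarrow> phase_u f g t < umax"
    using T0 by (auto simp: T_def)
  \<comment> \<open>Past \<open>T\<close> the rate is positive, so the square of the gap cannot
    decrease; since it tends to 0, it must already vanish at \<open>T\<close>, against
    \<open>n\<close>.\<close>
  have inc: "(gap f g h T)\<^sup>2 \<le> (gap f g h t)\<^sup>2" if t: "T \<le> t" for t
  proof (rule DERIV_nonneg_imp_increasing_open[where f = "\<lambda>x. (gap f g h x)\<^sup>2", OF t])
    have F': "flow a b {T..t} f g h" by (rule flow_subset[OF F]) (use T in auto)
    have "continuous_on {T..t} (gap f g h)"
      by (rule gap_continuous(1)[OF F']) (use P T in \<open>auto simp: less_imp_le\<close>)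
    then show "continuous_on {T..t} (\<lambda>x. (gap f g h x)\<^sup>2)" by (intro continuous_intros)
    fix x assume x: "T < x" "x < t"
    then have x0: "0 \<le> x" using T(1) by simp
    have "(gap f g h has_real_derivative f x * rate f g h x * gap f g h x) (at x)"
      by (rule gap_DERIV[OF F' x P[OF x0]]) (use T x in simp)
    then have "((\<lambda>x. (gap f g h x)\<^sup>2) has_real_derivative 2 * (f x * rate f g h x) * (gap f g h x)\<^sup>2) (at x)"
      by (auto intro!: derivative_eq_intros simp: power2_eq_square)
    moreover have "0 \<le> 2 * (f x * rate f g h x) * (gap f g h x)\<^sup>2"
      using P(1)[OF x0] T(2)[of x] x by simp
    ultimately show "\<exists>y. ((\<lambda>x. (gap f g h x)\<^sup>2) has_real_derivative y) (at x) \<and> 0 \<le> y" by blast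
  qed
  have "(gap f g h \<longlongrightarrow> - a - - a) at_top"
    unfolding gap_def[abs_def] by (intro tendsto_diff q sep_phase_u_tendsto[OF C])
  then have "((\<lambda>t. (gap f g h t)\<^sup>2) \<longlongrightarrow> 0) at_top"
    using tendsto_power[of "gap f g h" 0 at_top 2] by simp
  then have "(gap f g h T)\<^sup>2 \<le> 0"
    by (rule tendsto_lowerbound) (auto intro: eventually_at_top_linorderI[of T] inc)
  then show False using n[OF T(1)] by simp
qed

text \<open>An orbit starting below the separatrix stays below, hence q is squeezed between -a and
  sep(u), which tends to -a. Then \<open>gap_zero\<close> puts the orbit on the separatrix after
  all.\<close>

lemma gap_nonneg:
  assumes C: "concave_flow a b f g h" and h0: "h 0 < 0" and u0: "phase_u f g 0 \<le> umax"
  shows "0 \<le> gap f g h 0"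
proof (rule ccontr)
  assume neg: "\<not> 0 \<le> gap f g h 0"
  have lt: "phase_q f g h t \<le> sep (phase_u f g t)" if "0 \<le> t" for t
  proof -
    obtain k where "0 < k" "gap f g h t \<le> k * gap f g h 0"
      using gap_propagates_concave(1)[OF C h0 u0 \<open>0 \<le> t\<close>] by blast
    then have "gap f g h t < 0" using neg by (smt (verit) mult_pos_neg)
    then show ?thesis by (simp add: gap_def)
  qed
  have "(phase_q f g h \<longlongrightarrow> - a) at_top"
  proof (rule tendsto_sandwich[OF _ _ tendsto_const sep_phase_u_tendsto[OF C]])
    show "\<forall>\<^sub>F t in at_top. - a \<le> phase_q f g h t"
      by (rule eventually_at_top_linorderI[of 0]) (use concave_phase(5)[OF C] in \<open>auto intro: less_imp_le\<close>)
    show "\<forall>\<^sub>F t in at_top. phase_q f g h t \<le> sep (phase_u f g t)"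
      by (rule eventually_at_top_linorderI[of 0]) (rule lt)
  qed
  then show False using gap_zero[OF C h0 u0] neg by simp
qed

text \<open>Since u tends to 0 continuously, an orbit starting with u >= umax passes u = umax. There
  sep vanishes while q < 0, so the orbit is below the separatrix at that moment, which
  \<open>gap_nonneg\<close> forbids for the time-shifted solution.\<close>

lemma phase_u_less_umax:
  assumes C: "concave_flow a b f g h" and h0: "h 0 < 0"
  shows "phase_u f g 0 < umax"
proof (rule ccontr)
  assume ge: "\<not> ?thesis"
  have "\<forall>\<^sub>F t in at_top. phase_u f g t < umax \<and> 0 \<le> t"
    using order_tendstoD(2)[OF concave_phase(7)[OF C] umax_pos] eventually_ge_at_top[of 0]
    by eventually_elim simp
  then obtain T where T: "phase_u f g T < umax" "0 \<le> T"
    using eventually_happens'[OF trivial_limit_at_top_linorder] by blast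
  obtain s where s: "0 \<le> s" "phase_u f g s = umax"
    using IVT2'[of "phase_u f g" T umax 0] T ge continuous_on_subset[OF concave_phase(1)[OF C], of "{0..T}"]
    by auto
  define f' g' h' where "f' t = f (t + s)" and "g' t = g (t + s)" and "h' t = h (t + s)" for t
  have C': "concave_flow a b f' g' h'"
    unfolding f'_def g'_def h'_def by (rule concave_flow_shift[OF C s(1)])
  have P: "0 < f s" "0 < g s" "h s < 0" using C h0 s(1) by (auto simp: concave_flow_def order_le_less)
  have u': "phase_u f' g' 0 = umax" using s(2) by (simp add: phase_u_def f'_def g'_def)
  have "phase_q f' g' h' 0 < 0" using P by (simp add: phase_q_def f'_def g'_def h'_def divide_neg_pos)
  then have "gap f' g' h' 0 < 0" by (simp add: gap_def u' sep_umax)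
  moreover have "0 \<le> gap f' g' h' 0"
    by (rule gap_nonneg[OF C']) (use P u' in \<open>auto simp: h'_def\<close>)
  ultimately show False by simp
qed

text \<open>The link is the condition that q tends to -a. Boundedness implies it and
  \<open>gap_zero\<close> applies; conversely a zero gap persists, so q = sep(u) tends to -a and f
  is bounded.\<close>

lemma bounded_iff_gap_zero:
  assumes C: "concave_flow a b f g h" and h0: "h 0 < 0"
  shows "(\<exists>M. \<forall>t\<ge>0. f t \<le> M) \<longleftrightarrow> gap f g h 0 = 0"
proof
  note u0 = less_imp_le[OF phase_u_less_umax[OF C h0]]
  show "gap f g h 0 = 0" if "\<exists>M. \<forall>t\<ge>0. f t \<le> M"
    using gap_zero[OF C h0 u0] bounded_phase_q[OF C] that by blast
  assume 0: "gap f g h 0 = 0"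
  have eq: "phase_q f g h t = sep (phase_u f g t)" if "0 \<le> t" for t
    using gap_propagates_concave[OF C h0 u0 that] 0 by (auto simp: gap_def)
  have "(phase_q f g h \<longlongrightarrow> - a) at_top"
    using sep_phase_u_tendsto[OF C]
    by (rule Lim_transform_eventually) (rule eventually_at_top_linorderI[of 0], simp add: eq)
  then show "\<exists>M. \<forall>t\<ge>0. f t \<le> M" by (rule phase_q_imp_bounded[OF C])
qed

end

section \<open>Solutions above the separatrix\<close>

lemma flow_glue:
  assumes ex: "\<And>n :: nat. \<exists>f g h. flow a b {0..real (Suc n)} f g h \<and> f 0 = x \<and> g 0 = y \<and> h 0 = z"
  shows "\<exists>f g h. flow a b {0..} f g h \<and> f 0 = x \<and> g 0 = y \<and> h 0 = z"
proof -
  obtain F G H where FGH: "\<And>n. flow a b {0..real (Suc n)} (F n) (G n) (H n)"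
      "\<And>n. F n 0 = x" "\<And>n. G n 0 = y" "\<And>n. H n 0 = z"
    using ex by metis
  have agree: "F n t = F k t \<and> G n t = G k t \<and> H n t = H k t"
    if "0 \<le> t" "t \<le> real (Suc n)" "t \<le> real (Suc k)" for n k t
  proof -
    have "flow a b {0..t} (F n) (G n) (H n)" "flow a b {0..t} (F k) (G k) (H k)"
      by (rule flow_subset[OF FGH(1)]; use that in auto)+
    from flow_unique[OF this, of t] show ?thesis using FGH that by auto
  qed
  define N where "N t = nat \<lceil>t\<rceil>" for t :: real
  have N: "t < real (Suc (N t))" if "0 \<le> t" for t
    unfolding N_def using that by linarith
  define f g h where "f t = F (N t) t" and "g t = G (N t) t" and "h t = H (N t) t" for t
  have "flow a b {0..} f g h"
    unfolding flow_def
  proof (intro ballI)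
    fix t :: real assume "t \<in> {0..}"
    then have t: "0 \<le> t" by simp
    define k where "k = N t"
    have k: "t < real (Suc k)" using N[OF t] by (simp add: k_def)
    have w: "at t within {0..real (Suc k)} = at t within {0..}"
      by (rule at_within_nhd[of _ "{..<real (Suc k)}"]) (use k in auto)
    have eq: "F k s = f s" "G k s = g s" "H k s = h s" if "s \<in> {0..}" "dist s t < real (Suc k) - t" for s
    proof -
      have "s < real (Suc k)" using that by (auto simp: dist_real_def)
      then show "F k s = f s" "G k s = g s" "H k s = h s"
        using agree[of s k "N s"] N[of s] that by (auto simp: f_def g_def h_def)
    qed
    have "t \<in> {0..real (Suc k)}" using t k by simp
    note d = FGH(1)[of k, unfolded flow_def, rule_format, OF this, unfolded w]
    have e: "0 < real (Suc k) - t" using k by simp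
    have ft: "G k t = g t" "H k t = h t" "F k t = f t" using eq[of t] t e by auto
    show "(f has_real_derivative g t) (at t within {0..}) \<and> (g has_real_derivative h t) (at t within {0..}) \<and>
      (h has_real_derivative - (a * f t * h t + b * (g t)\<^sup>2)) (at t within {0..})"
    proof (intro conjI)
      show "(f has_real_derivative g t) (at t within {0..})"
        by (rule has_field_derivative_transform_within[OF conjunct1[OF d, unfolded ft] e \<open>t \<in> {0..}\<close>]) (rule eq)
      show "(g has_real_derivative h t) (at t within {0..})"
        by (rule has_field_derivative_transform_within[OF conjunct1[OF conjunct2[OF d], unfolded ft] e \<open>t \<in> {0..}\<close>]) (rule eq)
      show "(h has_real_derivative - (a * f t * h t + b * (g t)\<^sup>2)) (at t within {0..})"
        by (rule has_field_derivative_transform_within[OF conjunct2[OF conjunct2[OF d], unfolded ft] e \<open>t \<in> {0..}\<close>]) (rule eq)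
    qed
  qed
  moreover have "f 0 = x" "g 0 = y" "h 0 = z" by (simp_all add: f_def g_def h_def FGH)
  ultimately show ?thesis by blast
qed

context reference_flow
begin

lemma b_pos: "0 < b" using a ab by simp

text \<open>Above the separatrix \<open>f'' > - a f f'\<close>, which keeps \<open>f'\<close> from reaching zero.\<close>

lemma local_positivity:
  assumes F: "flow a b {0..T} f g h" and f0: "0 < f 0" and g0: "0 < g 0" and h0: "h 0 < 0"
    and u0: "phase_u f g 0 \<le> umax" and gap: "0 < gap f g h 0" and t: "t \<in> {0..T}"
  shows "f 0 \<le> f t \<and> 0 < g t \<and> g t \<le> g 0 \<and> h t < 0"
proof -
  have H: "h s < 0" if "s \<in> {0..T}" for s
    by (rule flow_concave[OF F _ h0 that]) (use b_pos in simp)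
  have fmono: "f 0 \<le> f s" if s: "s \<in> {0..T}" and pos: "\<And>x. 0 < x \<Longrightarrow> x < s \<Longrightarrow> 0 < g x" for s
  proof (rule DERIV_nonneg_imp_increasing_open[where f = f and a = 0 and b = s])
    show "0 \<le> s" using s by simp
    show "continuous_on {0..s} f" by (rule continuous_on_subset[OF flow_continuous(1)[OF F]]) (use s in auto)
    fix x assume x: "0 < x" "x < s"
    have "{0<..<s} \<subseteq> {0..T}" using s by auto
    from flow_DERIV(1)[OF F this x] pos[OF x]
    show "\<exists>y. (f has_real_derivative y) (at x) \<and> 0 \<le> y" by (intro exI[of _ "g x"]) simp
  qed
  have G: "0 < g s" if s: "s \<in> {0..T}" for s
  proof (rule ccontr)
    assume "\<not> 0 < g s"
    moreover have "continuous_on {0..T} (\<lambda>x. - g x)"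
      by (intro continuous_intros flow_continuous[OF F])
    ultimately obtain r where r: "r \<in> {0..T}" "0 < r" "- g r = 0" "\<forall>x\<in>{0..<r}. - g x < 0"
      using first_hit[of 0 T "\<lambda>x. - g x" 0 s] g0 s by auto
    \<comment> \<open>The phase variables are available only while f and g are positive, so the
      argument runs up to the first zero \<open>r\<close> of g; before it f increases and stays
      positive.\<close>
    have fpos: "0 < f x" if "x \<in> {0..r}" for x
      using fmono[of x] f0 r that by auto
    have "\<exists>k>0. - g r \<le> k * - g 0"
    proof (rule lin_diff_ineq[where y = "\<lambda>x. - g x" and s = 0 and t = r and p = "\<lambda>x. - a * f x"])
      show "continuous_on {0..r} (\<lambda>x. - g x)" "continuous_on {0..r} (\<lambda>x. - a * f x)"
        using r by (auto intro!: continuous_intros flow_continuous[OF F, THEN continuous_on_subset])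
      fix x assume x: "0 < x" "x < r"
      have F': "flow a b {0..x} f g h" by (rule flow_subset[OF F]) (use x r in auto)
      have "\<exists>k>0. - gap f g h x \<le> k * - gap f g h 0"
        by (rule gap_propagates(2)[OF F']) (use x r fpos H u0 in auto)
      then obtain k where "0 < k" "- gap f g h x \<le> k * - gap f g h 0" by blast
      then have "0 < gap f g h x" using gap by (smt (verit) mult_pos_neg)
      then have q: "sep (phase_u f g x) < phase_q f g h x" by (simp add: gap_def)
      have xp: "0 < f x" "0 < g x" using fpos[of x] r x by auto
      have "phase_u f g x < phase_u f g 0"
        by (rule phase_u_decreasing[OF F']) (use x r fpos H in auto)
      then have "- a < sep (phase_u f g x)"
        using xp u0 by (intro sep_gt) (auto simp: phase_u_def)
      then have "- a < h x / (f x * g x)" using q by (simp add: phase_q_def)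
      then have "- h x \<le> - a * f x * - g x" using xp by (simp add: pos_less_divide_eq mult.assoc)
      moreover have "((\<lambda>x. - g x) has_real_derivative - h x) (at x)"
      proof -
        have "{0<..<r} \<subseteq> {0..T}" using r by auto
        from flow_DERIV(2)[OF F this x] show ?thesis by (rule DERIV_minus)
      qed
      ultimately show "\<exists>D. ((\<lambda>x. - g x) has_real_derivative D) (at x) \<and> D \<le> - a * f x * - g x" by blast
    qed (use r in simp)
    then obtain k where "0 < k" "- g r \<le> k * - g 0" by blast
    then show False using g0 r(3) by (smt (verit) mult_pos_neg)
  qed
  have "g t \<le> g 0"
  proof (rule DERIV_nonpos_imp_decreasing_open[where f = g and a = 0 and b = t])
    show "0 \<le> t" using t by simp
    show "continuous_on {0..t} g" by (rule continuous_on_subset[OF flow_continuous(2)[OF F]]) (use t in auto)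
    fix x assume x: "0 < x" "x < t"
    have "{0<..<t} \<subseteq> {0..T}" using t by auto
    from flow_DERIV(2)[OF F this x] H[of x] x t
    show "\<exists>y. (g has_real_derivative y) (at x) \<and> y \<le> 0" by (intro exI[of _ "h x"]) auto
  qed
  then show ?thesis using fmono[OF t] G[OF t] H[OF t] G t by auto
qed

text \<open>By \<open>local_positivity\<close>, any solution on [0, T] satisfies 0 < g <= y and f >=
  x. Integration adds f <= x + y T and h >= z - b y^2 T, and h stays negative. With \<open>R\<close>
  above all these bounds, \<open>flow_local\<close> cannot end at the boundary of its box, so
  solutions exist on every [0, T] and glue together.\<close>

lemma global_above_separatrix:
  assumes x: "0 < x" and y: "0 < y" and z: "z < 0"
    and u: "y / x\<^sup>2 \<le> umax" and q: "sep (y / x\<^sup>2) < z / (x * y)"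
  shows "\<exists>f g h. concave_flow a b f g h \<and> f 0 = x \<and> g 0 = y \<and> h 0 = z"
proof -
  have positivity: "x \<le> f t \<and> 0 < g t \<and> g t \<le> y \<and> h t < 0"
    if "flow a b {0..T} f g h" "f 0 = x" "g 0 = y" "h 0 = z" "t \<in> {0..T}" for f g h T t
    using local_positivity[OF that(1) _ _ _ _ _ that(5)] x y z u q that(2-4)
    by (simp add: gap_def phase_u_def phase_q_def)
  have "\<exists>f g h. flow a b {0..T} f g h \<and> f 0 = x \<and> g 0 = y \<and> h 0 = z" if T: "0 < T" for T
  proof -
    define R where "R = 1 + (x + y * T) + y + (- z + b * y\<^sup>2 * T)"
    have nn: "0 \<le> y * T" "0 \<le> b * y\<^sup>2 * T" using y T b_pos by auto
    have "\<bar>x\<bar> < R" "\<bar>y\<bar> < R" "\<bar>z\<bar> < R" using x y z nn by (auto simp: R_def)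
    from flow_local[OF this T, of a b] obtain f g h \<tau> where
      f: "0 < \<tau>" "\<tau> \<le> T" "flow a b {0..\<tau>} f g h" "f 0 = x" "g 0 = y" "h 0 = z"
      and end_: "\<tau> = T \<or> \<bar>f \<tau>\<bar> = R \<or> \<bar>g \<tau>\<bar> = R \<or> \<bar>h \<tau>\<bar> = R" by blast
    note P = positivity[OF f(3-6)]
    have P\<tau>: "x \<le> f \<tau>" "0 < g \<tau>" "g \<tau> \<le> y" "h \<tau> < 0" using P[of \<tau>] f(1) by auto
    have sub: "{0<..<\<tau>} \<subseteq> {0..\<tau>}" by auto
    have Ty: "y * \<tau> \<le> y * T" "b * y\<^sup>2 * \<tau> \<le> b * y\<^sup>2 * T" using f(2) y b_pos by (auto intro!: mult_left_mono)
    have "f \<tau> - y * \<tau> \<le> f 0 - y * 0"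
    proof (rule DERIV_nonpos_imp_decreasing_open[where f = "\<lambda>s. f s - y * s" and a = 0 and b = \<tau>])
      show "continuous_on {0..\<tau>} (\<lambda>s. f s - y * s)" by (intro continuous_intros flow_continuous[OF f(3)])
      fix s assume s: "0 < s" "s < \<tau>"
      have "((\<lambda>s. f s - y * s) has_real_derivative g s - y) (at s)"
        using flow_DERIV(1)[OF f(3) sub s] by (auto intro!: derivative_eq_intros)
      then show "\<exists>D. ((\<lambda>s. f s - y * s) has_real_derivative D) (at s) \<and> D \<le> 0"
        using P[of s] s by (intro exI[of _ "g s - y"]) auto
    qed (use f in simp)
    then have "\<bar>f \<tau>\<bar> < R" using P\<tau> f(4) x y z nn Ty unfolding R_def by linarith
    moreover have "\<bar>g \<tau>\<bar> < R" using P\<tau> x y z nn unfolding R_def by linarith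
    moreover have "h 0 + b * y\<^sup>2 * 0 \<le> h \<tau> + b * y\<^sup>2 * \<tau>"
    proof (rule DERIV_nonneg_imp_increasing_open[where f = "\<lambda>s. h s + b * y\<^sup>2 * s" and a = 0 and b = \<tau>])
      show "continuous_on {0..\<tau>} (\<lambda>s. h s + b * y\<^sup>2 * s)" by (intro continuous_intros flow_continuous[OF f(3)])
      fix s assume s: "0 < s" "s < \<tau>"
      have "((\<lambda>s. h s + b * y\<^sup>2 * s) has_real_derivative - (a * f s * h s + b * (g s)\<^sup>2) + b * y\<^sup>2) (at s)"
        using flow_DERIV(3)[OF f(3) sub s] by (auto intro!: derivative_eq_intros)
      moreover have "a * f s * h s \<le> 0" using P[of s] s a x by (intro mult_nonneg_nonpos) auto
      moreover have "b * (g s)\<^sup>2 \<le> b * y\<^sup>2" using P[of s] s b_pos by (intro mult_left_mono power_mono) auto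
      ultimately show "\<exists>D. ((\<lambda>s. h s + b * y\<^sup>2 * s) has_real_derivative D) (at s) \<and> 0 \<le> D"
        by (intro exI conjI) (assumption, linarith)
    qed (use f in simp)
    then have "\<bar>h \<tau>\<bar> < R" using P\<tau> f(6) x y z nn Ty unfolding R_def by linarith
    ultimately have "\<tau> = T" using end_ by auto
    then show ?thesis using f by blast
  qed
  then have "\<exists>f g h. flow a b {0..} f g h \<and> f 0 = x \<and> g 0 = y \<and> h 0 = z"
    by (intro flow_glue) simp
  then obtain f g h where f: "flow a b {0..} f g h" "f 0 = x" "g 0 = y" "h 0 = z" by blast
  have "x \<le> f t \<and> 0 < g t \<and> g t \<le> y \<and> h t < 0" if "0 \<le> t" for t
  proof (rule positivity[where f = f and g = g and h = h and T = t and t = t, OF _ f(2) f(3) f(4)])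
    show "flow a b {0..t} f g h" by (rule flow_subset[OF f(1)]) auto
  qed (use that in simp)
  then have "concave_flow a b f g h"
    using f x unfolding concave_flow_def by force
  then show ?thesis using f by blast
qed

end

section \<open>A bounded solution near infinity\<close>

context similarity_flow
begin

text \<open>Coefficients of \<open>1 - f\<close> as a power series in \<open>z = exp (- a t)\<close>.\<close>

fun coeff :: "nat \<Rightarrow> real" where
  "coeff n = (if n = 0 then 0 else if n = 1 then 1 else
     - (\<Sum>i\<in>{1..<n}. (a * real (n - i) ^ 2 + b * (real i * real (n - i))) * (coeff i * coeff (n - i)))
       / (a * (real n ^ 2 * (real n - 1))))"

declare coeff.simps [simp del]

lemma coeff_0: "coeff 0 = 0" and coeff_1: "coeff (Suc 0) = 1"
  by (simp_all add: coeff.simps)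

text \<open>Holds for every n: for n = 0 and n = 1 the factor in front of \<open>coeff n\<close> and
  the sum both vanish. Hence the first coefficient is free; its size is a choice of the origin of
  time, and its positive sign makes f increase to its limit.\<close>

lemma coeff_rec:
  "a * (real n ^ 2 * (real n - 1)) * coeff n =
     - (\<Sum>i\<in>{1..<n}. (a * real (n - i) ^ 2 + b * (real i * real (n - i))) * (coeff i * coeff (n - i)))"
proof -
  consider "n = 0" | "n = 1" | "2 \<le> n" by linarith
  then show ?thesis
  proof cases
    case 3
    then have "a * (real n ^ 2 * (real n - 1)) \<noteq> 0" using a by simp
    then show ?thesis using 3 by (subst coeff.simps) simp
  qed (auto simp: coeff_0)
qed

text \<open>With C = (a + b)/a, each of the n - 1 summands is at most (a + b) n^2 C^(n-2). Division
  by a n^2 (n - 1) gives exactly C^(n-1), so the induction closes.\<close>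

lemma coeff_bound: "1 \<le> n \<Longrightarrow> \<bar>coeff n\<bar> \<le> ((a + b) / a) ^ (n - 1)"
proof (induction n rule: less_induct)
  case (less n)
  define C where "C = (a + b) / a"
  have C: "0 < C" using a ab by (simp add: C_def)
  show ?case
  proof (cases "n = 1")
    case True
    then show ?thesis by (simp add: coeff_1)
  next
    case False
    then have n: "2 \<le> n" using less.prems by simp
    define D where "D = a * (real n ^ 2 * (real n - 1))"
    have D: "0 < D" using a n by (simp add: D_def)
    have term_le: "\<bar>(a * real (n - i) ^ 2 + b * (real i * real (n - i))) * (coeff i * coeff (n - i))\<bar>
        \<le> (a + b) * real n ^ 2 * C ^ (n - 2)" if i: "i \<in> {1..<n}" for i
    proof -
      have "\<bar>coeff i * coeff (n - i)\<bar> \<le> C ^ (i - 1) * C ^ (n - i - 1)"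
        unfolding abs_mult C_def using less.IH[of i] less.IH[of "n - i"] i
        by (intro mult_mono) auto
      also have "\<dots> = C ^ (n - 2)"
        using i by (simp flip: power_add)
      finally have c: "\<bar>coeff i * coeff (n - i)\<bar> \<le> C ^ (n - 2)" .
      have "a * real (n - i) ^ 2 + b * (real i * real (n - i)) \<le> a * real n ^ 2 + b * (real n * real n)"
        using a ab i by (intro add_mono mult_left_mono mult_mono power_mono) auto
      also have "\<dots> = (a + b) * real n ^ 2" by (simp add: algebra_simps power2_eq_square)
      finally have w: "a * real (n - i) ^ 2 + b * (real i * real (n - i)) \<le> (a + b) * real n ^ 2" .
      have "0 \<le> a * real (n - i) ^ 2 + b * (real i * real (n - i))" using a ab by simp
      then show ?thesis unfolding abs_mult[of _ "coeff i * coeff (n - i)"]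
        using c w a ab by (intro mult_mono) auto
    qed
    have "D * \<bar>coeff n\<bar> = \<bar>D * coeff n\<bar>" using D by (simp add: abs_mult)
    also have "\<dots> = \<bar>\<Sum>i\<in>{1..<n}. (a * real (n - i) ^ 2 + b * (real i * real (n - i))) * (coeff i * coeff (n - i))\<bar>"
      unfolding D_def coeff_rec by simp
    also have "\<dots> \<le> (\<Sum>i\<in>{1..<n}. \<bar>(a * real (n - i) ^ 2 + b * (real i * real (n - i))) * (coeff i * coeff (n - i))\<bar>)"
      by (rule sum_abs)
    also have "\<dots> \<le> of_nat (card {1..<n}) * ((a + b) * real n ^ 2 * C ^ (n - 2))"
      by (rule sum_bounded_above) (rule term_le)
    also have "\<dots> = D * (C * C ^ (n - 2))"
      using n a by (simp add: D_def C_def of_nat_diff field_simps)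
    also have "C * C ^ (n - 2) = C ^ (n - 1)"
      using n by (simp flip: power_Suc add: Suc_diff_le numeral_2_eq_2 Suc_diff_Suc)
    finally have "D * \<bar>coeff n\<bar> \<le> D * C ^ (n - 1)" .
    then show ?thesis using D by (simp add: C_def)
  qed
qed

text \<open>The series \<open>ser1\<close>, \<open>ser2\<close>, \<open>ser3\<close> are the
  iterates of \<theta> = X d/dX on \<open>ser\<close>. For z = exp(-a t), time differentiation is -a
  \<theta>.\<close>

definition ser :: "real fps" where "ser = Abs_fps coeff"
definition ser1 :: "real fps" where "ser1 = fps_X * fps_deriv ser"
definition ser2 :: "real fps" where "ser2 = fps_X * fps_deriv ser1"
definition ser3 :: "real fps" where "ser3 = fps_X * fps_deriv ser2"

lemma ser_nth:
  "fps_nth ser n = coeff n" "fps_nth ser1 n = real n * coeff n"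
  "fps_nth ser2 n = real n ^ 2 * coeff n" "fps_nth ser3 n = real n ^ 3 * coeff n"
proof -
  have X: "fps_nth (fps_X * fps_deriv F) n = real n * fps_nth F n" for F :: "real fps"
    by (cases n) simp_all
  show "fps_nth ser n = coeff n" by (simp add: ser_def)
  then show 1: "fps_nth ser1 n = real n * coeff n" by (simp add: ser1_def X)
  then show 2: "fps_nth ser2 n = real n ^ 2 * coeff n" by (simp add: ser2_def X power2_eq_square)
  then show "fps_nth ser3 n = real n ^ 3 * coeff n" by (simp add: ser3_def X power2_eq_square power3_eq_cube)
qed

text \<open>Substituting f = 1 - ser(z), f' = a ser1(z), f'' = -a^2 ser2(z), f''' = a^3 ser3(z) into
  the equation and dividing by a^2 gives this identity; its coefficients are
  \<open>coeff_rec\<close>.\<close>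

lemma ser_equation:
  "fps_const a * ser3 + fps_const a * (ser * ser2) + fps_const b * (ser1 * ser1) = fps_const a * ser2"
proof (rule fps_ext)
  fix n
  have sum_eq: "(\<Sum>i=0..n. F i) = (\<Sum>i\<in>{1..<n}. F i)" if "F 0 = 0" "F n = 0" for F :: "nat \<Rightarrow> real"
  proof (rule sum.mono_neutral_right)
    show "\<forall>i\<in>{0..n} - {1..<n}. F i = 0"
    proof
      fix i assume "i \<in> {0..n} - {1..<n}"
      then have "i = 0 \<or> i = n" by auto
      then show "F i = 0" using that by auto
    qed
  qed auto
  have "fps_nth (ser * ser2) n = (\<Sum>i=0..n. coeff i * (real (n - i) ^ 2 * coeff (n - i)))"
    by (simp add: fps_mult_nth ser_nth)
  also have "\<dots> = (\<Sum>i\<in>{1..<n}. coeff i * (real (n - i) ^ 2 * coeff (n - i)))"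
    by (rule sum_eq) (auto simp: coeff_0)
  finally have 1: "fps_nth (ser * ser2) n = (\<Sum>i\<in>{1..<n}. coeff i * (real (n - i) ^ 2 * coeff (n - i)))" .
  have "fps_nth (ser1 * ser1) n = (\<Sum>i=0..n. real i * coeff i * (real (n - i) * coeff (n - i)))"
    by (simp add: fps_mult_nth ser_nth)
  also have "\<dots> = (\<Sum>i\<in>{1..<n}. real i * coeff i * (real (n - i) * coeff (n - i)))"
    by (rule sum_eq) (auto simp: coeff_0)
  finally have 2: "fps_nth (ser1 * ser1) n = (\<Sum>i\<in>{1..<n}. real i * coeff i * (real (n - i) * coeff (n - i)))" .
  have "a * fps_nth (ser * ser2) n + b * fps_nth (ser1 * ser1) n =
    (\<Sum>i\<in>{1..<n}. (a * real (n - i) ^ 2 + b * (real i * real (n - i))) * (coeff i * coeff (n - i)))"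
    unfolding 1 2 sum_distrib_left sum.distrib[symmetric] by (intro sum.cong) (auto simp: algebra_simps)
  also have "\<dots> = - (a * (real n ^ 2 * (real n - 1)) * coeff n)"
    using coeff_rec[of n] by simp
  finally show "fps_nth (fps_const a * ser3 + fps_const a * (ser * ser2) + fps_const b * (ser1 * ser1)) n
    = fps_nth (fps_const a * ser2) n"
    by (simp add: ser_nth algebra_simps power2_eq_square power3_eq_cube)
qed

text \<open>The reciprocal of the geometric ratio in \<open>coeff_bound\<close>: a lower bound for
  the radius of convergence.\<close>

definition rad :: real where "rad = a / (a + b)"

lemma rad_pos: "0 < rad" using a ab by (simp add: rad_def)

lemma radius_fps_X_mult:
  fixes F :: "real fps"
  assumes "ereal rad \<le> fps_conv_radius F"
  shows "ereal rad \<le> fps_conv_radius (fps_X * F)"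
  using assms fps_conv_radius_mult[of fps_X F] by simp

lemma in_radius:
  fixes z :: real
  assumes "\<bar>z\<bar> < rad" and "ereal rad \<le> R"
  shows "ereal (norm z) < R"
proof -
  have "ereal (norm z) < ereal rad" using assms(1) by simp
  then show ?thesis using assms(2) by (rule less_le_trans)
qed

lemma ser_radius:
  "ereal rad \<le> fps_conv_radius ser" "ereal rad \<le> fps_conv_radius ser1" "ereal rad \<le> fps_conv_radius ser2"
  "ereal rad \<le> fps_conv_radius (fps_deriv ser)" "ereal rad \<le> fps_conv_radius (fps_deriv ser1)"
  "ereal rad \<le> fps_conv_radius (fps_deriv ser2)"
proof -
  show 0: "ereal rad \<le> fps_conv_radius ser"
    unfolding fps_conv_radius_def
  proof (rule conv_radius_geI_ex')
    fix r assume r: "0 < r" "ereal r < ereal rad"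
    define C where "C = (a + b) / a"
    have C: "0 < C" using a ab by (simp add: C_def)
    have "r * C < rad * C" using r C by simp
    then have rC: "r * C < 1" using a ab by (simp add: rad_def C_def)
    have "summable (\<lambda>n. (1 / C) * (r * C) ^ n)"
      using r C rC by (intro summable_mult summable_geometric) auto
    then show "summable (\<lambda>n. fps_nth ser n * of_real r ^ n)"
    proof (rule summable_comparison_test[rotated], intro exI[of _ 1] allI impI)
      fix n :: nat assume n: "1 \<le> n"
      have "norm (fps_nth ser n * of_real r ^ n) = \<bar>coeff n\<bar> * r ^ n"
        using r by (simp add: ser_nth abs_mult)
      also have "\<dots> \<le> C ^ (n - 1) * r ^ n"
        using coeff_bound[OF n] r by (intro mult_right_mono) (auto simp: C_def)
      also have "\<dots> = (1 / C) * (r * C) ^ n"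
        using n C by (cases n) (auto simp: power_mult_distrib)
      finally show "norm (fps_nth ser n * of_real r ^ n) \<le> (1 / C) * (r * C) ^ n" .
    qed
  qed
  have D: "ereal rad \<le> fps_conv_radius (fps_deriv F)" if "ereal rad \<le> fps_conv_radius F" for F :: "real fps"
    using that fps_conv_radius_deriv[of F] by (rule order_trans)
  show 1: "ereal rad \<le> fps_conv_radius ser1" unfolding ser1_def by (rule radius_fps_X_mult[OF D[OF 0]])
  show 2: "ereal rad \<le> fps_conv_radius ser2" unfolding ser2_def by (rule radius_fps_X_mult[OF D[OF 1]])
  show "ereal rad \<le> fps_conv_radius (fps_deriv ser)" "ereal rad \<le> fps_conv_radius (fps_deriv ser1)"
    "ereal rad \<le> fps_conv_radius (fps_deriv ser2)" by (rule D[OF 0] D[OF 1] D[OF 2])+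
qed

lemma eval_X_deriv:
  assumes "\<bar>z\<bar> < rad" "ereal rad \<le> fps_conv_radius (fps_deriv F)"
  shows "eval_fps (fps_X * fps_deriv F) z = z * eval_fps (fps_deriv F) z"
  using in_radius[OF assms] by (simp add: eval_fps_mult)

lemma eval_ser_equation:
  assumes z: "\<bar>z\<bar> < rad"
  shows "a * eval_fps ser3 z + a * (eval_fps ser z * eval_fps ser2 z) + b * (eval_fps ser1 z * eval_fps ser1 z)
    = a * eval_fps ser2 z"
proof -
  have zr: "ereal \<bar>z\<bar> < ereal rad" using z by simp
  note r = ser_radius[THEN less_le_trans[OF zr]]
  have r3: "ereal \<bar>z\<bar> < fps_conv_radius ser3"
    using zr radius_fps_X_mult[OF ser_radius(6)] unfolding ser3_def by (rule less_le_trans)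
  have m: "ereal \<bar>z\<bar> < fps_conv_radius (F * G)"
    if "ereal \<bar>z\<bar> < fps_conv_radius F" "ereal \<bar>z\<bar> < fps_conv_radius G" for F G :: "real fps"
    using fps_conv_radius_mult[of F G] that by (auto intro: less_le_trans[OF min_less_iff_conj[THEN iffD2]])
  have p: "ereal \<bar>z\<bar> < fps_conv_radius (F + G)"
    if "ereal \<bar>z\<bar> < fps_conv_radius F" "ereal \<bar>z\<bar> < fps_conv_radius G" for F G :: "real fps"
    using fps_conv_radius_add[of F G] that by (auto intro: less_le_trans[OF min_less_iff_conj[THEN iffD2]])
  have c: "ereal \<bar>z\<bar> < fps_conv_radius (fps_const x)" for x :: real by simp
  have "eval_fps (fps_const a * ser3 + fps_const a * (ser * ser2) + fps_const b * (ser1 * ser1)) z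
    = a * eval_fps ser3 z + a * (eval_fps ser z * eval_fps ser2 z) + b * (eval_fps ser1 z * eval_fps ser1 z)"
    by (simp add: eval_fps_add eval_fps_mult m p r r3 c del: fps_const_mult_apply_left)
  moreover have "eval_fps (fps_const a * ser2) z = a * eval_fps ser2 z"
    by (simp add: eval_fps_mult m r c)
  ultimately show ?thesis using ser_equation by simp
qed

text \<open>All signs are read off at z = 0, where \<open>ser\<close> is 0 and the derivatives of
  \<open>ser\<close> and \<open>ser1\<close> are 1. They persist for |z| < e. For 0 < z < e this
  yields 0 <= ser < 1 and positive \<open>ser1\<close>, \<open>ser2\<close>, which are the bounds
  for f and the signs of f' and f''.\<close>

lemma bounded_concave_flow_exists: "\<exists>f g h. concave_flow a b f g h \<and> (\<forall>t\<ge>0. f t \<le> 1) \<and> h 0 < 0"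
proof -
  have cont0: "isCont (eval_fps F) 0" if "ereal rad \<le> fps_conv_radius F" for F :: "real fps"
  proof (rule DERIV_isCont[OF has_field_derivative_eval_fps])
    show "ereal (norm (0::real)) < fps_conv_radius F"
      by (rule in_radius[OF _ that]) (simp add: rad_pos)
  qed
  have near: "\<forall>\<^sub>F z in nhds 0. \<bar>z\<bar> < rad \<and> eval_fps ser z < 1 \<and> 0 < eval_fps (fps_deriv ser) z \<and> 0 < eval_fps (fps_deriv ser1) z"
  proof -
    have t: "(eval_fps F \<longlongrightarrow> fps_nth F 0) (nhds 0)" if "ereal rad \<le> fps_conv_radius F" for F :: "real fps"
      using cont0[OF that] unfolding isCont_def tendsto_at_iff_tendsto_nhds by (simp add: eval_fps_at_0)
    have "\<forall>\<^sub>F z in nhds (0::real). z \<in> {- rad<..<rad}"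
      using rad_pos by (intro eventually_nhds_in_open) auto
    then have "\<forall>\<^sub>F z in nhds 0. \<bar>z\<bar> < rad" by eventually_elim auto
    moreover have "\<forall>\<^sub>F z in nhds 0. eval_fps ser z < 1"
      using t[OF ser_radius(1)] by (rule order_tendstoD(2)) (simp add: ser_nth coeff_0)
    moreover have "\<forall>\<^sub>F z in nhds 0. 0 < eval_fps (fps_deriv ser) z"
      using t[OF ser_radius(4)] by (rule order_tendstoD(1)) (simp add: ser_nth coeff_1)
    moreover have "\<forall>\<^sub>F z in nhds 0. 0 < eval_fps (fps_deriv ser1) z"
      using t[OF ser_radius(5)] by (rule order_tendstoD(1)) (simp add: ser_nth coeff_1)
    ultimately show ?thesis by eventually_elim simp
  qed
  then obtain e where e: "0 < e" "\<And>z. \<bar>z\<bar> < e \<Longrightarrow> \<bar>z\<bar> < rad \<and> eval_fps ser z < 1 \<and> 0 < eval_fps (fps_deriv ser) z \<and> 0 < eval_fps (fps_deriv ser1) z"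
    unfolding eventually_nhds_metric by (auto simp: dist_real_def)
  \<comment> \<open>The factor e/2 is a shift of time, which keeps z within the disc of radius
    \<open>e\<close> for all t >= 0.\<close>
  define Z where "Z t = (e / 2) * exp (- a * t)" for t
  have Z: "0 < Z t" "\<bar>Z t\<bar> < e" if "0 \<le> t" for t
  proof -
    show "0 < Z t" using e(1) by (simp add: Z_def)
    have "exp (- a * t) \<le> 1" using a that by simp
    then have "Z t \<le> e / 2 * 1" unfolding Z_def using e(1) by (intro mult_left_mono) auto
    then show "\<bar>Z t\<bar> < e" using e(1) \<open>0 < Z t\<close> by simp
  qed
  have dZ: "(Z has_real_derivative - a * Z t) (at t within S)" for t S
    unfolding Z_def[abs_def] by (auto intro!: derivative_eq_intros)
  have ch: "((\<lambda>t. eval_fps F (Z t)) has_real_derivative - a * eval_fps (fps_X * fps_deriv F) (Z t)) (at t within {0..})"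
    if r: "ereal rad \<le> fps_conv_radius F" "ereal rad \<le> fps_conv_radius (fps_deriv F)" and t: "0 \<le> t" for F t
  proof -
    have z: "\<bar>Z t\<bar> < rad" using e(2) Z[OF t] by blast
    have "(eval_fps F has_real_derivative eval_fps (fps_deriv F) (Z t)) (at (Z t))"
      by (rule has_field_derivative_eval_fps[OF in_radius[OF z r(1)]])
    from DERIV_chain2[OF this dZ] show ?thesis
      by (simp add: eval_X_deriv[OF z r(2)] mult_ac)
  qed
  define f where "f t = 1 - eval_fps ser (Z t)" for t
  define g where "g t = a * eval_fps ser1 (Z t)" for t
  define h where "h t = - (a\<^sup>2 * eval_fps ser2 (Z t))" for t
  have "flow a b {0..} f g h"
    unfolding flow_def
  proof (intro ballI conjI)
    fix t :: real assume "t \<in> {0..}"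
    then have t: "0 \<le> t" by simp
    have z: "\<bar>Z t\<bar> < rad" using e(2) Z[OF t] by blast
    show "(f has_real_derivative g t) (at t within {0..})"
      using DERIV_diff[OF DERIV_const[of 1] ch[OF ser_radius(1,4) t]] by (simp add: f_def[abs_def] g_def ser1_def)
    show "(g has_real_derivative h t) (at t within {0..})"
      using DERIV_cmult[OF ch[OF ser_radius(2,5) t], of a] by (simp add: g_def[abs_def] h_def ser2_def power2_eq_square mult.assoc)
    have "- (a * f t * h t + b * (g t)\<^sup>2) = a\<^sup>2 * (a * eval_fps ser3 (Z t))"
    proof -
      have "- (a * f t * h t + b * (g t)\<^sup>2) = a\<^sup>2 * (a * eval_fps ser2 (Z t) - a * (eval_fps ser (Z t) * eval_fps ser2 (Z t))
         - b * (eval_fps ser1 (Z t) * eval_fps ser1 (Z t)))"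
        by (simp add: f_def g_def h_def algebra_simps power2_eq_square)
      then show ?thesis using eval_ser_equation[OF z] by simp
    qed
    then show "(h has_real_derivative - (a * f t * h t + b * (g t)\<^sup>2)) (at t within {0..})"
      using DERIV_minus[OF DERIV_cmult[OF ch[OF ser_radius(3,6) t], of "a\<^sup>2"]] by (simp add: h_def[abs_def] ser3_def mult.assoc)
  qed
  moreover have "0 < f t \<and> f t \<le> 1 \<and> 0 < g t \<and> h t < 0" if t: "0 \<le> t" for t
  proof -
    have z: "\<bar>Z t\<bar> < rad" "eval_fps ser (Z t) < 1" "0 < eval_fps (fps_deriv ser) (Z t)" "0 < eval_fps (fps_deriv ser1) (Z t)"
      using e(2) Z[OF t] by blast+
    have g: "0 < eval_fps ser1 (Z t)"
      unfolding ser1_def eval_X_deriv[OF z(1) ser_radius(4)] using Z(1)[OF t] z(3) by simp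
    have h: "0 < eval_fps ser2 (Z t)"
      unfolding ser2_def eval_X_deriv[OF z(1) ser_radius(5)] using Z(1)[OF t] z(4) by simp
    have s: "0 \<le> eval_fps ser (Z t)"
    proof -
      have "eval_fps ser 0 \<le> eval_fps ser (Z t)"
      proof (rule DERIV_nonneg_imp_nondecreasing[where f = "eval_fps ser" and a = 0 and b = "Z t"])
        show "0 \<le> Z t" using Z(1)[OF t] by simp
        fix x assume x: "0 \<le> x" "x \<le> Z t"
        then have xe: "\<bar>x\<bar> < e" using Z[OF t] by simp
        have "(eval_fps ser has_real_derivative eval_fps (fps_deriv ser) x) (at x)"
          by (rule has_field_derivative_eval_fps[OF in_radius[OF _ ser_radius(1)]]) (use e(2)[OF xe] in simp)
        then show "\<exists>y. (eval_fps ser has_real_derivative y) (at x) \<and> 0 \<le> y"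
          using e(2)[OF xe] by (intro exI[of _ "eval_fps (fps_deriv ser) x"]) auto
      qed
      then show ?thesis by (simp add: eval_fps_at_0 ser_nth coeff_0)
    qed
    show ?thesis using z(2) g h s a by (simp add: f_def g_def h_def)
  qed
  ultimately show ?thesis unfolding concave_flow_def by (intro exI[of _ f] exI[of _ g] exI[of _ h]) auto
qed

end

section \<open>Backward continuation to the inflection point\<close>

lemma flow_append:
  assumes F: "flow a b {0..s} f g h" and F': "flow a b {0..} f' g' h'" and s: "0 \<le> s"
    and joint: "f s = f' 0" "g s = g' 0" "h s = h' 0"
  shows "flow a b {0..} (\<lambda>t. if t \<in> {0..s} then f t else f' (t - s))
    (\<lambda>t. if t \<in> {0..s} then g t else g' (t - s)) (\<lambda>t. if t \<in> {0..s} then h t else h' (t - s))"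
proof -
  have cl: "{0..s} \<union> (closure {0..s} \<inter> closure {s..}) = {0..s}" "{s..} \<union> (closure {0..s} \<inter> closure {s..}) = {s..}"
    "{0..s} \<union> {s..} = {0..}"
    using s by auto
  have sh: "((\<lambda>t. u (t - s)) has_real_derivative D) (at t within {s..})"
    if "(u has_real_derivative D) (at (t - s) within {0..})" for u D t
  proof -
    have "((\<lambda>t. t - s) has_real_derivative 1) (at t within {s..})"
      by (auto intro!: derivative_eq_intros)
    moreover have "(u has_real_derivative D) (at (t - s) within (\<lambda>t. t - s) ` {s..})"
      using that by (rule DERIV_subset) auto
    ultimately show ?thesis using DERIV_image_chain[of u D "\<lambda>t. t - s" t "{s..}" 1]
      by (simp add: o_def)
  qed
  have join: "((\<lambda>t. if t \<in> {0..s} then u t else w (t - s)) has_real_derivative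
      (if t \<in> {0..s} then u' t else w' (t - s))) (at t within {0..})"
    if "\<And>t. t \<in> {0..s} \<Longrightarrow> (u has_real_derivative u' t) (at t within {0..s})"
      "\<And>t. t \<in> {0..} \<Longrightarrow> (w has_real_derivative w' t) (at t within {0..})"
      "u s = w 0" "u' s = w' 0" "t \<in> {0..}" for u u' w w' :: "real \<Rightarrow> real" and t
    unfolding has_real_derivative_iff_has_vector_derivative
  proof (rule has_vector_derivative_If_within_closures[where T = "{s..}" and g = "\<lambda>t. w (t - s)" and g' = "\<lambda>t. w' (t - s)"])
    show "t \<in> {0..s} \<union> {s..}" using that(5) by auto
    show "{0..} = {0..s} \<union> {s..}" by (rule cl(3)[symmetric])
    show "(u has_vector_derivative u' t) (at t within {0..s} \<union> (closure {0..s} \<inter> closure {s..}))"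
      if "t \<in> {0..s} \<union> (closure {0..s} \<inter> closure {s..})"
      using \<open>\<And>t. t \<in> {0..s} \<Longrightarrow> (u has_real_derivative u' t) (at t within {0..s})\<close>[of t] that
      unfolding cl has_real_derivative_iff_has_vector_derivative .
    show "((\<lambda>t. w (t - s)) has_vector_derivative w' (t - s)) (at t within {s..} \<union> (closure {0..s} \<inter> closure {s..}))"
      if "t \<in> {s..} \<union> (closure {0..s} \<inter> closure {s..})"
      using sh[OF \<open>\<And>t. t \<in> {0..} \<Longrightarrow> (w has_real_derivative w' t) (at t within {0..})\<close>[of "t - s"]] that
      unfolding cl has_real_derivative_iff_has_vector_derivative by simp
  qed (use that in auto)
  have eq: "- (a * (if t \<in> {0..s} then f t else f' (t - s)) * (if t \<in> {0..s} then h t else h' (t - s))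
      + b * (if t \<in> {0..s} then g t else g' (t - s))\<^sup>2)
    = (if t \<in> {0..s} then - (a * f t * h t + b * (g t)\<^sup>2) else - (a * f' (t - s) * h' (t - s) + b * (g' (t - s))\<^sup>2))" for t
    by auto
  note d = F[unfolded flow_def, rule_format] and d' = F'[unfolded flow_def, rule_format]
  show ?thesis unfolding flow_def eq
  proof (intro ballI conjI)
    fix t :: real assume t: "t \<in> {0..}"
    show "((\<lambda>t. if t \<in> {0..s} then f t else f' (t - s)) has_real_derivative (if t \<in> {0..s} then g t else g' (t - s))) (at t within {0..})"
      by (rule join[OF conjunct1[OF d] conjunct1[OF d'] joint(1,2) t])
    show "((\<lambda>t. if t \<in> {0..s} then g t else g' (t - s)) has_real_derivative (if t \<in> {0..s} then h t else h' (t - s))) (at t within {0..})"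
      by (rule join[OF conjunct1[OF conjunct2[OF d]] conjunct1[OF conjunct2[OF d']] joint(2,3) t])
    show "((\<lambda>t. if t \<in> {0..s} then h t else h' (t - s)) has_real_derivative
       (if t \<in> {0..s} then - (a * f t * h t + b * (g t)\<^sup>2) else - (a * f' (t - s) * h' (t - s) + b * (g' (t - s))\<^sup>2))) (at t within {0..})"
      using join[where u = h and u' = "\<lambda>t. - (a * f t * h t + b * (g t)\<^sup>2)" and w = h'
          and w' = "\<lambda>t. - (a * f' t * h' t + b * (g' t)\<^sup>2)" and t = t,
          OF conjunct2[OF conjunct2[OF d]] conjunct2[OF conjunct2[OF d']] joint(3) _ t] joint by simp
  qed
qed

context similarity_flow
begin

text \<open>The equation is invariant under \<open>f(t) \<mapsto> - f(- t)\<close>, so continuing a solution backwards amounts to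
  solving forwards from \<open>(- f 0, g 0, - h 0)\<close>.  As the energy is positive, \<open>f''\<close> must vanish
  before \<open>f\<close> does.\<close>

lemma backward_inflection:
  assumes x: "0 < x" and y: "0 < y" and z: "z < 0" and energy: "0 < z + a * x * y"
  shows "\<exists>s f g h. 0 < s \<and> flow a b {0..s} f g h \<and> f s = x \<and> g s = y \<and> h s = z \<and> h 0 = 0 \<and>
    (\<forall>t\<in>{0..s}. 0 < f t \<and> 0 < g t) \<and> (\<forall>t\<in>{0<..s}. h t < 0)"
proof -
  \<comment> \<open>As long as H >= 0, G >= y and F grows at least at speed y from -x. By time
    \<open>T\<close> it would reach y > 0, against F < 0.\<close>
  define T where "T = x / y + 1"
  have T: "0 < T" using x y by (simp add: T_def add_pos_pos)
  \<comment> \<open>Gronwall bound for G on [0, T], coming from H <= a x G; then a x K bounds H, and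
    \<open>R\<close> exceeds all three bounds.\<close>
  define K where "K = y * exp (a * x * T)"
  have K: "0 < K" using y by (simp add: K_def)
  have K1: "y \<le> K" using y a x T by (simp add: K_def)
  define R where "R = 1 + x + K + a * x * K - z"
  have axK: "0 < a * x * K" using a x K by simp
  have "\<bar>- x\<bar> < R" "\<bar>y\<bar> < R" "\<bar>- z\<bar> < R" using x y z K K1 axK by (auto simp: R_def)
  from flow_local[OF this T, of a b] obtain F G H \<tau> where
    F: "0 < \<tau>" "\<tau> \<le> T" "flow a b {0..\<tau>} F G H" "F 0 = - x" "G 0 = y" "H 0 = - z"
    and end_: "\<tau> = T \<or> \<bar>F \<tau>\<bar> = R \<or> \<bar>G \<tau>\<bar> = R \<or> \<bar>H \<tau>\<bar> = R" by blast
  \<comment> \<open>For the reversed solution the energy starts at minus the original one, hence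
    negative, and decreases. While H >= 0 this forces a F G < 0, so F cannot reach zero
    first.\<close>
  have facts: "y \<le> G t \<and> H t + a * F t * G t < 0 \<and> F t < 0"
    if t: "t \<in> {0..\<tau>}" and H: "\<And>s. s \<in> {0..t} \<Longrightarrow> 0 \<le> H s" for t
  proof -
    have G: "y \<le> G s" if s: "s \<in> {0..t}" for s
    proof -
      have "G 0 \<le> G s"
      proof (rule DERIV_nonneg_imp_increasing_open[where f = G and a = 0 and b = s])
        show "continuous_on {0..s} G" by (rule continuous_on_subset[OF flow_continuous(2)[OF F(3)]]) (use s t in auto)
        fix r assume r: "0 < r" "r < s"
        have "{0<..<s} \<subseteq> {0..\<tau>}" using s t by auto
        from flow_DERIV(2)[OF F(3) this r] H[of r] r s
        show "\<exists>D. (G has_real_derivative D) (at r) \<and> 0 \<le> D" by (intro exI[of _ "H r"]) auto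
      qed (use s in simp)
      then show ?thesis by (simp add: F)
    qed
    have "H t + a * F t * G t \<le> H 0 + a * F 0 * G 0"
    proof (cases "t = 0")
      case False
      have "H t + a * F t * G t < H 0 + a * F 0 * G 0"
      proof (rule flow_energy_less[OF F(3) ab])
        show "0 < t" "{0..t} \<subseteq> {0..\<tau>}" using False t by auto
        show "G r \<noteq> 0" if "0 < r" "r < t" for r using G[of r] that y by auto
      qed
      then show ?thesis by simp
    qed simp
    then have e: "H t + a * F t * G t < 0" using energy by (simp add: F)
    have "F t < 0"
    proof (rule ccontr)
      assume "\<not> F t < 0"
      then have "0 \<le> a * F t * G t" using a G[of t] y t by (simp add: mult_nonneg_nonneg)
      then show False using e H[of t] t by simp
    qed
    then show ?thesis using G[of t] e t by auto
  qed
  have "\<exists>r\<in>{0..\<tau>}. 0 \<le> - H r"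
  proof (rule ccontr)
    assume "\<not> ?thesis"
    then have H: "0 < H r" if "r \<in> {0..\<tau>}" for r using that by force
    have P: "y \<le> G t \<and> H t + a * F t * G t < 0 \<and> F t < 0" if "t \<in> {0..\<tau>}" for t
      by (rule facts[OF that]) (use H that in \<open>auto simp: less_imp_le\<close>)
    have sub: "{0<..<\<tau>} \<subseteq> {0..\<tau>}" by auto
    have Fge: "- x + y * t \<le> F t" if t: "t \<in> {0..\<tau>}" for t
    proof -
      have "F 0 - y * 0 \<le> F t - y * t"
      proof (rule DERIV_nonneg_imp_increasing_open[where f = "\<lambda>s. F s - y * s" and a = 0 and b = t])
        show "continuous_on {0..t} (\<lambda>s. F s - y * s)"
          by (intro continuous_intros continuous_on_subset[OF flow_continuous(1)[OF F(3)]]) (use t in auto)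
        fix r assume r: "0 < r" "r < t"
        have "{0<..<t} \<subseteq> {0..\<tau>}" using t by auto
        from flow_DERIV(1)[OF F(3) this r]
        have "((\<lambda>s. F s - y * s) has_real_derivative G r - y) (at r)" by (auto intro!: derivative_eq_intros)
        then show "\<exists>D. ((\<lambda>s. F s - y * s) has_real_derivative D) (at r) \<and> 0 \<le> D"
          using P[of r] r t by (intro exI[of _ "G r - y"]) auto
      qed (use t in simp)
      then show ?thesis by (simp add: F)
    qed
    have Fx: "- x \<le> F t" if "t \<in> {0..\<tau>}" for t
    proof -
      have "0 \<le> y * t" using y that by simp
      then show ?thesis using Fge[OF that] by linarith
    qed
    have HG: "H t \<le> a * x * G t" if t: "t \<in> {0..\<tau>}" for t
    proof -
      have "a * (- x) * G t \<le> a * F t * G t"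
        using Fx[OF t] a P[OF t] y by (intro mult_right_mono mult_left_mono) auto
      then show ?thesis using P[OF t] by simp
    qed
    have "G \<tau> * exp (- (a * x) * \<tau>) \<le> G 0 * exp (- (a * x) * 0)"
    proof (rule DERIV_nonpos_imp_decreasing_open[where f = "\<lambda>s. G s * exp (- (a * x) * s)" and a = 0 and b = \<tau>])
      show "continuous_on {0..\<tau>} (\<lambda>s. G s * exp (- (a * x) * s))"
        by (intro continuous_intros flow_continuous[OF F(3)])
      fix r assume r: "0 < r" "r < \<tau>"
      have "((\<lambda>s. G s * exp (- (a * x) * s)) has_real_derivative (H r - a * x * G r) * exp (- (a * x) * r)) (at r)"
        using flow_DERIV(2)[OF F(3) sub r] by (auto intro!: derivative_eq_intros simp: algebra_simps)
      moreover have "(H r - a * x * G r) * exp (- (a * x) * r) \<le> 0"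
        using HG[of r] r by (simp add: mult_le_0_iff)
      ultimately show "\<exists>D. ((\<lambda>s. G s * exp (- (a * x) * s)) has_real_derivative D) (at r) \<and> D \<le> 0" by blast
    qed (use F in simp)
    then have "G \<tau> \<le> y * exp (a * x * \<tau>)"
      by (simp add: F exp_minus field_simps)
    also have "\<dots> \<le> K" unfolding K_def using y a x F(2) by simp
    finally have GK: "G \<tau> \<le> K" .
    have \<tau>: "\<tau> \<in> {0..\<tau>}" using F by simp
    have "a * x * G \<tau> \<le> a * x * K" using GK a x by (intro mult_left_mono) auto
    then have HK: "H \<tau> \<le> a * x * K" using HG[OF \<tau>] by simp
    have "\<bar>F \<tau>\<bar> < R" "\<bar>G \<tau>\<bar> < R" "\<bar>H \<tau>\<bar> < R"
      using GK HK Fx[OF \<tau>] P[OF \<tau>] H[OF \<tau>] x y z K axK by (auto simp: R_def)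
    then have "\<tau> = T" using end_ by auto
    then have "- x + y * T < 0" using Fge[OF \<tau>] P[OF \<tau>] by simp
    moreover have "y * T = x + y" using y by (simp add: T_def field_simps)
    ultimately show False using y by simp
  qed
  then obtain r where r: "r \<in> {0..\<tau>}" "0 \<le> - H r" by blast
  have "continuous_on {0..\<tau>} (\<lambda>r. - H r)" "- H 0 < 0"
    using z F(6) by (auto intro: continuous_intros flow_continuous[OF F(3)])
  from first_hit[OF this r] obtain s where
    s: "s \<in> {0..\<tau>}" "0 < s" "- H s = 0" "\<forall>r\<in>{0..<s}. - H r < 0" by blast
  have Fs: "flow a b {0..s} F G H" by (rule flow_subset[OF F(3)]) (use s in auto)
  have Hnn: "0 \<le> H r" if "r \<in> {0..s}" for r using s(3,4) that by (cases "r = s") (auto simp: less_imp_le)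
  have P: "y \<le> G t \<and> F t < 0" if "t \<in> {0..s}" for t
    using facts[of t] Hnn that s(1) by auto
  show ?thesis
  proof (intro exI conjI)
    show "flow a b {0..s} (\<lambda>t. - F (s - t)) (\<lambda>t. G (s - t)) (\<lambda>t. - H (s - t))"
      by (rule flow_reverse[OF Fs])
    show "\<forall>t\<in>{0..s}. 0 < - F (s - t) \<and> 0 < G (s - t)"
      using P y by (auto intro: less_le_trans)
    show "\<forall>t\<in>{0<..s}. - H (s - t) < 0" using s(4) by auto
  qed (use s F in auto)
qed

text \<open>The power series solution preceded by its backward continuation to the inflection point.
  The bound 1 extends to the added piece because p is increasing.\<close>

lemma reference_exists:
  "\<exists>p p1 p2. concave_flow a b p p1 p2 \<and> p2 0 = 0 \<and> (\<forall>t\<ge>0. p t \<le> 1)"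
proof -
  obtain f g h where C: "concave_flow a b f g h" and f1: "\<And>t. 0 \<le> t \<Longrightarrow> f t \<le> 1" and h0: "h 0 < 0"
    using bounded_concave_flow_exists by blast
  have F: "flow a b {0..} f g h" using C by (simp add: concave_flow_def)
  have P: "0 < f t" "0 < g t" if "0 \<le> t" for t using C that by (auto simp: concave_flow_def)
  have H: "h t < 0" if "0 \<le> t" for t using C h0 that by (auto simp: concave_flow_def order_le_less)
  obtain s f' g' h' where s: "0 < s" and F': "flow a b {0..s} f' g' h'"
    and joint: "f' s = f 0" "g' s = g 0" "h' s = h 0" and h'0: "h' 0 = 0"
    and P': "\<forall>t\<in>{0..s}. 0 < f' t \<and> 0 < g' t" and H': "\<forall>t\<in>{0<..s}. h' t < 0"
    using backward_inflection[of "f 0" "g 0" "h 0"] P[of 0] h0 energy_pos[OF C, of 0] by blast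
  define p p1 p2 where "p t = (if t \<in> {0..s} then f' t else f (t - s))"
    and "p1 t = (if t \<in> {0..s} then g' t else g (t - s))"
    and "p2 t = (if t \<in> {0..s} then h' t else h (t - s))" for t
  have "flow a b {0..} p p1 p2"
    unfolding p_def p1_def p2_def by (rule flow_append[OF F' F less_imp_le[OF s] joint])
  then have "concave_flow a b p p1 p2"
    unfolding concave_flow_def using P P' H H' by (auto simp: p_def p1_def p2_def)
  moreover have "p2 0 = 0" using s h'0 by (simp add: p2_def)
  moreover have "p t \<le> 1" if "0 \<le> t" for t
  proof (cases "t \<le> s")
    case False
    then show ?thesis using f1[of "t - s"] by (simp add: p_def)
  next
    case True
    have "p t \<le> p s" using concave_flow_mono(1)[OF calculation(1) that, of s] True by (cases "t = s") auto
    also have "\<dots> \<le> 1" using f1[of 0] s joint by (simp add: p_def)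
    finally show ?thesis .
  qed
  ultimately show ?thesis by blast
qed

end

section \<open>The level function on the separatrix\<close>

context reference_flow
begin

definition level :: "real \<Rightarrow> real" where "level t = p2 t / p t ^ 3"

text \<open>The derivative of \<open>level\<close> times p^4 / (a p^2 + 3 p1). This normalisation
  gives \<open>p2\<close> the coefficient -1, so that the equation for its derivative produces the
  linear term needed for a comparison.\<close>

definition level_sign :: "real \<Rightarrow> real" where
  "level_sign t = - p2 t - b * p t * (p1 t)\<^sup>2 / (a * (p t)\<^sup>2 + 3 * p1 t)"

lemma ref_flow: "flow a b {0..} p p1 p2"
  and ref_pos: "0 \<le> t \<Longrightarrow> 0 < p t" "0 \<le> t \<Longrightarrow> 0 < p1 t"
  and ref_neg: "0 < t \<Longrightarrow> p2 t < 0"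
  using ref by (auto simp: concave_flow_def)

lemma denom_pos: "0 \<le> t \<Longrightarrow> 0 < a * (p t)\<^sup>2 + 3 * p1 t"
  using ref_pos[of t] a by (simp add: add_pos_pos)

lemma level_eq: "0 \<le> t \<Longrightarrow> level t = up t * qp t"
  using ref_pos[of t] by (simp add: level_def phase_u_def phase_q_def power2_eq_square power3_eq_cube)

lemma level_DERIV:
  assumes t: "0 < t"
  shows "(level has_real_derivative level_sign t * ((a * (p t)\<^sup>2 + 3 * p1 t) / p t ^ 4)) (at t)"
proof -
  have P: "0 < p t" "0 < p1 t" "0 < a * (p t)\<^sup>2 + 3 * p1 t" using ref_pos denom_pos t by auto
  note d = flow_DERIV_pos[OF ref_flow t]
  have "((\<lambda>t. p2 t / p t ^ 3) has_real_derivative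
      (- (a * p t * p2 t + b * (p1 t)\<^sup>2) * p t ^ 3 - p2 t * (3 * (p t)\<^sup>2 * p1 t)) / (p t ^ 3 * p t ^ 3)) (at t)"
    using d P(1) by (auto intro!: derivative_eq_intros)
  moreover have "(- (a * p t * p2 t + b * (p1 t)\<^sup>2) * p t ^ 3 - p2 t * (3 * (p t)\<^sup>2 * p1 t)) / (p t ^ 3 * p t ^ 3)
    = level_sign t * ((a * (p t)\<^sup>2 + 3 * p1 t) / p t ^ 4)"
  proof -
    define w where "w = a * (p t)\<^sup>2 + 3 * p1 t"
    have w: "w \<noteq> 0" using P(3) by (simp add: w_def)
    have "level_sign t * (w / p t ^ 4) = (- p2 t * w - b * p t * (p1 t)\<^sup>2) / p t ^ 4"
    proof -
      have "level_sign t = - p2 t - b * p t * (p1 t)\<^sup>2 / w" by (simp add: level_sign_def w_def)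
      then show ?thesis using w P(1) by (simp add: field_simps)
    qed
    also have "\<dots> = ((- p2 t * w - b * p t * (p1 t)\<^sup>2) * (p t)\<^sup>2) / (p t ^ 4 * (p t)\<^sup>2)"
      by (rule mult_divide_mult_cancel_right[symmetric]) (use P(1) in simp)
    also have "(- p2 t * w - b * p t * (p1 t)\<^sup>2) * (p t)\<^sup>2
      = - (a * p t * p2 t + b * (p1 t)\<^sup>2) * p t ^ 3 - p2 t * (3 * (p t)\<^sup>2 * p1 t)"
      by (simp add: w_def algebra_simps power2_eq_square power3_eq_cube)
    also have "p t ^ 4 * (p t)\<^sup>2 = p t ^ 3 * p t ^ 3" by (simp flip: power_add)
    finally show ?thesis by (simp add: w_def)
  qed
  ultimately show ?thesis by (simp add: level_def[abs_def])
qed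

lemma level_continuous: "continuous_on {0..} level"
proof -
  have "p t ^ 3 \<noteq> 0" if "t \<in> {0..}" for t using ref_pos(1)[of t] that by simp
  then show ?thesis unfolding level_def[abs_def]
    by (intro continuous_on_divide continuous_on_power flow_continuous[OF ref_flow] ballI)
qed

lemma level_sign_continuous: "continuous_on {0..} level_sign"
proof -
  have "a * (p t)\<^sup>2 + 3 * p1 t \<noteq> 0" if "t \<in> {0..}" for t using denom_pos[of t] that by simp
  then show ?thesis unfolding level_sign_def[abs_def]
    by (intro continuous_on_diff continuous_on_minus continuous_on_divide continuous_on_mult continuous_on_add
        continuous_on_const continuous_on_power flow_continuous[OF ref_flow] ballI)
qed

text \<open>\<open>level_sign' + a p level_sign > 0\<close>, so \<open>level_sign\<close> changes sign at most once, from negative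
  to positive.\<close>

lemma level_sign_pos:
  assumes s: "0 \<le> s" "s < t" and nn: "0 \<le> level_sign s"
  shows "0 < level_sign t"
proof -
  have sub: "{s..t} \<subseteq> {0..}" using s by auto
  have "\<exists>k>0. - level_sign t < k * - level_sign s"
  proof (rule lin_diff_ineq_strict[where y = "\<lambda>x. - level_sign x" and s = s and t = t and p = "\<lambda>x. - a * p x", OF s(2)])
    show "continuous_on {s..t} (\<lambda>x. - level_sign x)"
      by (intro continuous_intros continuous_on_subset[OF level_sign_continuous sub])
    show "continuous_on {s..t} (\<lambda>x. - a * p x)"
      by (intro continuous_intros continuous_on_subset[OF flow_continuous(1)[OF ref_flow] sub])
    fix x assume "s < x" "x < t"
    then have x: "0 < x" using s by simp
    define f g h where "f = p x" and "g = p1 x" and "h = p2 x"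
    define w where "w = a * f\<^sup>2 + 3 * g"
    have P: "0 < f" "0 < g" "h < 0" "0 < w"
      using ref_pos[of x] ref_neg[OF x] denom_pos[of x] x by (auto simp: f_def g_def h_def w_def)
    have d: "(p has_real_derivative g) (at x)" "(p1 has_real_derivative h) (at x)"
      "(p2 has_real_derivative - (a * f * h + b * g\<^sup>2)) (at x)"
      using flow_DERIV_pos[OF ref_flow x] by (auto simp: f_def g_def h_def)
    define N where "N = (g * g\<^sup>2 + f * (2 * g * h)) * w - f * g\<^sup>2 * (2 * a * f * g + 3 * h)"
    have "((\<lambda>x. p2 x + b * (p x * (p1 x)\<^sup>2 / (a * (p x)\<^sup>2 + 3 * p1 x))) has_real_derivative
      - (a * f * h + b * g\<^sup>2) + b * (N / (w * w))) (at x)"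
    proof -
      have "((\<lambda>x. p x * (p1 x)\<^sup>2) has_real_derivative g * g\<^sup>2 + f * (2 * g * h)) (at x)"
        using d by (auto intro!: derivative_eq_intros simp: f_def g_def)
      moreover have "((\<lambda>x. a * (p x)\<^sup>2 + 3 * p1 x) has_real_derivative 2 * a * f * g + 3 * h) (at x)"
        using d by (auto intro!: derivative_eq_intros simp: f_def)
      ultimately have "((\<lambda>x. p x * (p1 x)\<^sup>2 / (a * (p x)\<^sup>2 + 3 * p1 x)) has_real_derivative N / (w * w)) (at x)"
        using DERIV_divide[of "\<lambda>x. p x * (p1 x)\<^sup>2" _ x UNIV "\<lambda>x. a * (p x)\<^sup>2 + 3 * p1 x"] P(4)
        by (simp add: N_def f_def g_def w_def)
      from DERIV_add[OF d(3) DERIV_cmult[OF this, of b]] show ?thesis .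
    qed
    moreover have "(\<lambda>x. p2 x + b * (p x * (p1 x)\<^sup>2 / (a * (p x)\<^sup>2 + 3 * p1 x))) = (\<lambda>x. - level_sign x)"
      by (simp add: level_sign_def fun_eq_iff)
    ultimately have der: "((\<lambda>x. - level_sign x) has_real_derivative - (a * f * h + b * g\<^sup>2) + b * (N / (w * w))) (at x)"
      by simp
    have "- (a * f * h + b * g\<^sup>2) + b * (N / (w * w)) < - a * p x * - level_sign x"
    proof -
      have rhs: "- a * p x * - level_sign x = - a * f * h - a * b * f\<^sup>2 * g\<^sup>2 / w"
      proof -
        have ls: "level_sign x = - h - b * f * g\<^sup>2 / w" by (simp add: level_sign_def w_def f_def g_def h_def)
        show ?thesis unfolding ls f_def[symmetric] by (simp add: algebra_simps power2_eq_square)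
      qed
      \<comment> \<open>The difference of the two sides of the desired inequality is b / w^2 times
        this expression. Because h < 0, each summand on the right contributes positively.\<close>
      have id: "g\<^sup>2 * (w * w) - a * f\<^sup>2 * g\<^sup>2 * w - N
        = 2 * g ^ 3 * w + 2 * a * f\<^sup>2 * g ^ 3 - f * g * h * (2 * a * f\<^sup>2 + 3 * g)"
        by (simp add: N_def w_def algebra_simps power2_eq_square power3_eq_cube)
      have "0 < 2 * g ^ 3 * w + 2 * a * f\<^sup>2 * g ^ 3 - f * g * h * (2 * a * f\<^sup>2 + 3 * g)"
      proof -
        have "0 < 2 * g ^ 3 * w" "0 < 2 * a * f\<^sup>2 * g ^ 3" using P a by simp_all
        moreover have "0 < 2 * a * f\<^sup>2 + 3 * g" using P a by (simp add: add_pos_pos)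
        then have "f * g * h * (2 * a * f\<^sup>2 + 3 * g) < 0" using P by (simp add: mult_neg_pos mult_pos_neg)
        ultimately show ?thesis by linarith
      qed
      then have "0 < b * ((g\<^sup>2 * (w * w) - a * f\<^sup>2 * g\<^sup>2 * w - N) / (w * w))"
        unfolding id using P b_pos by simp
      also have "b * ((g\<^sup>2 * (w * w) - a * f\<^sup>2 * g\<^sup>2 * w - N) / (w * w))
        = b * g\<^sup>2 - a * b * f\<^sup>2 * g\<^sup>2 / w - b * (N / (w * w))"
        using P(4) by (simp add: diff_divide_distrib right_diff_distrib)
      finally show ?thesis unfolding rhs by linarith
    qed
    then show "\<exists>D. ((\<lambda>x. - level_sign x) has_real_derivative D) (at x) \<and> D < - a * p x * - level_sign x"
      using der by blast
  qed
  then obtain k where "0 < k" "- level_sign t < k * - level_sign s" by blast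
  moreover have "0 \<le> k * level_sign s" using \<open>0 < k\<close> nn by simp
  ultimately show ?thesis by simp
qed

lemma level_0: "level 0 = 0"
  by (simp add: level_def ref0)

lemma level_neg: "0 < t \<Longrightarrow> level t < 0"
  using ref_pos[of t] ref_neg[of t] by (simp add: level_def divide_neg_pos)

lemma level_tendsto: "(level \<longlongrightarrow> 0) at_top"
proof -
  have "((\<lambda>t. up t * qp t) \<longlongrightarrow> 0 * - a) at_top"
    by (intro tendsto_mult ref_phase(7) bounded_phase_q[OF ref ref_bounded])
  then have "((\<lambda>t. up t * qp t) \<longlongrightarrow> 0) at_top" by simp
  then show ?thesis
    by (rule Lim_transform_eventually) (rule eventually_at_top_linorderI[of 0], simp add: level_eq)
qed

lemma level_decreasing:
  assumes "0 \<le> s" "s < t" and sign: "\<And>x. s < x \<Longrightarrow> x < t \<Longrightarrow> level_sign x < 0"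
  shows "level t < level s"
proof (rule DERIV_neg_imp_decreasing_open[OF \<open>s < t\<close>])
  show "continuous_on {s..t} level" by (rule continuous_on_subset[OF level_continuous]) (use assms in auto)
  fix x assume x: "s < x" "x < t"
  then have x0: "0 < x" using assms by simp
  have "level_sign x * ((a * (p x)\<^sup>2 + 3 * p1 x) / p x ^ 4) < 0"
    using sign[OF x] denom_pos[of x] ref_pos[of x] x0 by (intro mult_neg_pos divide_pos_pos) auto
  then show "\<exists>y. (level has_real_derivative y) (at x) \<and> y < 0"
    using level_DERIV[OF x0] by blast
qed

text \<open>At t = 0 the term \<open>p2\<close> vanishes and \<open>level_sign\<close> is negative.
  It cannot remain so: \<open>level\<close> would keep decreasing from a negative value and miss its
  limit 0. Its zero \<open>c\<close> is therefore the only change of sign, by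
  \<open>level_sign_pos\<close>.\<close>

lemma level_unimodal:
  "\<exists>c>0. (\<forall>s t. 0 \<le> s \<longrightarrow> s < t \<longrightarrow> t \<le> c \<longrightarrow> level t < level s) \<and>
         (\<forall>s t. c \<le> s \<longrightarrow> s < t \<longrightarrow> level s < level t)"
proof -
  have s0: "level_sign 0 < 0"
    using ref_pos[of 0] denom_pos[of 0] b_pos by (simp add: level_sign_def ref0)
  have "\<exists>r>0. 0 \<le> level_sign r"
  proof (rule ccontr)
    assume "\<not> ?thesis"
    then have neg: "level_sign r < 0" if "0 < r" for r using that by force
    have "level t \<le> level 1" if "1 \<le> t" for t
      using level_decreasing[of 1 t] neg that by (cases "t = 1") auto
    then have "0 \<le> level 1"
      by (intro tendsto_upperbound[OF level_tendsto] eventually_at_top_linorderI[of 1]) auto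
    then show False using level_neg[of 1] by simp
  qed
  then obtain r where r: "0 < r" "0 \<le> level_sign r" by blast
  obtain c where c: "0 \<le> c" "c \<le> r" "level_sign c = 0"
    using IVT'[of level_sign 0 0 r] s0 r continuous_on_subset[OF level_sign_continuous, of "{0..r}"] by auto
  have c0: "0 < c" using c s0 by (cases "c = 0") auto
  have below: "level_sign x < 0" if "0 \<le> x" "x < c" for x
    using level_sign_pos[OF that] c(3) by force
  have above: "0 < level_sign x" if "c < x" for x
    using level_sign_pos[OF c(1) that] c(3) by simp
  have "level t < level s" if "0 \<le> s" "s < t" "t \<le> c" for s t
    by (rule level_decreasing[OF that(1,2)]) (use below that in auto)
  moreover have "level s < level t" if st: "c \<le> s" "s < t" for s t
  proof (rule DERIV_pos_imp_increasing_open[OF st(2)])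
    show "continuous_on {s..t} level" by (rule continuous_on_subset[OF level_continuous]) (use st c0 in auto)
    fix x assume x: "s < x" "x < t"
    then have x0: "0 < x" using st c0 by simp
    have "0 < level_sign x * ((a * (p x)\<^sup>2 + 3 * p1 x) / p x ^ 4)"
      using above[of x] denom_pos[of x] ref_pos[of x] x0 x st by (intro mult_pos_pos divide_pos_pos) auto
    then show "\<exists>y. (level has_real_derivative y) (at x) \<and> 0 < y"
      using level_DERIV[OF x0] by blast
  qed
  ultimately show ?thesis using c0 by blast
qed

text \<open>The time t is where the reference orbit has the same u as the given initial point. Then
  -1/f(0)^3 - level(t) = u times the gap, so the inequality is \<open>gap_nonneg\<close> and the
  equality case is \<open>bounded_iff_gap_zero\<close>.\<close>

lemma phase_param:
  assumes C: "concave_flow a b f g h" and h0: "h 0 = - 1"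
  shows "\<exists>t>0. g 0 = up t * (f 0)\<^sup>2 \<and> level t \<le> - 1 / f 0 ^ 3 \<and>
    ((\<exists>M. \<forall>t\<ge>0. f t \<le> M) \<longleftrightarrow> level t = - 1 / f 0 ^ 3)"
proof -
  have P: "0 < f 0" "0 < g 0" using C by (auto simp: concave_flow_def)
  have u: "0 < phase_u f g 0" "phase_u f g 0 < umax"
    using concave_phase(4)[OF C, of 0] phase_u_less_umax[OF C] h0 by auto
  obtain t where t: "0 \<le> t" "up t = phase_u f g 0" using up_surj[of "phase_u f g 0"] u by auto
  have t0: "0 < t" using t u by (cases "t = 0") (auto simp: umax_def)
  have g: "g 0 = up t * (f 0)\<^sup>2" using t(2) P by (simp add: phase_u_def)
  have lev: "- 1 / f 0 ^ 3 - level t = up t * gap f g h 0"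
  proof -
    have "- 1 / f 0 ^ 3 = up t * phase_q f g h 0"
      unfolding t(2) using P h0 by (simp add: phase_u_def phase_q_def power2_eq_square power3_eq_cube)
    then show ?thesis using sep_up[OF t(1)] t(2) by (simp add: level_eq[OF t(1)] gap_def algebra_simps)
  qed
  have ut: "0 < up t" using u t by simp
  have "0 \<le> gap f g h 0" by (rule gap_nonneg[OF C]) (use h0 u in auto)
  then have "0 \<le> - 1 / f 0 ^ 3 - level t" unfolding lev using ut by simp
  moreover have "gap f g h 0 = 0 \<longleftrightarrow> level t = - 1 / f 0 ^ 3"
    using lev ut by (metis diff_self eq_iff_diff_eq_0 mult_eq_0_iff less_irrefl)
  ultimately show ?thesis using t0 g bounded_iff_gap_zero[OF C] h0 by (intro exI[of _ t]) auto
qed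

text \<open>Converse of \<open>phase_param\<close>. In the case of equality the initial point is on
  the separatrix, and the reference solution started at t and scaled by k = d / p(t) has f''(0) =
  d^3 level(t) = -1. Strict inequality places the point above it, where
  \<open>global_above_separatrix\<close> applies.\<close>

lemma realize_param:
  assumes d: "0 < d" and t: "0 < t" and lev: "level t \<le> - 1 / d ^ 3"
  shows "\<exists>f g h. concave_flow a b f g h \<and> f 0 = d \<and> g 0 = up t * d\<^sup>2 \<and> h 0 = - 1"
proof (cases "level t = - 1 / d ^ 3")
  case True
  define k where "k = d / p t"
  have pt: "0 < p t" using ref_pos t by simp
  have k: "0 < k" using d pt by (simp add: k_def)
  have "concave_flow a b (\<lambda>x. k * p (k * x + t)) (\<lambda>x. k ^ 2 * p1 (k * x + t)) (\<lambda>x. k ^ 3 * p2 (k * x + t))"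
    unfolding concave_flow_def
  proof (intro conjI allI impI)
    show "flow a b {0..} (\<lambda>x. k * p (k * x + t)) (\<lambda>x. k ^ 2 * p1 (k * x + t)) (\<lambda>x. k ^ 3 * p2 (k * x + t))"
      using flow_affine[OF ref_flow k, of t] t by simp
    fix x :: real
    show "k ^ 3 * p2 (k * x + t) < 0" if "0 < x"
      using ref_neg[of "k * x + t"] k t that by (simp add: mult_pos_neg add_pos_pos)
    show "0 < k * p (k * x + t)" "0 < k ^ 2 * p1 (k * x + t)" if "0 \<le> x"
      using ref_pos[of "k * x + t"] k t that by auto
  qed
  moreover have "k * p (k * 0 + t) = d" using pt by (simp add: k_def)
  moreover have "k ^ 2 * p1 (k * 0 + t) = up t * d\<^sup>2" by (simp add: k_def phase_u_def power_divide)
  moreover have "k ^ 3 * p2 (k * 0 + t) = - 1"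
  proof -
    have "k ^ 3 * p2 (k * 0 + t) = d ^ 3 * level t" by (simp add: k_def level_def power_divide)
    then show ?thesis using True d by simp
  qed
  ultimately show ?thesis
    by (intro exI[of _ "\<lambda>x. k * p (k * x + t)"] exI[of _ "\<lambda>x. k ^ 2 * p1 (k * x + t)"]
        exI[of _ "\<lambda>x. k ^ 3 * p2 (k * x + t)"]) simp
next
  case False
  then have lt: "level t < - 1 / d ^ 3" using lev by simp
  have ut: "0 < up t" using ref_phase(4)[of t] t by simp
  define y where "y = up t * d\<^sup>2"
  have y: "0 < y" using ut d by (simp add: y_def)
  have yd: "y / d\<^sup>2 = up t" using d by (simp add: y_def)
  show ?thesis unfolding y_def[symmetric]
  proof (rule global_above_separatrix[OF d y])
    show "y / d\<^sup>2 \<le> umax" unfolding yd using up_le[of t] t by simp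
    have "up t * qp t < - 1 / d ^ 3" using lt level_eq[of t] t by simp
    also have "- 1 / d ^ 3 = up t * (- 1 / (d * y))"
      using ut d by (simp add: y_def power2_eq_square power3_eq_cube)
    finally have "qp t < - 1 / (d * y)" using ut by (simp only: mult_less_cancel_left_pos)
    then show "sep (y / d\<^sup>2) < - 1 / (d * y)" unfolding yd using sep_up[of t] t by simp
  qed simp
qed

text \<open>Only f(0) > 0 is new. If it failed, f would increase through arbitrarily small positive
  values while f' stays bounded below, so u = f'/f^2 would exceed umax at some time with f > 0,
  against \<open>phase_u_less_umax\<close>.\<close>

lemma solution_concave:
  assumes F: "flow a b {0..} f g h" and h0: "h 0 = - 1" and lim: "(g \<longlongrightarrow> 0) at_top"
  shows "concave_flow a b f g h"
proof -
  have "h 0 < 0" "0 \<le> b" using h0 b_pos by auto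
  note B = flow_bounded_below_pos[OF F a \<open>0 \<le> b\<close> \<open>h 0 < 0\<close> lim]
  have mono: "f s < f t" if st: "0 \<le> s" "s < t" for s t
  proof (rule DERIV_pos_imp_increasing_open[where f = f, OF st(2)])
    show "continuous_on {s..t} f" by (rule continuous_on_subset[OF flow_continuous(1)[OF F]]) (use st in auto)
    fix x assume "s < x" "x < t"
    then have "0 < x" using st by simp
    from flow_DERIV_pos(1)[OF F this] B(2)[of x] this
    show "\<exists>y. (f has_real_derivative y) (at x) \<and> 0 < y" by (intro exI[of _ "g x"]) simp
  qed
  have shifted: "concave_flow a b (\<lambda>t. f (t + s)) (\<lambda>t. g (t + s)) (\<lambda>t. h (t + s))" if s: "0 \<le> s" "0 < f s" for s
  proof -
    have "0 < f (t + s)" if "0 \<le> t" for t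
      using mono[of s "t + s"] s that by (cases "t = 0") auto
    then show ?thesis unfolding concave_flow_def
      using flow_shift[OF F s(1)] B(1,2) s by auto
  qed
  have "0 < f 0"
  proof (rule ccontr)
    assume n: "\<not> 0 < f 0"
    obtain r where r: "0 \<le> r" "0 < f r" using B(3) by blast
    have gr: "0 < g r" using B(2) r by simp
    \<comment> \<open>Small enough that g(r)/e^2 >= umax; g is even larger at the earlier time when
      f equals \<open>e\<close>.\<close>
    define e where "e = min (f r) (sqrt (g r / umax))"
    have e: "0 < e" "e \<le> f r" "e \<le> sqrt (g r / umax)" using r gr umax_pos by (auto simp: e_def)
    obtain s where s: "0 \<le> s" "s \<le> r" "f s = e"
      using IVT'[of f 0 e r] n e r continuous_on_subset[OF flow_continuous(1)[OF F], of "{0..r}"] by auto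
    have "e\<^sup>2 \<le> (sqrt (g r / umax))\<^sup>2" using e by (intro power_mono) auto
    then have "e\<^sup>2 \<le> g r / umax" using gr umax_pos by simp
    then have "umax * e\<^sup>2 \<le> g r" using umax_pos by (simp add: field_simps)
    also have "g r \<le> g s"
    proof (cases "s = r")
      case False
      have "g r < g s"
      proof (rule DERIV_neg_imp_decreasing_open[where f = g and a = s and b = r])
        show "s < r" using False s by simp
        show "continuous_on {s..r} g" by (rule continuous_on_subset[OF flow_continuous(2)[OF F]]) (use s in auto)
        fix x assume "s < x" "x < r"
        then have "0 < x" using s by simp
        from flow_DERIV_pos(2)[OF F this] B(1)[of x] this
        show "\<exists>y. (g has_real_derivative y) (at x) \<and> y < 0" by (intro exI[of _ "h x"]) simp
      qed
      then show ?thesis by simp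
    qed simp
    finally have "umax \<le> g s / (f s)\<^sup>2" using s e by (simp add: field_simps)
    moreover have "g s / (f s)\<^sup>2 < umax"
    proof -
      have "phase_u (\<lambda>t. f (t + s)) (\<lambda>t. g (t + s)) 0 < umax"
        by (rule phase_u_less_umax[OF shifted]) (use s e B(1) in auto)
      then show ?thesis by (simp add: phase_u_def)
    qed
    ultimately show False by simp
  qed
  then show ?thesis using shifted[of 0] by simp
qed

end

section \<open>Counting solutions\<close>

lemma is_bvp_solution_iff_flow:
  "is_bvp_solution m \<gamma> f \<longleftrightarrow> (\<exists>g h. flow (m + 2) (- (2 * m + 1)) {0..} f g h \<and>
     f 0 = - \<gamma> \<and> h 0 = - 1 \<and> (g \<longlongrightarrow> 0) at_top)"
proof
  assume "is_bvp_solution m \<gamma> f"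
  then obtain f1 f2 f3 where d:
      "\<And>t. 0 \<le> t \<Longrightarrow> (f has_real_derivative f1 t) (at t within {0..})"
      "\<And>t. 0 \<le> t \<Longrightarrow> (f1 has_real_derivative f2 t) (at t within {0..})"
      "\<And>t. 0 \<le> t \<Longrightarrow> (f2 has_real_derivative f3 t) (at t within {0..})"
      "\<And>t. 0 \<le> t \<Longrightarrow> f3 t + (m + 2) * f t * f2 t - (2 * m + 1) * (f1 t)\<^sup>2 = 0"
    and i: "f 0 = - \<gamma>" "f2 0 = - 1" "(f1 \<longlongrightarrow> 0) at_top"
    unfolding is_bvp_solution_def by blast
  have "flow (m + 2) (- (2 * m + 1)) {0..} f f1 f2"
    unfolding flow_def
  proof (intro ballI conjI)
    fix t :: real assume "t \<in> {0..}"
    then have t: "0 \<le> t" by simp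
    show "(f has_real_derivative f1 t) (at t within {0..})" by (rule d(1)[OF t])
    show "(f1 has_real_derivative f2 t) (at t within {0..})" by (rule d(2)[OF t])
    have "f3 t = - ((m + 2) * f t * f2 t + - (2 * m + 1) * (f1 t)\<^sup>2)" using d(4)[OF t] by (simp add: algebra_simps)
    then show "(f2 has_real_derivative - ((m + 2) * f t * f2 t + - (2 * m + 1) * (f1 t)\<^sup>2)) (at t within {0..})"
      using d(3)[OF t] by metis
  qed
  then show "\<exists>g h. flow (m + 2) (- (2 * m + 1)) {0..} f g h \<and> f 0 = - \<gamma> \<and> h 0 = - 1 \<and> (g \<longlongrightarrow> 0) at_top"
    using i by blast
next
  assume "\<exists>g h. flow (m + 2) (- (2 * m + 1)) {0..} f g h \<and> f 0 = - \<gamma> \<and> h 0 = - 1 \<and> (g \<longlongrightarrow> 0) at_top"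
  then obtain g h where F: "flow (m + 2) (- (2 * m + 1)) {0..} f g h"
    and i: "f 0 = - \<gamma>" "h 0 = - 1" "(g \<longlongrightarrow> 0) at_top" by blast
  note d = F[unfolded flow_def, rule_format, OF atLeast_iff[THEN iffD2]]
  show "is_bvp_solution m \<gamma> f"
    unfolding is_bvp_solution_def
  proof (intro exI conjI allI impI)
    fix t :: real assume t: "0 \<le> t"
    show "(f has_real_derivative g t) (at t within {0..})" by (rule conjunct1[OF d[OF t]])
    show "(g has_real_derivative h t) (at t within {0..})" by (rule conjunct1[OF conjunct2[OF d[OF t]]])
    show "(h has_real_derivative - ((m + 2) * f t * h t + - (2 * m + 1) * (g t)\<^sup>2)) (at t within {0..})"
      by (rule conjunct2[OF conjunct2[OF d[OF t]]])
    show "- ((m + 2) * f t * h t + - (2 * m + 1) * (g t)\<^sup>2) + (m + 2) * f t * h t - (2 * m + 1) * (g t)\<^sup>2 = 0"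
      by (simp add: algebra_simps)
  qed (rule i)+
qed

lemma flow_cong:
  assumes F: "flow a b {0..} f g h" and eq: "\<And>t. 0 \<le> t \<Longrightarrow> f' t = f t"
  shows "flow a b {0..} f' g h"
  unfolding flow_def
proof (intro ballI conjI)
  fix t :: real assume t: "t \<in> {0..}"
  note d = F[unfolded flow_def, rule_format, OF t]
  have ft: "f' t = f t" using eq t by simp
  show "(f' has_real_derivative g t) (at t within {0..})"
    by (rule has_field_derivative_transform_within[OF conjunct1[OF d] zero_less_one t]) (use eq in simp)
  show "(g has_real_derivative h t) (at t within {0..})" by (rule conjunct1[OF conjunct2[OF d]])
  show "(h has_real_derivative - (a * f' t * h t + b * (g t)\<^sup>2)) (at t within {0..})"
    unfolding ft by (rule conjunct2[OF conjunct2[OF d]])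
qed

lemma flow_unique_global:
  assumes F: "flow a b {0..} f g h" and F': "flow a b {0..} f' g' h'"
    and init: "f 0 = f' 0" "g 0 = g' 0" "h 0 = h' 0" and t: "0 \<le> t"
  shows "f t = f' t"
proof -
  have F_t: "flow a b {0..t} f g h" by (rule flow_subset[OF F]) auto
  have F'_t: "flow a b {0..t} f' g' h'" by (rule flow_subset[OF F']) auto
  show ?thesis by (rule flow_unique(1)[OF F_t F'_t init]) (use t in simp)
qed

locale bvp_reference = reference_flow "m + 2" "- (2 * m + 1)" p p1 p2 M for m p p1 p2 M
begin

abbreviation "cflow \<equiv> concave_flow (m + 2) (- (2 * m + 1))"

text \<open>A time t on the reference orbit stands for the initial slope f'(0) = up(t) d^2. The
  inequality says that the corresponding starting point lies on or above the separatrix.\<close>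

definition params :: "real \<Rightarrow> real set" where
  "params d = {t. 0 < t \<and> level t \<le> - 1 / d ^ 3}"

lemma bvp_concave:
  assumes "f \<in> bvp_solutions m \<gamma>"
  shows "\<exists>g h. cflow f g h \<and> f 0 = - \<gamma> \<and> h 0 = - 1"
proof -
  obtain g h where "flow (m + 2) (- (2 * m + 1)) {0..} f g h" "f 0 = - \<gamma>" "h 0 = - 1" "(g \<longlongrightarrow> 0) at_top"
    using assms unfolding bvp_solutions_def is_bvp_solution_iff_flow by blast
  then show ?thesis using solution_concave by blast
qed

lemma no_solution_nonpos:
  assumes "0 \<le> \<gamma>"
  shows "bvp_solutions m \<gamma> = {}"
proof -
  have False if f: "f \<in> bvp_solutions m \<gamma>" for f
  proof -
    obtain g h where "cflow f g h" "f 0 = - \<gamma>" using bvp_concave[OF f] by blast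
    then have "0 < - \<gamma>" unfolding concave_flow_def by force
    then show False using assms by simp
  qed
  then show ?thesis by blast
qed

text \<open>Solutions with f(0) = d are classified by f'(0), and f'(0) by t because
  \<open>up\<close> is injective. \<open>realize_param\<close> provides a solution for every
  admissible t; \<open>phase_param\<close> with uniqueness of the initial value problem shows that
  there are no others.\<close>

lemma solutions_param:
  assumes d: "0 < d"
  shows "\<exists>\<Phi>. bij_betw \<Phi> (params d) (bvp_solutions m (- d)) \<and>
    (\<forall>t\<in>params d. bounded_on_half_line (\<Phi> t) \<longleftrightarrow> level t = - 1 / d ^ 3)"
proof -
  have "\<forall>t\<in>params d. \<exists>f g h. cflow f g h \<and> f 0 = d \<and> g 0 = up t * d\<^sup>2 \<and> h 0 = - 1"
    using realize_param[OF d] by (auto simp: params_def)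
  then obtain F G H where F: "\<And>t. t \<in> params d \<Longrightarrow> cflow (F t) (G t) (H t)"
    "\<And>t. t \<in> params d \<Longrightarrow> F t 0 = d" "\<And>t. t \<in> params d \<Longrightarrow> G t 0 = up t * d\<^sup>2" "\<And>t. t \<in> params d \<Longrightarrow> H t 0 = - 1"
    by metis
  define \<Phi> where "\<Phi> t = restrict (F t) {0..}" for t
  have flow: "flow (m + 2) (- (2 * m + 1)) {0..} (\<Phi> t) (G t) (H t)" if "t \<in> params d" for t
    by (rule flow_cong[of _ _ "F t"]) (use F(1)[OF that] in \<open>auto simp: concave_flow_def \<Phi>_def\<close>)
  have cflow: "cflow (\<Phi> t) (G t) (H t)" if "t \<in> params d" for t
    using F(1)[OF that] flow[OF that] by (auto simp: concave_flow_def \<Phi>_def)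
  have \<Phi>0: "\<Phi> t 0 = d" if "t \<in> params d" for t using F(2)[OF that] by (simp add: \<Phi>_def)
  have d2: "d\<^sup>2 \<noteq> 0" using d by simp
  have mem: "\<Phi> t \<in> bvp_solutions m (- d)" if t: "t \<in> params d" for t
    unfolding bvp_solutions_def is_bvp_solution_iff_flow
    using flow[OF t] \<Phi>0[OF t] F(4)[OF t] concave_flow_g_to_0[OF cflow[OF t]] by (auto simp: \<Phi>_def)
  have bound: "bounded_on_half_line (\<Phi> t) \<longleftrightarrow> level t = - 1 / d ^ 3" if t: "t \<in> params d" for t
  proof -
    have pos: "0 < \<Phi> t x" if "0 \<le> x" for x using cflow[OF t] that by (simp add: concave_flow_def)
    have "bounded_on_half_line (\<Phi> t) \<longleftrightarrow> (\<exists>M. \<forall>x\<ge>0. \<Phi> t x \<le> M)"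
    proof
      show "\<exists>M. \<forall>x\<ge>0. \<Phi> t x \<le> M" if bh: "bounded_on_half_line (\<Phi> t)"
      proof -
        obtain B where B: "\<forall>y\<in>\<Phi> t ` {0..}. norm y \<le> B"
          using bh unfolding bounded_on_half_line_def bounded_iff by blast
        then have "\<Phi> t x \<le> B" if "0 \<le> x" for x using abs_le_D1[of "\<Phi> t x" B] that by simp
        then show ?thesis by blast
      qed
      show "bounded_on_half_line (\<Phi> t)" if bM: "\<exists>M. \<forall>x\<ge>0. \<Phi> t x \<le> M"
      proof -
        obtain B where "\<And>x. 0 \<le> x \<Longrightarrow> \<Phi> t x \<le> B" using bM by blast
        then have "norm y \<le> B" if "y \<in> \<Phi> t ` {0..}" for y using that pos by (auto simp: abs_of_pos)
        then show ?thesis unfolding bounded_on_half_line_def bounded_iff by blast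
      qed
    qed
    also have "\<dots> \<longleftrightarrow> level t = - 1 / d ^ 3"
    proof -
      obtain s where s: "0 < s" "G t 0 = up s * (\<Phi> t 0)\<^sup>2"
        "(\<exists>M. \<forall>x\<ge>0. \<Phi> t x \<le> M) \<longleftrightarrow> level s = - 1 / \<Phi> t 0 ^ 3"
        using phase_param[OF cflow[OF t] F(4)[OF t]] by blast
      have "up s = up t" using s(2) F(3)[OF t] \<Phi>0[OF t] d2 by simp
      then have "s = t" using up_inj s(1) t by (auto simp: inj_on_def params_def)
      then show ?thesis using s(3) \<Phi>0[OF t] by simp
    qed
    finally show ?thesis .
  qed
  have "bij_betw \<Phi> (params d) (bvp_solutions m (- d))"
    unfolding bij_betw_def
  proof (intro conjI equalityI subsetI)
    show "inj_on \<Phi> (params d)"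
    proof (rule inj_onI)
      fix s t assume st: "s \<in> params d" "t \<in> params d" "\<Phi> s = \<Phi> t"
      \<comment> \<open>The one-sided derivative at 0 recovers f'(0) from the function alone, so
        equal solutions have equal parameters.\<close>
      have D: "(\<Phi> r has_vector_derivative G r 0) (at_right 0)" if "r \<in> params d" for r
        using conjunct1[OF flow[OF that, unfolded flow_def, rule_format, of 0]]
        by (simp add: has_real_derivative_iff_has_vector_derivative at_within_Ici_at_right)
      have "G s 0 = G t 0"
        using vector_derivative_unique_within[OF _ D[OF st(1)] D[OF st(2), folded st(3)]] by simp
      then have "up s = up t" using F(3) st d2 by simp
      then show "s = t" using up_inj st by (auto simp: inj_on_def params_def)
    qed
    fix f
    show "f \<in> bvp_solutions m (- d)" if "f \<in> \<Phi> ` params d" using that mem by blast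
    assume f: "f \<in> bvp_solutions m (- d)"
    obtain g h where C: "cflow f g h" and i: "f 0 = d" "h 0 = - 1" using bvp_concave[OF f] by auto
    obtain t where t: "0 < t" "g 0 = up t * d\<^sup>2" "level t \<le> - 1 / d ^ 3"
      using phase_param[OF C i(2)] i(1) by auto
    have tp: "t \<in> params d" using t by (simp add: params_def)
    have "f x = \<Phi> t x" for x
    proof (cases "0 \<le> x")
      case True
      show ?thesis
        by (rule flow_unique_global[OF _ flow[OF tp] _ _ _ True, of f g h])
           (use C i t F(3,4)[OF tp] \<Phi>0[OF tp] in \<open>auto simp: concave_flow_def\<close>)
    next
      case False
      then show ?thesis using f by (auto simp: bvp_solutions_def \<Phi>_def extensional_def)
    qed
    then have "f = \<Phi> t" by blast
    then show "f \<in> \<Phi> ` params d" using tp by blast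
  qed
  then show ?thesis using bound by blast
qed

text \<open>Everything is read off the graph of \<open>level\<close>, which falls from 0 to its
  minimum at \<open>c\<close> and rises back towards 0. A value strictly between the minimum and 0
  is taken exactly twice, and the open interval between the two times consists of parameters of
  unbounded solutions.\<close>

lemma solution_counts:
  "\<exists>\<gamma>\<^sub>s<0.
    (\<forall>\<gamma>>\<gamma>\<^sub>s. bvp_solutions m \<gamma> = {}) \<and>
    (\<exists>f. bvp_solutions m \<gamma>\<^sub>s = {f} \<and> bounded_on_half_line f) \<and>
    (\<forall>\<gamma><\<gamma>\<^sub>s.
       card {f \<in> bvp_solutions m \<gamma>. bounded_on_half_line f} = 2 \<and>
       infinite {f \<in> bvp_solutions m \<gamma>. \<not> bounded_on_half_line f})"
proof -
  obtain c where c: "0 < c" and dec: "\<And>s t. 0 \<le> s \<Longrightarrow> s < t \<Longrightarrow> t \<le> c \<Longrightarrow> level t < level s"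
    and inc: "\<And>s t. c \<le> s \<Longrightarrow> s < t \<Longrightarrow> level s < level t"
    using level_unimodal by blast
  have min: "level c < level t" if "0 \<le> t" "t \<noteq> c" for t
    using dec[of t c] inc[of c t] that by (cases t c rule: linorder_cases) auto
  \<comment> \<open>The value of f(0) for which the minimum of \<open>level\<close> equals
    -1/f(0)^3; the threshold is gamma_* = -D.\<close>
  define D where "D = root 3 (- 1 / level c)"
  have lc: "level c < 0" using level_neg[OF c] .
  have D: "0 < D" using lc by (simp add: D_def divide_neg_neg)
  have "D ^ 3 = - 1 / level c" unfolding D_def using lc by (intro real_root_pow_pos2) (auto simp: divide_nonpos_neg)
  then have Dc: "level c = - 1 / D ^ 3" using lc by simp
  have mono: "- 1 / x ^ 3 < - 1 / y ^ 3" if "0 < x" "x < y" for x y :: real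
    using power_strict_mono[of x y 3] that by (simp add: frac_less2)
  show ?thesis
  proof (intro exI[of _ "- D"] conjI allI impI)
    show "- D < 0" using D by simp
  next
    fix \<gamma> assume g: "- D < \<gamma>"
    show "bvp_solutions m \<gamma> = {}"
    proof (cases "0 \<le> \<gamma>")
      case True
      then show ?thesis by (rule no_solution_nonpos)
    next
      case False
      define d where "d = - \<gamma>"
      have d: "0 < d" "d < D" using False g by (auto simp: d_def)
      have "params d = {}"
      proof -
        have "- 1 / d ^ 3 < level t" if "0 < t" for t
          using mono[OF d] min[of t] that Dc by (cases "t = c") auto
        then show ?thesis by (force simp: params_def)
      qed
      then show ?thesis using solutions_param[OF d(1)] by (auto simp: d_def bij_betw_def)
    qed
  next
    have pD: "params D = {c}"
    proof (intro equalityI subsetI)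
      fix t assume t: "t \<in> params D"
      then have "\<not> level c < level t" "0 \<le> t" by (simp_all add: params_def Dc)
      then show "t \<in> {c}" using min[of t] by auto
    qed (use c Dc in \<open>simp add: params_def\<close>)
    obtain \<Phi> where "bij_betw \<Phi> {c} (bvp_solutions m (- D))" "bounded_on_half_line (\<Phi> c)"
      using solutions_param[OF D] Dc unfolding pD by auto
    then show "\<exists>f. bvp_solutions m (- D) = {f} \<and> bounded_on_half_line f"
      by (intro exI[of _ "\<Phi> c"]) (auto simp: bij_betw_def)
  next
    fix \<gamma> assume g: "\<gamma> < - D"
    define d where "d = - \<gamma>"
    have d: "0 < d" "D < d" using g D by (auto simp: d_def)
    define l where "l = - 1 / d ^ 3"
    have l: "level c < l" "l < 0" using mono[OF D d(2)] Dc d by (auto simp: l_def)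
    obtain t1 where t1: "0 \<le> t1" "t1 \<le> c" "level t1 = l"
      using IVT2'[of level c l 0] l c level_0 continuous_on_subset[OF level_continuous, of "{0..c}"] by auto
    have t1': "0 < t1" "t1 < c" using t1 l level_0 by (auto simp: order_le_less)
    have "\<forall>\<^sub>F t in at_top. l < level t \<and> c \<le> t"
      using order_tendstoD(1)[OF level_tendsto l(2)] eventually_ge_at_top by (rule eventually_conj)
    then obtain T where T: "l < level T" "c \<le> T"
      using eventually_happens'[OF trivial_limit_at_top_linorder] by blast
    obtain t2 where t2: "c \<le> t2" "t2 \<le> T" "level t2 = l"
      using IVT'[of level c l T] l T c continuous_on_subset[OF level_continuous, of "{c..T}"] by auto
    have t2': "c < t2" using t2 l by (auto simp: order_le_less)
    obtain \<Phi> where \<Phi>: "bij_betw \<Phi> (params d) (bvp_solutions m \<gamma>)"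
      and bnd: "\<And>t. t \<in> params d \<Longrightarrow> bounded_on_half_line (\<Phi> t) \<longleftrightarrow> level t = l"
      using solutions_param[OF d(1)] by (auto simp: d_def l_def)
    have inj: "inj_on \<Phi> (params d)" and img: "\<Phi> ` params d = bvp_solutions m \<gamma>"
      using \<Phi> by (auto simp: bij_betw_def)
    have "t = t1 \<or> t = t2" if "0 < t" "level t = l" for t
    proof (cases "t \<le> c")
      case True
      then have "t = t1" using dec[of t t1] dec[of t1 t] that t1 t1' by (cases t t1 rule: linorder_cases) auto
      then show ?thesis ..
    next
      case False
      then have "t = t2" using inc[of t t2] inc[of t2 t] that t2 t2' by (cases t t2 rule: linorder_cases) auto
      then show ?thesis ..
    qed
    then have two: "{t \<in> params d. level t = l} = {t1, t2}"
      using t1 t1' t2 t2' c by (auto simp: params_def l_def)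
    have "{f \<in> bvp_solutions m \<gamma>. bounded_on_half_line f} = \<Phi> ` {t \<in> params d. level t = l}"
      using bnd by (auto simp flip: img)
    moreover have "card (\<Phi> ` {t \<in> params d. level t = l}) = card {t \<in> params d. level t = l}"
      by (intro card_image inj_on_subset[OF inj]) auto
    moreover have "card {t1, t2} = 2" using t1' t2' by simp
    ultimately show "card {f \<in> bvp_solutions m \<gamma>. bounded_on_half_line f} = 2" by (simp add: two)
    \<comment> \<open>The part of the interval to the right of \<open>c\<close> already gives
      infinitely many parameters.\<close>
    have sub: "{c<..<t2} \<subseteq> {t \<in> params d. level t \<noteq> l}"
    proof
      fix t assume t: "t \<in> {c<..<t2}"
      then have "level t < l" using inc[of t t2] t2 by auto
      then show "t \<in> {t \<in> params d. level t \<noteq> l}" using t c by (auto simp: params_def l_def)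
    qed
    have "infinite {c<..<t2}" using t2' by (simp add: infinite_Ioo)
    then have "infinite (\<Phi> ` {c<..<t2})"
      using finite_imageD[OF _ inj_on_subset[OF inj]] sub by blast
    moreover have "\<Phi> ` {c<..<t2} \<subseteq> {f \<in> bvp_solutions m \<gamma>. \<not> bounded_on_half_line f}"
      using bnd sub by (auto simp flip: img)
    ultimately show "infinite {f \<in> bvp_solutions m \<gamma>. \<not> bounded_on_half_line f}"
      using finite_subset by blast
  qed
qed

end

theorem theorem3p2:
  fixes m :: real
  assumes "- 2 < m" and "m < - 1"
  shows "\<exists>\<gamma>\<^sub>s<0.
    (\<forall>\<gamma>>\<gamma>\<^sub>s. bvp_solutions m \<gamma> = {}) \<and>
    (\<exists>f. bvp_solutions m \<gamma>\<^sub>s = {f} \<and> bounded_on_half_line f) \<and>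
    (\<forall>\<gamma><\<gamma>\<^sub>s.
       card {f \<in> bvp_solutions m \<gamma>. bounded_on_half_line f} = 2 \<and>
       infinite {f \<in> bvp_solutions m \<gamma>. \<not> bounded_on_half_line f})"
proof -
  \<comment> \<open>For a = m + 2 and b = -(2m + 1), the condition 0 < a is -2 < m and the condition
    a < b is m < -1.\<close>
  interpret similarity_flow "m + 2" "- (2 * m + 1)"
    by unfold_locales (use assms in auto)
  obtain p p1 p2 where p: "concave_flow (m + 2) (- (2 * m + 1)) p p1 p2" "p2 0 = 0" "\<And>t. 0 \<le> t \<Longrightarrow> p t \<le> 1"
    using reference_exists by blast
  interpret bvp_reference m p p1 p2 1
    by unfold_locales (use p in auto)
  show ?thesis by (rule solution_counts)
qed

end
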